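(* Let $X$ be a downward skip-free continuous-time Markov chain on $\mathbb{N}$ satisfying the standing assumptions of the context. Suppose $\mathbb{P}_x[\tau_0<\infty]=1$ for all $x\ge0$, $\lambda_0>0$, and the boundary $\infty$ is non-entrance. For $\lambda\in(0,\lambda_0]$ let $\nu_\lambda$ be the probability distribution $\nu_\lambda(x):=\lambda W^{(-\lambda)}(0,x)$ ($x\ge0$). Then $$\nu_\lambda\le_{\mathrm{lr}}\nu_{\lambda'}\qquad(0<\lambda'\le\lambda\le\lambda_0).$$ In particular, the set of quasi-stationary distributions of $X$ is totally ordered by the likelihood ratio order $\le_{\mathrm{lr}}$ and $\nu_{\lambda_0}$ is its minimum element.
   Context: $\mathbb{N}=\{0,1,2,\dots\}$. $(\{X_t\}_{t\ge0},\{\mathbb{P}_x\}_{x\in\mathbb{N}})$ is a continuous-time Markov chain on $\mathbb{N}$ with càdlàg paths, whose $Q$-matrix $Q=(Q(x,y))_{x,y\ge0}$ is conservative ($\sum_{y}Q(x,y)=0$ for all $x$), killed at its explosion time $\lim_{z\to\infty}\tau_z^+$. For $A\subset\mathbb{N}$, $\tau_A:=\inf\{t>0: X_t\in A\}$ (with $\inf\emptyset=\infty$), $\tau_x:=\tau_{\{x\}}$, $\tau_z^+:=\tau_{[z,\infty)\cap\mathbb{N}}$; $Q(x):=-Q(x,x)$. $\mathbb{E}_x[Y,A]$ means $\mathbb{E}_x[Y1_A]$; $\mathbb{P}_\nu:=\sum_y\nu(y)\mathbb{P}_y$. Standing assumptions: $X$ is downward skip-free, i.e. $Q(x,y)=0$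 for $0\le y\le x-2$; $X$ is irreducible on $\mathbb{N}\setminus\{0\}$: $\mathbb{P}_x[\tau_y<\infty]>0$ for $x\ge1$, $y\ge0$; $X$ is regular on $\mathbb{N}\setminus\{0\}$: $\mathbb{P}_x[\tau_{\mathbb{N}\setminus\{x\}}>0]=1$ for $x\ge1$; and $0$ is a trap: $\mathbb{P}_0[X_t=0]=1$ for all $t$. Scale function: for $z\ge1$, $n_z$ is $Q(z)$ times the law under $\mathbb{P}_z$ of the path of $X$ after its first exit time from $z$, stopped upon returning to $z$. Thus, writing $\sigma_z:=\tau_{\mathbb{N}\setminus\{z\}}$ and $R_z:=\inf\{t>\sigma_z:X_t=z\}$, for $x<z$, $n_z[e^{-q\tau_x},\tau_x<\infty]=Q(z)\,\mathbb{E}_z[e^{-q(\tau_x-\sigma_z)},\ \tau_x<R_z]$. For $q\ge0$, $W^{(q)}(x,z):=1/n_z[e^{-q\tau_x},\tau_x<\infty]$ for $0\le x<z$ and $W^{(q)}(x,z):=0$ for $x\ge z$; $W:=W^{(0)}$. For fixed $x,y$, $q\mapsto W^{(q)}(x,y)$ is a polynomial, $W^{(q)}(x,y)=\sum_{n\ge0}q^nW^{n+1}(x,y)$ ($W^n$ = matrix power, finite sum), and this formula defines $W^{(q)}(x,y)$ for all $q\in\mathbb{C}$. Decay parameter: $\lambda_0:=\sup\{\lambda\ge0:\mathbb{E}_x[e^{\lambda\tau_0}]<\infty\text{ for some }x\ge1\}$. The boundary $\infty$ is called non-entrance if $\sum_{y\ge0}W(0,y)=\infty$. A probability distribution $\nu$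 on $\mathbb{N}$ is a quasi-stationary distribution if $\nu(y)=\mathbb{P}_\nu[X_t=y\mid\tau_0>t]$ for every $y\ge0$, $t\ge0$. Likelihood ratio order: for probability distributions $\mu,\nu$ on $\mathbb{N}$, $\mu\le_{\mathrm{lr}}\nu$ means $\mu(x)\nu(x+1)\ge\mu(x+1)\nu(x)$ for every $x\ge0$. *)

theory Defs
  imports "HOL-Probability.Probability"
begin

text \<open>
  A path is a function of time \<open>t \<ge> 0\<close> with values in \<^typ>\<open>enat\<close>; the value \<open>\<infinity>\<close> is the cemetery,
  so that a set \<open>A\<close> of states is the set \<open>enat ` A\<close> of values, which never contains the cemetery.
  Random times take values in \<^typ>\<open>ereal\<close>, where the infimum of the empty set is \<open>\<infinity>\<close>.
\<close>

definition hit :: "(real \<Rightarrow> 'a \<Rightarrow> enat) \<Rightarrow> nat set \<Rightarrow> 'a \<Rightarrow> ereal" where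
  "hit X A \<omega> = (INF t\<in>{t. 0 < t \<and> X t \<omega> \<in> enat ` A}. ereal t)"

definition return_time :: "(real \<Rightarrow> 'a \<Rightarrow> enat) \<Rightarrow> nat \<Rightarrow> 'a \<Rightarrow> ereal" where
  "return_time X z \<omega> = (INF t\<in>{t. hit X (- {z}) \<omega> < ereal t \<and> X t \<omega> = enat z}. ereal t)"

text \<open>The limit of \<open>hit X {z..}\<close> as \<open>z \<rightarrow> \<infinity>\<close>, which is monotone in \<open>z\<close>.\<close>

definition explosion_time :: "(real \<Rightarrow> 'a \<Rightarrow> enat) \<Rightarrow> 'a \<Rightarrow> ereal" where
  "explosion_time X \<omega> = (SUP z. hit X {z..} \<omega>)"

definition past :: "'a measure \<Rightarrow> (real \<Rightarrow> 'a \<Rightarrow> enat) \<Rightarrow> real \<Rightarrow> 'a set set" where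
  "past M X s = sigma_sets (space M) {X u -` B \<inter> space M | u B. 0 \<le> u \<and> u \<le> s}"

text \<open>
  All \<open>P x\<close> live on the same measurable space. In the order topology of \<^typ>\<open>enat\<close> the points of
  \<open>\<nat>\<close> are isolated. Left limits are only required before the explosion time; there paths are locally
  bounded, so these limits are automatically states. The last assumption says that \<open>Q\<close> is the matrix
  of derivatives at \<open>0\<close> of the transition function.
\<close>

locale killed_markov_chain =
  fixes P :: "nat \<Rightarrow> 'a measure" and X :: "real \<Rightarrow> 'a \<Rightarrow> enat" and Q :: "nat \<Rightarrow> nat \<Rightarrow> real"
  assumes prob_space_P: "prob_space (P x)"
    and sets_P: "sets (P x) = sets (P y)"
    and measurable_X: "0 \<le> t \<Longrightarrow> X t \<in> P x \<rightarrow>\<^sub>M count_space UNIV"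
    and start: "\<P>(\<omega> in P x. X 0 \<omega> = enat x) = 1"
    and markov: "0 \<le> s \<Longrightarrow> 0 \<le> t \<Longrightarrow> A \<in> past (P x) X s \<Longrightarrow>
      \<P>(\<omega> in P x. \<omega> \<in> A \<and> X s \<omega> = enat y \<and> X (s + t) \<omega> = enat z) =
      \<P>(\<omega> in P x. \<omega> \<in> A \<and> X s \<omega> = enat y) * \<P>(\<omega> in P y. X t \<omega> = enat z)"
    and right_continuous: "\<omega> \<in> space (P x) \<Longrightarrow> 0 \<le> t \<Longrightarrow> ((\<lambda>s. X s \<omega>) \<longlongrightarrow> X t \<omega>) (at_right t)"
    and left_limits: "\<omega> \<in> space (P x) \<Longrightarrow> 0 < t \<Longrightarrow> ereal t < explosion_time X \<omega> \<Longrightarrow>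
      \<exists>l. ((\<lambda>s. X s \<omega>) \<longlongrightarrow> l) (at_left t)"
    and killed: "\<omega> \<in> space (P x) \<Longrightarrow> 0 \<le> t \<Longrightarrow> X t \<omega> = \<infinity> \<longleftrightarrow> explosion_time X \<omega> \<le> ereal t"
    and Q_matrix: "((\<lambda>t. \<P>(\<omega> in P x. X t \<omega> = enat y)) has_real_derivative Q x y) (at_right 0)"

locale downward_skip_free_chain = killed_markov_chain P X Q
  for P :: "nat \<Rightarrow> 'a measure" and X :: "real \<Rightarrow> 'a \<Rightarrow> enat" and Q :: "nat \<Rightarrow> nat \<Rightarrow> real" +
  assumes conservative: "(\<lambda>y. Q x y) sums 0"
    and skip_free: "y + 2 \<le> x \<Longrightarrow> Q x y = 0"
    and irreducible: "1 \<le> x \<Longrightarrow> 0 < \<P>(\<omega> in P x. hit X {y} \<omega> < \<infinity>)"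
    and regular: "1 \<le> x \<Longrightarrow> \<P>(\<omega> in P x. 0 < hit X (- {x}) \<omega>) = 1"
    and trap: "0 \<le> t \<Longrightarrow> \<P>(\<omega> in P 0. X t \<omega> = enat 0) = 1"

text \<open>
  \<open>n_laplace P X Q q z x\<close> is \<open>n\<^sub>z[exp (- q \<tau>\<^sub>x), \<tau>\<^sub>x < \<infinity>]\<close> for \<open>x < z\<close> and \<open>q \<ge> 0\<close>, where \<open>n\<^sub>z\<close> is the
  excursion measure away from \<open>z\<close>; both times are finite on the event \<open>\<tau>\<^sub>x < R\<^sub>z\<close>.
\<close>

definition n_laplace ::
    "(nat \<Rightarrow> 'a measure) \<Rightarrow> (real \<Rightarrow> 'a \<Rightarrow> enat) \<Rightarrow> (nat \<Rightarrow> nat \<Rightarrow> real) \<Rightarrow> real \<Rightarrow> nat \<Rightarrow> nat \<Rightarrow> real" where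
  "n_laplace P X Q q z x = - Q z z *
     (LINT \<omega>|P z. exp (- q * real_of_ereal (hit X {x} \<omega> - hit X (- {z}) \<omega>)) *
        indicator {\<omega>. hit X {x} \<omega> < return_time X z \<omega>} \<omega>)"

text \<open>\<open>scale_nonneg P X Q q\<close> is \<open>W\<^bsup>(q)\<^esup>\<close> for real \<open>q \<ge> 0\<close>.\<close>

definition scale_nonneg ::
    "(nat \<Rightarrow> 'a measure) \<Rightarrow> (real \<Rightarrow> 'a \<Rightarrow> enat) \<Rightarrow> (nat \<Rightarrow> nat \<Rightarrow> real) \<Rightarrow> real \<Rightarrow> nat \<Rightarrow> nat \<Rightarrow> real" where
  "scale_nonneg P X Q q x z = (if x < z then 1 / n_laplace P X Q q z x else 0)"

text \<open>
  Powers of a matrix \<open>A\<close> that is upper triangular (\<open>A x y = 0\<close> for \<open>y < x\<close>): the terms with \<open>z > y\<close>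
  of the matrix product vanish.
\<close>

fun triangular_power :: "(nat \<Rightarrow> nat \<Rightarrow> real) \<Rightarrow> nat \<Rightarrow> nat \<Rightarrow> nat \<Rightarrow> real" where
  "triangular_power A 0 x y = (if x = y then 1 else 0)"
| "triangular_power A (Suc n) x y = (\<Sum>z\<le>y. A x z * triangular_power A n z y)"

text \<open>
  \<open>W\<^bsup>(q)\<^esup>\<close> for arbitrary real or complex \<open>q\<close>. Since \<open>W\<close> is strictly upper triangular, only finitely
  many terms of the series are nonzero.
\<close>

definition scale_fun ::
    "(nat \<Rightarrow> 'a measure) \<Rightarrow> (real \<Rightarrow> 'a \<Rightarrow> enat) \<Rightarrow> (nat \<Rightarrow> nat \<Rightarrow> real) \<Rightarrow>
     'b::real_normed_field \<Rightarrow> nat \<Rightarrow> nat \<Rightarrow> 'b" where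
  "scale_fun P X Q q x y =
     (\<Sum>n. q ^ n * of_real (triangular_power (scale_nonneg P X Q 0) (Suc n) x y))"

definition exp_ereal :: "ereal \<Rightarrow> ennreal" where
  "exp_ereal a = (if a = \<infinity> then \<infinity> else if a = - \<infinity> then 0 else ennreal (exp (real_of_ereal a)))"

definition decay_parameter :: "(nat \<Rightarrow> 'a measure) \<Rightarrow> (real \<Rightarrow> 'a \<Rightarrow> enat) \<Rightarrow> ereal" where
  "decay_parameter P X =
     (SUP l\<in>{l::real. 0 \<le> l \<and> (\<exists>x\<ge>1. (\<integral>\<^sup>+\<omega>. exp_ereal (ereal l * hit X {0} \<omega>) \<partial>P x) < \<infinity>)}. ereal l)"

definition non_entrance ::
    "(nat \<Rightarrow> 'a measure) \<Rightarrow> (real \<Rightarrow> 'a \<Rightarrow> enat) \<Rightarrow> (nat \<Rightarrow> nat \<Rightarrow> real) \<Rightarrow> bool" where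
  "non_entrance P X Q \<longleftrightarrow> (\<Sum>y. ennreal (scale_nonneg P X Q 0 0 y)) = \<infinity>"

definition prob_distribution :: "(nat \<Rightarrow> real) \<Rightarrow> bool" where
  "prob_distribution \<nu> \<longleftrightarrow> (\<forall>x. 0 \<le> \<nu> x) \<and> \<nu> sums 1"

definition initial_law :: "(nat \<Rightarrow> 'a measure) \<Rightarrow> (nat \<Rightarrow> real) \<Rightarrow> 'a measure" where
  "initial_law P \<nu> = measure_of (space (P 0)) (sets (P 0)) (\<lambda>A. \<Sum>y. ennreal (\<nu> y) * emeasure (P y) A)"

text \<open>
  If the conditioning event had probability \<open>0\<close>, the conditional probabilities would all be \<open>0\<close> by
  convention; as \<open>\<nu>\<close> has total mass \<open>1\<close>, the equations below exclude this.
\<close>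

definition quasi_stationary :: "(nat \<Rightarrow> 'a measure) \<Rightarrow> (real \<Rightarrow> 'a \<Rightarrow> enat) \<Rightarrow> (nat \<Rightarrow> real) \<Rightarrow> bool" where
  "quasi_stationary P X \<nu> \<longleftrightarrow> prob_distribution \<nu> \<and>
     (\<forall>y t. 0 \<le> t \<longrightarrow>
       \<nu> y = \<P>(\<omega> in initial_law P \<nu>. X t \<omega> = enat y \<bar> ereal t < hit X {0} \<omega>))"

definition lr_le :: "(nat \<Rightarrow> real) \<Rightarrow> (nat \<Rightarrow> real) \<Rightarrow> bool" where
  "lr_le \<mu> \<nu> \<longleftrightarrow> (\<forall>x. \<mu> x * \<nu> (x + 1) \<ge> \<mu> (x + 1) * \<nu> x)"

definition nu ::
    "(nat \<Rightarrow> 'a measure) \<Rightarrow> (real \<Rightarrow> 'a \<Rightarrow> enat) \<Rightarrow> (nat \<Rightarrow> nat \<Rightarrow> real) \<Rightarrow> real \<Rightarrow> nat \<Rightarrow> real" where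
  "nu P X Q l x = l * scale_fun P X Q (- l) 0 x"

end

theory Submission
  imports Defs
begin

text \<open>
  Discretising time by dyadic grids and using that the rows of \<open>Q\<close> sum to \<open>0\<close>, the probabilities of
  escaping from \<open>z\<close> to \<open>x\<close> without return to \<open>z\<close> are seen to be \<open>Q\<close>-harmonic. This gives \<open>Q W = I\<close> for
  the scale matrix \<open>W\<close>, and as these matrices are triangular up to a shift, also \<open>W Q = I\<close>. Hence
  \<open>V = W\<^bsup>(q)\<^esup>\<close> satisfies \<open>Q V = I + q V = V Q\<close> and the resolvent identity.

  For \<open>l < \<lambda>\<^sub>0\<close> the function \<open>E\<^sub>x[exp (l \<tau>\<^sub>0)]\<close> is a nondecreasing positive supersolution of \<open>Q f = - l f\<close>.
  The maximum principle for the quotient with this function makes \<open>V = W\<^bsup>(-l)\<^esup>\<close> positive and gives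
  \<open>l * (\<Sum>y. V 0 y) \<le> 1\<close>, with equality if the boundary is non-entrance; the quotient with \<open>V(\<cdot>, y + 1)\<close>
  shows that \<open>V z y / V 0 y\<close> is nondecreasing in \<open>y\<close>. Together with the resolvent identity
  \<open>V' 0 y / V 0 y = 1 + (l - l') * (\<Sum>z<y. V' 0 z * V z y / V 0 y)\<close>, where \<open>V' = W\<^bsup>(-l')\<^esup>\<close>, this is the
  likelihood ratio order.

  The quasi-stationary distributions \<open>\<nu>\<close> are the probability vectors with \<open>\<nu> Q = - l \<nu>\<close> off \<open>0\<close> and
  \<open>\<nu>(1) Q(1,0) = l\<close>, by a comparison of \<open>\<nu> p\<^sub>t\<close> with solutions of the forward differential inequality; this
  recursion has the unique solution \<open>\<nu>\<^sub>l\<close>, and \<open>l \<le> \<lambda>\<^sub>0\<close> as \<open>P\<^sub>\<nu>[\<tau>\<^sub>0 > t] = exp (- l t)\<close>.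
\<close>

section \<open>Skip-free matrices and the maximum principle\<close>

text \<open>The hypotheses provide the Markov property at fixed times and the derivatives of the
  transition function at time \<open>0\<close>, but no strong Markov property, jump chain or
  differential equation. Hence every pathwise statement is tested on grids of mesh
  \<open>1 / 2 ^ n\<close>; these see every relevant visit in the limit because a path stays for a
  positive time in each state that it enters. Identities that would come from the strong Markov
  property are recovered by linear algebra: harmonic functions of a skip-free matrix are determined
  by one value. Non-explosion follows from absorption, since the cemetery is never left.
  Supersolutions are constructed only strictly below the decay parameter. At the decay parameter
  itself nonnegativity follows by continuity, as \<open>V\<close> is a polynomial in its parameter;
  the strict positivity lost in this limit comes back from irreducibility, and it is what makes the
  likelihood ratio relation transitive and antisymmetric. The non-entrance condition enters at a
  single point, to exclude a total mass below \<open>1\<close>.\<close>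

locale skip_free_matrix =
  fixes Q W :: "nat \<Rightarrow> nat \<Rightarrow> real"
  assumes Q_sums: "(\<lambda>y. Q x y) sums 0"
    and Q_zero: "y + 2 \<le> x \<Longrightarrow> Q x y = 0"
    and Q_nonneg: "x \<noteq> y \<Longrightarrow> 0 \<le> Q x y"
    and Q_down: "0 < Q (Suc x) x"
    and W_zero: "z \<le> x \<Longrightarrow> W x z = 0"
    and Q_W: "(\<Sum>v<z. Q (Suc y) v * W v z) = (if Suc y = z then 1 else 0)"
begin

definition V :: "real \<Rightarrow> nat \<Rightarrow> nat \<Rightarrow> real" where
  "V q x y = (\<Sum>n. q ^ n * triangular_power W (Suc n) x y)"

text \<open>Every factor \<open>W\<close> raises the index by at least one, so \<open>n\<close>
  factors need a distance of at least \<open>n\<close>.\<close>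

lemma triangular_power_zero: "y < x + n \<Longrightarrow> triangular_power W n x y = 0"
proof (induction n arbitrary: x)
  case (Suc n)
  have "W x z * triangular_power W n z y = 0" if "z \<le> y" for z
    using Suc.IH[of z] Suc.prems W_zero[of z x] by (cases "z \<le> x") auto
  then show ?case unfolding triangular_power.simps by (intro sum.neutral) auto
qed auto

lemma V_eq_sum: "y \<le> N \<Longrightarrow> V q x y = (\<Sum>n<N. q ^ n * triangular_power W (Suc n) x y)"
  unfolding V_def by (rule suminf_finite) (auto simp: triangular_power_zero simp del: triangular_power.simps)

lemma V_zero: "y \<le> x \<Longrightarrow> V q x y = 0"
  by (simp add: V_eq_sum[of y y] triangular_power_zero del: triangular_power.simps)

lemma V_recursion: "V q x y = W x y + q * (\<Sum>z<y. W x z * V q z y)"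
proof -
  have 1: "(\<Sum>z\<le>y. W x z * V q z y) = (\<Sum>z<y. W x z * V q z y)"
    by (rule sum.mono_neutral_right) (auto simp: V_zero not_less)
  have "V q x y = (\<Sum>n<Suc y. q ^ n * triangular_power W (Suc n) x y)"
    by (rule V_eq_sum) simp
  also have "\<dots> = triangular_power W 1 x y + (\<Sum>n<y. q ^ Suc n * triangular_power W (Suc (Suc n)) x y)"
    by (subst sum.lessThan_Suc_shift) (simp del: triangular_power.simps)
  also have "triangular_power W 1 x y = W x y"
    by (simp add: if_distrib[of "\<lambda>t. _ * t"] cong: if_cong)
  also have "(\<Sum>n<y. q ^ Suc n * triangular_power W (Suc (Suc n)) x y) =
      q * (\<Sum>z\<le>y. W x z * (\<Sum>n<y. q ^ n * triangular_power W (Suc n) z y))"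
    unfolding triangular_power.simps(2)[of W "Suc _" x] sum_distrib_left
    by (subst sum.swap) (simp add: mult_ac del: triangular_power.simps)
  also have "\<dots> = q * (\<Sum>z\<le>y. W x z * V q z y)"
    by (simp add: V_eq_sum[of y y] del: triangular_power.simps)
  finally show ?thesis by (simp add: 1)
qed

text \<open>\<open>Q\<close> is applied to \<open>V_recursion\<close>: the relation for
  \<open>Q W\<close> yields the unit entry from the leading \<open>W\<close> and strips the factor
  \<open>W\<close> from the remaining sum.\<close>

lemma Q_V: "(\<Sum>v<z. Q (Suc y) v * V q v z) = (if Suc y = z then 1 else 0) + q * V q (Suc y) z"
proof -
  have "(\<Sum>v<z. Q (Suc y) v * V q v z) =
      (\<Sum>v<z. Q (Suc y) v * W v z) + q * (\<Sum>v<z. \<Sum>w<z. Q (Suc y) v * W v w * V q w z)"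
    by (subst V_recursion) (simp add: algebra_simps sum.distrib sum_distrib_left)
  also have "(\<Sum>v<z. \<Sum>w<z. Q (Suc y) v * W v w * V q w z) = (\<Sum>w<z. (\<Sum>v<z. Q (Suc y) v * W v w) * V q w z)"
    by (subst sum.swap) (simp add: sum_distrib_right)
  also have "\<dots> = (\<Sum>w<z. (if Suc y = w then 1 else 0) * V q w z)"
  proof (rule sum.cong[OF refl])
    fix w assume w: "w \<in> {..<z}"
    have "(\<Sum>v<z. Q (Suc y) v * W v w) = (\<Sum>v<w. Q (Suc y) v * W v w)"
      by (rule sum.mono_neutral_right) (use w in \<open>auto simp: W_zero not_less\<close>)
    then show "(\<Sum>v<z. Q (Suc y) v * W v w) * V q w z = (if Suc y = w then 1 else 0) * V q w z"
      by (simp add: Q_W)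
  qed
  also have "\<dots> = V q (Suc y) z"
    by (cases "Suc y < z") (auto simp: if_distrib[of "\<lambda>t. t * _"] V_zero cong: if_cong)
  finally show ?thesis by (simp add: Q_W)
qed

text \<open>Row \<open>Suc y\<close> of \<open>Q\<close> starts in column \<open>y\<close> and
  column \<open>Suc y\<close> of \<open>W\<close> ends in row \<open>y\<close>, so one term is left.
  In this shifted sense both matrices are triangular with nonzero diagonal.\<close>

lemma W_superdiag: "W y (Suc y) = 1 / Q (Suc y) y"
proof -
  have "(\<Sum>v<Suc y. Q (Suc y) v * W v (Suc y)) = (\<Sum>v\<in>{y}. Q (Suc y) v * W v (Suc y))"
    by (rule sum.mono_neutral_right) (auto simp: Q_zero)
  then show ?thesis using Q_W[of y "Suc y"] Q_down[of y] by (simp add: field_simps)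
qed

lemma V_superdiag: "V q y (Suc y) = 1 / Q (Suc y) y"
proof -
  have "(\<Sum>z<Suc y. W y z * V q z (Suc y)) = 0"
    by (rule sum.neutral) (auto simp: W_zero)
  then show ?thesis by (subst V_recursion) (simp add: W_superdiag)
qed

text \<open>For triangular matrices with nonzero diagonal, a right inverse is a left inverse.\<close>

lemma V_Q: "(\<Sum>z\<le>Suc y. V q x z * Q z y) = (if x = y then 1 else 0) + q * V q x y"
proof -
  define D where "D y = (\<Sum>z\<le>Suc y. V q x z * Q z y) - q * V q x y - (if x = y then 1 else 0)" for y
  \<comment> \<open>\<open>D\<close> is the defect of the asserted left identity. Multiplied by
    \<open>V\<close> from the right it vanishes, by evaluating \<open>V Q V\<close> with
    \<open>Q_V\<close>; row \<open>0\<close>, about which \<open>Q_V\<close> says nothing, drops out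
    because \<open>V q x 0 = 0\<close>.\<close>
  have key: "(\<Sum>y<z'. D y * V q y z') = 0" for z'
  proof -
    have "(\<Sum>y<z'. (\<Sum>z\<le>Suc y. V q x z * Q z y) * V q y z') = (\<Sum>y<z'. (\<Sum>z\<le>z'. V q x z * Q z y) * V q y z')"
    proof (rule sum.cong[OF refl])
      fix y assume "y \<in> {..<z'}"
      then have "(\<Sum>z\<le>Suc y. V q x z * Q z y) = (\<Sum>z\<le>z'. V q x z * Q z y)"
        by (intro sum.mono_neutral_left) (auto simp: Q_zero)
      then show "(\<Sum>z\<le>Suc y. V q x z * Q z y) * V q y z' = (\<Sum>z\<le>z'. V q x z * Q z y) * V q y z'" by simp
    qed
    also have "\<dots> = (\<Sum>z\<le>z'. V q x z * (\<Sum>y<z'. Q z y * V q y z'))"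
      unfolding sum_distrib_right sum_distrib_left by (subst sum.swap) (simp add: mult_ac)
    also have "\<dots> = (\<Sum>z\<le>z'. V q x z * ((if z = z' then 1 else 0) + q * V q z z'))"
    proof (rule sum.cong[OF refl])
      fix z
      show "V q x z * (\<Sum>y<z'. Q z y * V q y z') = V q x z * ((if z = z' then 1 else 0) + q * V q z z')"
        by (cases z) (simp_all add: V_zero Q_V)
    qed
    also have "\<dots> = V q x z' + q * (\<Sum>z\<le>z'. V q x z * V q z z')"
      by (simp add: distrib_left sum.distrib sum_distrib_left mult_ac if_distrib[of "\<lambda>t. _ * t"] cong: if_cong)
    also have "(\<Sum>z\<le>z'. V q x z * V q z z') = (\<Sum>z<z'. V q x z * V q z z')"
      by (rule sum.mono_neutral_right) (auto simp: V_zero not_less)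
    finally have 1: "(\<Sum>y<z'. (\<Sum>z\<le>Suc y. V q x z * Q z y) * V q y z') = V q x z' + q * (\<Sum>z<z'. V q x z * V q z z')" .
    have 2: "(\<Sum>y<z'. (if x = y then 1 else 0) * V q y z') = V q x z'"
      by (cases "x < z'") (auto simp: if_distrib[of "\<lambda>t. t * _"] V_zero cong: if_cong)
    show ?thesis
      unfolding D_def left_diff_distrib sum_subtractf 1 2 by (simp add: sum_distrib_left mult_ac)
  qed
  \<comment> \<open>Column \<open>Suc y\<close> of \<open>key\<close> involves \<open>D\<close> up
    to \<open>y\<close> only, with the nonzero coefficient \<open>V q y (Suc y)\<close> at
    \<open>y\<close>.\<close>
  have "D y = 0" for y
  proof (induction y rule: less_induct)
    case (less y)
    have "(\<Sum>y'<Suc y. D y' * V q y' (Suc y)) = D y * V q y (Suc y)"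
      using less by simp
    then show ?case using key[of "Suc y"] Q_down[of y] by (simp add: V_superdiag)
  qed
  then show ?thesis by (simp add: D_def algebra_simps)
qed

text \<open>The product \<open>V q' Q V q\<close> is evaluated twice, with \<open>Q_V\<close> on its
  right part and with \<open>V_Q\<close> on its left part.\<close>

lemma resolvent: "V q' x y = V q x y + (q' - q) * (\<Sum>z<y. V q' x z * V q z y)"
proof (cases y)
  case 0 then show ?thesis by (simp add: V_zero)
next
  case (Suc y0)
  have s: "(\<Sum>z\<le>y. V q' x z * V q z y) = (\<Sum>z<y. V q' x z * V q z y)"
    by (rule sum.mono_neutral_right) (auto simp: V_zero not_less)
  have "(\<Sum>z\<le>y. V q' x z * (\<Sum>w<y. Q z w * V q w y)) = (\<Sum>z\<le>y. V q' x z * ((if z = y then 1 else 0) + q * V q z y))"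
  proof (rule sum.cong[OF refl])
    fix z
    show "V q' x z * (\<Sum>w<y. Q z w * V q w y) = V q' x z * ((if z = y then 1 else 0) + q * V q z y)"
      by (cases z) (simp_all add: V_zero Q_V)
  qed
  also have "\<dots> = V q' x y + q * (\<Sum>z\<le>y. V q' x z * V q z y)"
    by (simp add: distrib_left sum.distrib sum_distrib_left mult_ac if_distrib[of "\<lambda>t. _ * t"] cong: if_cong)
  finally have 1: "(\<Sum>z\<le>y. V q' x z * (\<Sum>w<y. Q z w * V q w y)) = V q' x y + q * (\<Sum>z<y. V q' x z * V q z y)"
    by (simp add: s)
  have "(\<Sum>z\<le>y. V q' x z * (\<Sum>w<y. Q z w * V q w y)) = (\<Sum>w<y. (\<Sum>z\<le>y. V q' x z * Q z w) * V q w y)"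
    unfolding sum_distrib_right sum_distrib_left by (subst sum.swap) (simp add: mult_ac)
  also have "\<dots> = (\<Sum>w<y. (\<Sum>z\<le>Suc w. V q' x z * Q z w) * V q w y)"
  proof (rule sum.cong[OF refl])
    fix w assume "w \<in> {..<y}"
    then have "(\<Sum>z\<le>Suc w. V q' x z * Q z w) = (\<Sum>z\<le>y. V q' x z * Q z w)"
      by (intro sum.mono_neutral_left) (auto simp: Q_zero)
    then show "(\<Sum>z\<le>y. V q' x z * Q z w) * V q w y = (\<Sum>z\<le>Suc w. V q' x z * Q z w) * V q w y" by simp
  qed
  also have "\<dots> = (\<Sum>w<y. (if x = w then 1 else 0) * V q w y) + q' * (\<Sum>w<y. V q' x w * V q w y)"
    unfolding V_Q distrib_right sum.distrib by (simp add: sum_distrib_left mult.assoc)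
  also have "(\<Sum>w<y. (if x = w then 1 else 0) * V q w y) = V q x y"
    by (cases "x < y") (auto simp: if_distrib[of "\<lambda>t. t * _"] V_zero cong: if_cong)
  finally show ?thesis using 1 by (simp add: algebra_simps)
qed

lemma V_0: "V 0 = W"
  by (intro ext, subst V_recursion) simp

lemma Q_V_sums: "(\<lambda>v. Q (Suc y) v * V q v z) sums ((if Suc y = z then 1 else 0) + q * V q (Suc y) z)"
  unfolding Q_V[symmetric] by (rule sums_finite) (auto simp: V_zero)

text \<open>
  Equality in \<open>Q (m f - g) \<le> - l (m f - g)\<close> at a point where \<open>m f - g\<close> vanishes spreads from \<open>x\<close> to
  \<open>x - 1\<close>, so the maximum of \<open>g / f\<close> is also attained at the left end point.
\<close>

lemma maximum_principle:
  fixes f g :: "nat \<Rightarrow> real"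
  assumes f_nonneg: "\<And>w. 0 \<le> f w" and f_pos: "\<And>w. a \<le> w \<Longrightarrow> w \<le> N \<Longrightarrow> 0 < f w"
    and f_summable: "\<And>x. a < x \<Longrightarrow> x \<le> N \<Longrightarrow> summable (\<lambda>w. Q x w * f w)"
    and f_super: "\<And>x. a < x \<Longrightarrow> x \<le> N \<Longrightarrow> (\<Sum>w. Q x w * f w) \<le> - l * f x"
    and g_sums: "\<And>x. a < x \<Longrightarrow> x \<le> N \<Longrightarrow> (\<lambda>w. Q x w * g w) sums (- l * g x)"
    and g_pos: "\<exists>x. a < x \<and> x \<le> N \<and> 0 \<le> g x"
    and g_right: "\<And>w. N < w \<Longrightarrow> \<exists>x. a < x \<and> x \<le> N \<and> g w * f x \<le> g x * f w"
    and x: "a < x" "x \<le> N"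
  shows "g x * f a \<le> g a * f x"
proof (rule ccontr)
  assume neg: "\<not> ?thesis"
  define r where "r x = g x / f x" for x
  define m where "m = Max (r ` {a<..N})"
  have fin: "finite (r ` {a<..N})" by simp
  have ne: "r ` {a<..N} \<noteq> {}" using x by auto
  have r_le: "r w \<le> m" if "a < w" "w \<le> N" for w
    unfolding m_def by (rule Max_ge[OF fin]) (use that in auto)
  \<comment> \<open>\<open>f_super\<close> is only an inequality and will be multiplied by
    \<open>m\<close>; \<open>g_pos\<close> secures the sign.\<close>
  have m_nonneg: "0 \<le> m"
  proof -
    from g_pos obtain y where y: "a < y" "y \<le> N" "0 \<le> g y" by auto
    then have "0 \<le> r y" using f_pos[of y] by (simp add: r_def)
    then show ?thesis using r_le[OF y(1,2)] by simp
  qed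
  have r0: "r a < r x"
    using neg f_pos[of a] f_pos[of x] x by (simp add: r_def field_simps not_le)
  have d_nonneg: "0 \<le> m * f w - g w" if w: "a \<le> w" for w
  proof -
    consider "w = a" | "a < w" "w \<le> N" | "N < w" using w by linarith
    then show ?thesis
    proof cases
      case 1
      then have "r w \<le> m" using r0 r_le[OF x] by simp
      then show ?thesis using f_pos[of w] w 1 x by (simp add: r_def field_simps)
    next
      case 2 then show ?thesis using r_le[OF 2] f_pos[of w] by (simp add: r_def field_simps)
    next
      case 3
      from g_right[OF 3] obtain y where y: "a < y" "y \<le> N" "g w * f y \<le> g y * f w" by auto
      have fy: "0 < f y" using f_pos y by simp
      have "g w \<le> r y * f w" using y(3) fy by (simp add: r_def field_simps)
      also have "\<dots> \<le> m * f w" using r_le[OF y(1,2)] f_nonneg[of w] by (rule mult_right_mono)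
      finally show ?thesis by simp
    qed
  qed
  have "m \<in> r ` {a<..N}" unfolding m_def by (rule Max_in[OF fin ne])
  then have ex: "\<exists>x. a < x \<and> x \<le> N \<and> r x = m" by auto
  \<comment> \<open>The leftmost maximiser: its left neighbour will turn out to be a maximiser too,
    which leaves only \<open>a\<close>, where the ratio is smaller than \<open>m\<close>.\<close>
  define z where "z = (LEAST x. a < x \<and> x \<le> N \<and> r x = m)"
  have z: "a < z" "z \<le> N" "r z = m" using LeastI_ex[OF ex] unfolding z_def by auto
  have z_least: "z \<le> w" if "a < w" "w \<le> N" "r w = m" for w
    unfolding z_def by (rule Least_le) (use that in auto)
  obtain z1 where z1: "z = Suc z1" using z(1) by (cases z) auto
  have d0: "m * f z - g z = 0" using z(3) f_pos[of z] z by (simp add: r_def field_simps)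
  have t_nonneg: "0 \<le> Q z w * (m * f w - g w)" for w
  proof (cases "w = z")
    case False
    show ?thesis
    proof (cases "a \<le> w")
      case True then show ?thesis using d_nonneg Q_nonneg[of z w] False by simp
    next
      case False
      then have "Q z w = 0" using z(1) by (intro Q_zero) simp
      then show ?thesis by simp
    qed
  qed (simp add: d0)
  have sm: "summable (\<lambda>w. Q z w * (m * f w - g w))"
    using summable_diff[OF summable_mult[OF f_summable[OF z(1,2)], of m] sums_summable[OF g_sums[OF z(1,2)]]]
    by (simp add: algebra_simps)
  have "(\<Sum>w. Q z w * (m * f w - g w)) = m * (\<Sum>w. Q z w * f w) - (\<Sum>w. Q z w * g w)"
    using suminf_diff[OF summable_mult[OF f_summable[OF z(1,2)], of m] sums_summable[OF g_sums[OF z(1,2)]]]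
      suminf_mult[OF f_summable[OF z(1,2)], of m]
    by (simp add: algebra_simps)
  also have "\<dots> = m * (\<Sum>w. Q z w * f w) + l * g z" using sums_unique[OF g_sums[OF z(1,2)]] by simp
  also have "\<dots> \<le> m * (- l * f z) + l * g z" using mult_left_mono[OF f_super[OF z(1,2)] m_nonneg] by simp
  also have "\<dots> = - l * (m * f z - g z)" by (simp add: algebra_simps)
  finally have "(\<Sum>w. Q z w * (m * f w - g w)) \<le> 0" using d0 by simp
  then have "(\<Sum>w. Q z w * (m * f w - g w)) = 0"
    using suminf_nonneg[OF sm] t_nonneg by (intro antisym) auto
  then have "Q z z1 * (m * f z1 - g z1) = 0"
    using suminf_eq_zero_iff[OF sm] t_nonneg by auto
  then have d1: "m * f z1 = g z1" using Q_down[of z1] z1 by simp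
  have "0 < f z1" by (rule f_pos) (use z z1 in auto)
  then have rz1: "r z1 = m" using d1 by (simp add: r_def field_simps)
  show False
  proof (cases "z1 = a")
    case True then show False using rz1 r0 r_le[OF x] by simp
  next
    case False then show False using z_least[of z1] rz1 z z1 by simp
  qed
qed

text \<open>Row \<open>0\<close> is left out: for the chain it vanishes, and a positive function
  could not satisfy the inequality there if \<open>l > 0\<close>.\<close>

definition supersolution :: "real \<Rightarrow> (nat \<Rightarrow> real) \<Rightarrow> bool" where
  "supersolution l f \<longleftrightarrow> (\<forall>x. 0 < f x) \<and>
     (\<forall>x. summable (\<lambda>w. Q (Suc x) w * f w) \<and> (\<Sum>w. Q (Suc x) w * f w) \<le> - l * f (Suc x))"

text \<open>Induction from \<open>N\<close> downwards: on \<open>{x<..N}\<close> the maximum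
  principle with left end point \<open>x\<close> bounds \<open>g x / f x\<close> from below by the
  positive number \<open>g (Suc x) / f (Suc x)\<close>.\<close>

lemma positive_to_the_left:
  assumes f: "supersolution l f"
    and g_sums: "\<And>x. Suc x \<le> N \<Longrightarrow> (\<lambda>w. Q (Suc x) w * g w) sums (- l * g (Suc x))"
    and g_pos: "0 < g N" and g_right: "\<And>w. N < w \<Longrightarrow> g w * f N \<le> g N * f w"
    and "x \<le> N"
  shows "0 < g x"
  using \<open>x \<le> N\<close>
proof (induction "N - x" arbitrary: x rule: less_induct)
  case less
  show ?case
  proof (cases "x = N")
    case False
    then have xN: "x < N" using less.prems by simp
    have f_pos: "0 < f w" for w using f by (simp add: supersolution_def)
    have IH: "0 < g (Suc x)" by (rule less.hyps) (use xN in auto)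
    have "g (Suc x) * f x \<le> g x * f (Suc x)"
    proof (rule maximum_principle[where N = N and l = l])
      show "summable (\<lambda>w. Q z w * f w)" "(\<Sum>w. Q z w * f w) \<le> - l * f z" if "x < z" for z
        using f that by (auto simp: supersolution_def gr0_conv_Suc dest!: less_imp_Suc_add)
      show "(\<lambda>w. Q z w * g w) sums (- l * g z)" if "x < z" "z \<le> N" for z
        using g_sums[of "z - 1"] that by auto
      show "\<exists>z>x. z \<le> N \<and> 0 \<le> g z" using IH xN by (intro exI[of _ "Suc x"]) auto
      show "\<exists>z>x. z \<le> N \<and> g w * f z \<le> g z * f w" if "N < w" for w
        using g_right[OF that] xN by blast
    qed (use f_pos xN in \<open>auto simp: less_imp_le\<close>)
    moreover have "0 < g (Suc x) * f x" using IH f_pos by simp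
    ultimately show ?thesis using f_pos[of "Suc x"] by (metis less_le_trans zero_less_mult_pos2)
  qed (use g_pos in simp)
qed

text \<open>The column \<open>y = Suc N\<close> has the positive superdiagonal entry
  \<open>1 / Q (Suc N) N\<close> and vanishes below it, so positivity spreads from row
  \<open>N\<close> to the left.\<close>

lemma V_pos:
  assumes f: "supersolution l f" and "x < y"
  shows "0 < V (- l) x y"
proof -
  obtain N where y: "y = Suc N" using \<open>x < y\<close> by (cases y) auto
  show ?thesis
  proof (rule positive_to_the_left[where g = "\<lambda>x. V (- l) x y", OF f])
    show "(\<lambda>w. Q (Suc z) w * V (- l) w y) sums (- l * V (- l) (Suc z) y)" if "Suc z \<le> N" for z
      using Q_V_sums[of z "- l" y] that y by simp
    show "V (- l) w y * f N \<le> V (- l) N y * f w" if "N < w" for w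
      using that f y Q_down[of N] by (simp add: V_zero V_superdiag supersolution_def less_imp_le)
  qed (use \<open>x < y\<close> y in \<open>simp_all add: V_superdiag Q_down\<close>)
qed

lemma supersolution_1: "supersolution 0 (\<lambda>_. 1)"
  using Q_sums by (simp add: supersolution_def sums_iff)

lemma W_pos: "x < y \<Longrightarrow> 0 < W x y"
  using V_pos[OF supersolution_1] by (simp add: V_0)

lemma W_nonneg: "0 \<le> W x y"
  by (cases "x < y") (auto simp: W_zero W_pos less_imp_le)

text \<open>Constants are harmonic, so the maximum principle applies with \<open>f = 1\<close> and
  rate \<open>0\<close>. The bound will control the convolution with \<open>W\<close> when the total
  mass is computed.\<close>

lemma W_antimono:
  assumes "z < y"
  shows "W z y \<le> W 0 y"
proof (cases "z = 0")
  case False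
  have "W z y * 1 \<le> W 0 y * 1"
  proof (rule maximum_principle[where f = "\<lambda>_. 1" and g = "\<lambda>w. W w y" and N = "y - 1" and l = 0 and a = 0])
    show "summable (\<lambda>w. Q x w * 1)" "(\<Sum>w. Q x w * 1) \<le> - 0 * 1" for x
      using Q_sums[of x] by (auto simp: sums_iff)
    show "(\<lambda>w. Q x w * W w y) sums (- 0 * W x y)" if "0 < x" "x \<le> y - 1" for x
    proof -
      have "x \<noteq> y" using that by auto
      then show ?thesis using Q_V_sums[of "x - 1" 0 y] that by (simp add: V_0)
    qed
    show "\<exists>x>0. x \<le> y - 1 \<and> 0 \<le> W x y"
      using assms False by (intro exI[of _ z]) (auto simp: W_nonneg)
    show "\<exists>x>0. x \<le> y - 1 \<and> W w y * 1 \<le> W x y * 1" if "y - 1 < w" for w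
      using assms False that by (intro exI[of _ z]) (auto simp: W_nonneg W_zero)
  qed (use assms False in auto)
  then show ?thesis by simp
qed simp

text \<open>Analogue of the second scale function of one-sided processes, at the parameter
  \<open>- l\<close> and with the summation cut at \<open>n\<close>. At \<open>x = 0\<close> it is
  the mass that the candidate distribution still misses after \<open>n\<close>.\<close>

definition Z :: "real \<Rightarrow> nat \<Rightarrow> nat \<Rightarrow> real" where
  "Z l x n = 1 - l * (\<Sum>y\<le>n. V (- l) x y)"

text \<open>\<open>Q\<close> annihilates the constant \<open>1\<close>; for
  \<open>Suc x \<le> n\<close> the unit entry of \<open>Q_V\<close> occurs exactly once in the sum
  and restores it.\<close>

lemma Z_sums:
  assumes "Suc x \<le> n"
  shows "(\<lambda>w. Q (Suc x) w * Z l w n) sums (- l * Z l (Suc x) n)"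
proof -
  have "(\<lambda>w. Q (Suc x) w - l * (\<Sum>y\<le>n. Q (Suc x) w * V (- l) w y)) sums
      (0 - l * (\<Sum>y\<le>n. (if Suc x = y then 1 else 0) + (- l) * V (- l) (Suc x) y))"
    by (intro sums_diff Q_sums sums_mult sums_sum Q_V_sums)
  moreover have "(\<Sum>y\<le>n. (if Suc x = y then 1 else 0) + (- l) * V (- l) (Suc x) y) = Z l (Suc x) n"
    using assms by (simp add: Z_def sum.distrib sum_distrib_left sum_negf sum_subtractf)
  ultimately have "(\<lambda>w. Q (Suc x) w - l * (\<Sum>y\<le>n. Q (Suc x) w * V (- l) w y)) sums (0 - l * Z l (Suc x) n)"
    by (simp only:)
  moreover have "Q (Suc x) w * Z l w n = Q (Suc x) w - l * (\<Sum>y\<le>n. Q (Suc x) w * V (- l) w y)" for w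
    unfolding Z_def sum_distrib_left[symmetric] by (simp add: algebra_simps)
  ultimately show ?thesis by simp
qed

text \<open>To the right of \<open>n\<close> all entries of \<open>V\<close> vanish and
  \<open>Z\<close> is \<open>1\<close>, as it is at \<open>n\<close>. The boundary condition of the
  comparison becomes \<open>f n \<le> f w\<close>, which is where monotonicity of \<open>f\<close>
  enters.\<close>

lemma Z_pos:
  assumes f: "supersolution l f" "mono f" and "x \<le> n"
  shows "0 < Z l x n"
proof (rule positive_to_the_left[where g = "\<lambda>x. Z l x n", OF f(1) Z_sums _ _ \<open>x \<le> n\<close>])
  show "Z l w n * f n \<le> Z l n n * f w" if "n < w" for w
    using that f(2) by (simp add: Z_def V_zero mono_def)
qed (simp_all add: Z_def V_zero)

text \<open>The given \<open>f\<close> only supplies positivity. The comparison function is column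
  \<open>Suc y\<close>, which satisfies the eigenvalue equation exactly in rows \<open>1\<close> to
  \<open>y - 1\<close>, as does column \<open>y\<close>, since the unit entries lie in later
  rows.\<close>

lemma V_ratio_mono:
  assumes f: "supersolution l f"
  shows "V (- l) z y * V (- l) 0 (Suc y) \<le> V (- l) z (Suc y) * V (- l) 0 y"
proof -
  have nn: "0 \<le> V (- l) x y" for x y
    using V_pos[OF f, of x y] by (cases "x < y") (auto simp: V_zero less_imp_le)
  consider "z = 0" | "0 < z" "z < y" | "y \<le> z" by linarith
  then show ?thesis
  proof cases
    case 2
    have "V (- l) z y * V (- l) 0 (Suc y) \<le> V (- l) 0 y * V (- l) z (Suc y)"
    proof (rule maximum_principle[where f = "\<lambda>w. V (- l) w (Suc y)" and g = "\<lambda>w. V (- l) w y" and N = "y - 1" and l = l and a = 0])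
      show "summable (\<lambda>w. Q x w * V (- l) w (Suc y))"
          "(\<Sum>w. Q x w * V (- l) w (Suc y)) \<le> - l * V (- l) x (Suc y)" if "0 < x" "x \<le> y - 1" for x
        using Q_V_sums[of "x - 1" "- l" "Suc y"] that by (auto simp: sums_iff)
      show "(\<lambda>w. Q x w * V (- l) w y) sums (- l * V (- l) x y)" if "0 < x" "x \<le> y - 1" for x
        using Q_V_sums[of "x - 1" "- l" y] that by (auto split: if_splits)
      show "\<exists>x>0. x \<le> y - 1 \<and> 0 \<le> V (- l) x y"
        using 2 nn by (intro exI[of _ z]) auto
      show "\<exists>x>0. x \<le> y - 1 \<and> V (- l) w y * V (- l) x (Suc y) \<le> V (- l) x y * V (- l) w (Suc y)" if "y - 1 < w" for w
        using 2 nn that by (intro exI[of _ z]) (auto simp: V_zero)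
    qed (use 2 nn f in \<open>auto intro!: V_pos\<close>)
    then show ?thesis by (simp add: mult.commute)
  qed (auto simp: V_zero nn)
qed

lemma V_isCont: "isCont (\<lambda>l. V (- l) x y) l"
  unfolding V_eq_sum[OF order_refl] by (intro continuous_intros)

text \<open>The equation in column \<open>n\<close> determines \<open>\<nu> (Suc n)\<close>, because
  \<open>Q (Suc n) n\<close> is nonzero; row \<open>0\<close> of \<open>V_Q\<close>, multiplied by
  \<open>l\<close>, is the same recursion.\<close>

lemma left_solution_unique:
  assumes left: "\<And>y. (\<Sum>z\<le>Suc y. \<nu> z * Q z y) = (if y = 0 then l else 0) - l * \<nu> y" and "\<nu> 0 = 0"
  shows "\<nu> y = l * V (- l) 0 y"
proof (induction y rule: less_induct)
  case (less y)
  show ?case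
  proof (cases y)
    case 0 then show ?thesis using \<open>\<nu> 0 = 0\<close> by (simp add: V_zero)
  next
    case (Suc n)
    have "(\<Sum>z\<le>n. \<nu> z * Q z n) + \<nu> y * Q y n = (if n = 0 then l else 0) - l * \<nu> n"
      using left[of n] Suc by simp
    moreover have "(\<Sum>z\<le>n. \<nu> z * Q z n) = l * (\<Sum>z\<le>n. V (- l) 0 z * Q z n)"
      using less Suc by (simp add: sum_distrib_left mult.assoc)
    moreover have "\<nu> n = l * V (- l) 0 n" using less Suc by simp
    moreover have "l * (\<Sum>z\<le>n. V (- l) 0 z * Q z n) + l * V (- l) 0 y * Q y n = (if n = 0 then l else 0) - l * (l * V (- l) 0 n)"
      using arg_cong[OF V_Q[of "- l" 0 n], of "\<lambda>t. l * t"] Suc by (auto simp: algebra_simps)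
    ultimately have "\<nu> y * Q y n = l * V (- l) 0 y * Q y n"
      by (metis add_left_cancel)
    then show ?thesis using Q_down[of n] Suc by simp
  qed
qed

end

section \<open>Rates up to and including the decay parameter\<close>

locale decaying_skip_free_matrix = skip_free_matrix Q W for Q W +
  fixes l0 :: real
  assumes ex_supersolution: "0 < l \<Longrightarrow> l < l0 \<Longrightarrow> \<exists>f. supersolution l f \<and> mono f"
    and upward: "2 \<le> b \<Longrightarrow> \<exists>z c. 0 < z \<and> z < b \<and> b \<le> c \<and> Q z c \<noteq> 0"
    and W_not_summable: "\<not> summable (W 0)"
begin

text \<open>Supersolutions are supplied strictly below \<open>l0\<close>; at \<open>l0\<close>
  inequalities are taken over as left limits in the rate.\<close>

lemma nonneg_at_l0:
  fixes g :: "real \<Rightarrow> real"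
  assumes "isCont g l0" "\<And>l. 0 < l \<Longrightarrow> l < l0 \<Longrightarrow> 0 \<le> g l" "0 < l" "l \<le> l0"
  shows "0 \<le> g l"
proof (cases "l = l0")
  case True
  have "0 \<le> g l0"
  proof (rule tendsto_lowerbound)
    show "(g \<longlongrightarrow> g l0) (at_left l0)"
      using assms(1) by (simp add: isCont_def filterlim_at_split)
    show "\<forall>\<^sub>F x in at_left l0. 0 \<le> g x"
      unfolding eventually_at_left_field using assms(2-4) True by (intro exI[of _ 0]) auto
  qed simp
  then show ?thesis using True by simp
qed (use assms in auto)

lemma V_nonneg: "0 < l \<Longrightarrow> l \<le> l0 \<Longrightarrow> 0 \<le> V (- l) x y"
proof (rule nonneg_at_l0[where g = "\<lambda>l. V (- l) x y"])
  fix l assume "0 < l" "l < l0"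
  then obtain f where "supersolution l f" using ex_supersolution by blast
  from V_pos[OF this, of x y] show "0 \<le> V (- l) x y"
    by (cases "x < y") (auto simp: V_zero less_imp_le)
qed (rule V_isCont)

lemma Z_nonneg: "0 < l \<Longrightarrow> l \<le> l0 \<Longrightarrow> 0 \<le> Z l 0 n"
proof (rule nonneg_at_l0[where g = "\<lambda>l. Z l 0 n"])
  fix l assume "0 < l" "l < l0"
  then obtain f where "supersolution l f" "mono f" using ex_supersolution by blast
  from Z_pos[OF this, of 0 n] show "0 \<le> Z l 0 n" by simp
next
  show "isCont (\<lambda>l. Z l 0 n) l0" unfolding Z_def by (intro continuous_intros V_isCont)
qed

lemma V_sums:
  assumes l: "0 < l" "l \<le> l0"
  shows "(\<lambda>y. l * V (- l) 0 y) sums 1"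
proof -
  define u where "u = V (- l) 0"
  have u_nonneg: "0 \<le> u y" for y using V_nonneg[OF l] by (simp add: u_def)
  have part: "(\<Sum>y<n. u y) \<le> 1 / l" for n
  proof -
    have "(\<Sum>y<n. u y) \<le> (\<Sum>y\<le>n. u y)" by (intro sum_mono2) (auto simp: u_nonneg)
    then show ?thesis using Z_nonneg[OF l, of n] l by (simp add: Z_def u_def field_simps) (smt (verit) mult_left_mono)
  qed
  have sm: "summable u" by (rule summableI_nonneg_bounded[OF u_nonneg part])
  have u_le: "(\<Sum>y<n. u y) \<le> suminf u" for n by (rule sum_le_suminf[OF sm]) (auto simp: u_nonneg)
  have "suminf u \<le> 1 / l" by (rule suminf_le_const[OF sm part])
  \<comment> \<open>The missing mass. The resolvent identity between the rates \<open>- l\<close>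
    and \<open>0\<close> reads \<open>u = W 0 - l u W\<close>; together with
    \<open>W_antimono\<close> it bounds \<open>u\<close> below by \<open>\<kappa> * W 0\<close>, so
    a positive \<open>\<kappa>\<close> would make \<open>W 0\<close> summable.\<close>
  define \<kappa> where "\<kappa> = 1 - l * suminf u"
  have k0: "0 \<le> \<kappa>" using \<open>suminf u \<le> 1 / l\<close> l by (simp add: \<kappa>_def field_simps)
  have low: "\<kappa> * W 0 y \<le> u y" for y
  proof -
    have "(\<Sum>z<y. u z * W z y) \<le> (\<Sum>z<y. u z * W 0 y)"
      by (intro sum_mono mult_left_mono W_antimono u_nonneg) auto
    also have "\<dots> \<le> suminf u * W 0 y"
      unfolding sum_distrib_right[symmetric] by (intro mult_right_mono u_le W_nonneg)
    finally have "l * (\<Sum>z<y. u z * W z y) \<le> l * (suminf u * W 0 y)" using l by simp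
    then show ?thesis using resolvent[of "- l" 0 y 0] by (simp add: u_def[symmetric] V_0 \<kappa>_def algebra_simps)
  qed
  have "\<kappa> = 0"
  proof (rule ccontr)
    assume "\<kappa> \<noteq> 0"
    then have "0 < \<kappa>" using k0 by simp
    then have "W 0 y \<le> (1 / \<kappa>) * u y" for y using low[of y] by (simp add: field_simps)
    then have "summable (W 0)"
      by (intro summable_comparison_test'[OF summable_mult[OF sm, of "1 / \<kappa>"], of 0])
        (auto simp: W_nonneg)
    then show False using W_not_summable by simp
  qed
  then show ?thesis
    using sums_mult[OF summable_sums[OF sm], of l] by (simp add: \<kappa>_def u_def)
qed

text \<open>At \<open>l0\<close> only nonnegativity is known. If \<open>u = V (- l) 0\<close>
  vanishes at some \<open>c > 0\<close>, column \<open>c\<close> of \<open>V_Q\<close> is a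
  vanishing sum of nonnegative terms, so \<open>u z * Q z c = 0\<close> for all
  \<open>z \<le> Suc c\<close>. Hence zeros spread to the right of the first one, \<open>b\<close>,
  and no jump leads from \<open>{1..<b}\<close> to \<open>{b..}\<close>, against
  \<open>upward\<close>.\<close>

lemma V_0_pos:
  assumes l: "0 < l" "l \<le> l0" and "0 < y"
  shows "0 < V (- l) 0 y"
proof (rule ccontr)
  define u where "u = V (- l) 0"
  have u_nonneg: "0 \<le> u y" for y using V_nonneg[OF l] by (simp add: u_def)
  assume "\<not> 0 < V (- l) 0 y"
  then have ex: "\<exists>y. 0 < y \<and> u y = 0" using \<open>0 < y\<close> u_nonneg[of y] by (auto simp: u_def intro!: exI[of _ y])
  define b where "b = (LEAST y. 0 < y \<and> u y = 0)"
  have b: "0 < b" "u b = 0" using LeastI_ex[OF ex] unfolding b_def by auto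
  have before: "0 < u z" if "0 < z" "z < b" for z
    using not_less_Least[of z "\<lambda>y. 0 < y \<and> u y = 0"] that u_nonneg[of z] unfolding b_def by force
  have "u 1 \<noteq> 0" using V_superdiag[of "- l" 0] Q_down[of 0] by (simp add: u_def)
  then have b2: "2 \<le> b" using b by (cases "b = 1") auto
  have vanish: "u z * Q z c = 0" if "u c = 0" "z \<le> Suc c" "0 < c" for z c
  proof -
    have "(\<Sum>z\<le>Suc c. u z * Q z c) = 0"
      using V_Q[of "- l" 0 c] that by (simp add: u_def)
    moreover have "\<forall>z\<in>{..Suc c}. 0 \<le> u z * Q z c"
      using u_nonneg Q_nonneg that(1) by (metis mult_eq_0_iff mult_nonneg_nonneg order_refl)
    ultimately have "\<forall>z\<in>{..Suc c}. u z * Q z c = 0"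
      using sum_nonneg_eq_0_iff[of "{..Suc c}" "\<lambda>z. u z * Q z c"] by simp
    then show ?thesis using that by simp
  qed
  have zero: "u c = 0" if "b \<le> c" for c
    using that
  proof (induction c rule: dec_induct)
    case (step n)
    then show ?case using vanish[of n "Suc n"] b Q_down[of n] by simp
  qed (rule b)
  obtain z c where "0 < z" "z < b" "b \<le> c" "Q z c \<noteq> 0" using upward[OF b2] by blast
  then show False using vanish[of c z] zero[of c] before[of z] by auto
qed

text \<open>The sums in the resolvent identity are compared termwise by \<open>V_ratio_mono\<close>;
  passing from \<open>x\<close> to \<open>Suc x\<close> adds only the nonnegative term
  \<open>z = x\<close>. As \<open>V_ratio_mono\<close> needs a supersolution, \<open>l = l0\<close>
  is reached as a limit of rates \<open>k < l0\<close> with \<open>l'\<close> fixed, while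
  \<open>l' = l0\<close> forces \<open>l = l'\<close>.\<close>

lemma V_lr:
  assumes l: "0 < l'" "l' \<le> l" "l \<le> l0"
  shows "V (- l) 0 (Suc x) * V (- l') 0 x \<le> V (- l) 0 x * V (- l') 0 (Suc x)"
proof (cases "l' = l0")
  case False
  have "0 \<le> V (- k) 0 x * V (- l') 0 (Suc x) - V (- k) 0 (Suc x) * V (- l') 0 x"
    if k: "l' \<le> k" "k < l0" for k
  proof -
    obtain f where f: "supersolution k f" using ex_supersolution[of k] k l by auto
    define u where "u = V (- k) 0"
    define u' where "u' = V (- l') 0"
    define R where "R = V (- k)"
    have u'_eq: "u' y = u y + (k - l') * (\<Sum>z<y. u' z * R z y)" for y
      using resolvent[of "- l'" 0 y "- k"] by (simp add: u_def u'_def R_def)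
    have nn: "0 \<le> u' z" "0 \<le> R z y" "0 \<le> u z" for z y
      using V_nonneg l k by (auto simp: u_def u'_def R_def)
    have "(\<Sum>z<x. u' z * R z x) * u (Suc x) = (\<Sum>z<x. u' z * (R z x * u (Suc x)))"
      by (simp add: sum_distrib_right mult.assoc)
    also have "\<dots> \<le> (\<Sum>z<x. u' z * (R z (Suc x) * u x))"
      using V_ratio_mono[OF f] nn by (intro sum_mono mult_left_mono) (auto simp: R_def u_def)
    also have "\<dots> \<le> (\<Sum>z<Suc x. u' z * (R z (Suc x) * u x))" using nn by simp
    finally have "(k - l') * ((\<Sum>z<x. u' z * R z x) * u (Suc x)) \<le> (k - l') * (\<Sum>z<Suc x. u' z * (R z (Suc x) * u x))"
      using k by (intro mult_left_mono) auto
    also have "(\<Sum>z<Suc x. u' z * (R z (Suc x) * u x)) = (\<Sum>z<Suc x. u' z * R z (Suc x)) * u x"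
      by (simp only: sum_distrib_right mult.assoc)
    finally show ?thesis
      unfolding u_def[symmetric] u'_def[symmetric] u'_eq[of x] u'_eq[of "Suc x"]
      by (simp add: algebra_simps)
  qed
  note * = this
  show ?thesis
  proof (cases "l = l0")
    case True
    have "0 \<le> V (- l0) 0 x * V (- l') 0 (Suc x) - V (- l0) 0 (Suc x) * V (- l') 0 x"
    proof (rule tendsto_lowerbound)
      let ?g = "\<lambda>k. V (- k) 0 x * V (- l') 0 (Suc x) - V (- k) 0 (Suc x) * V (- l') 0 x"
      have "isCont ?g l0" by (intro continuous_intros V_isCont)
      then show "(?g \<longlongrightarrow> ?g l0) (at_left l0)" by (simp add: isCont_def filterlim_at_split)
      show "\<forall>\<^sub>F k in at_left l0. 0 \<le> ?g k"
        unfolding eventually_at_left_field using * l False by (intro exI[of _ l']) auto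
    qed simp
    then show ?thesis using True by simp
  next
    case False then show ?thesis using *[of l] l by simp
  qed
qed (use l in simp)

end

section \<open>Paths and transition function\<close>

lemma disjoint_family_natI:
  fixes A :: "nat \<Rightarrow> 'b set"
  assumes "\<And>j k. j < k \<Longrightarrow> A j \<inter> A k = {}"
  shows "disjoint_family A"
  unfolding disjoint_family_on_def using assms by (metis Int_commute linorder_less_linear)

text \<open>An intersection over all \<open>n \<ge> N\<close> is no likelier than any of its
  members, hence null; there are countably many \<open>N\<close>.\<close>

lemma AE_not_eventually_if_prob_tendsto_0:
  assumes "prob_space M" "\<And>n. F n \<in> sets M" "(\<lambda>n. measure M (F n)) \<longlonglongrightarrow> 0"
  shows "AE \<omega> in M. \<not> (\<forall>\<^sub>F n in sequentially. \<omega> \<in> F n)"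
proof -
  interpret prob_space M by fact
  have "AE \<omega> in M. \<not> (\<forall>n\<ge>N. \<omega> \<in> F n)" for N
  proof -
    let ?I = "\<Inter>n\<in>{N..}. F n"
    have I: "?I \<in> sets M" using assms(2) by auto
    have "measure M ?I \<le> 0"
    proof (rule LIMSEQ_le_const[OF assms(3)])
      show "\<exists>N'. \<forall>n\<ge>N'. measure M ?I \<le> measure M (F n)"
        using assms(2) I by (intro exI[of _ N] allI impI finite_measure_mono) auto
    qed
    then have "measure M ?I = 0" by (simp add: antisym)
    then have "?I \<in> null_sets M" using I by (simp add: emeasure_eq_measure null_setsI)
    then show ?thesis by (rule AE_I') auto
  qed
  then have "AE \<omega> in M. \<forall>N. \<not> (\<forall>n\<ge>N. \<omega> \<in> F n)" by (simp add: AE_all_countable)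
  then show ?thesis by (auto simp: eventually_sequentially)
qed

context killed_markov_chain
begin

sublocale P: prob_space "P x" for x
  by (rule prob_space_P)

lemma space_P: "space (P x) = space (P y)"
  by (rule sets_eq_imp_space_eq[OF sets_P])

definition p :: "real \<Rightarrow> nat \<Rightarrow> nat \<Rightarrow> real" where
  "p t x y = \<P>(\<omega> in P x. X t \<omega> = enat y)"

lemma sets_X: "0 \<le> t \<Longrightarrow> {\<omega> \<in> space (P x). X t \<omega> \<in> B} \<in> sets (P x)"
  using measurable_sets[OF measurable_X, of t B x] by (simp add: vimage_def Int_def conj_commute)

lemma sets_X_eq [measurable]: "0 \<le> t \<Longrightarrow> {\<omega> \<in> space (P x). X t \<omega> = a} \<in> sets (P x)"
  using sets_X[of t x "{a}"] by simp

lemma p_nonneg [simp]: "0 \<le> p t x y" by (simp add: p_def)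

lemma p_le_1 [simp]: "p t x y \<le> 1" by (simp add: p_def)

lemma AE_start: "AE \<omega> in P x. X 0 \<omega> = enat x"
  using start[of x] by (subst (asm) P.prob_eq_1) (auto simp: )

lemma p_0: "p 0 x y = (if x = y then 1 else 0)"
proof (cases "x = y")
  case False
  have "\<P>(\<omega> in P x. X 0 \<omega> = enat y) = \<P>(\<omega> in P x. False)"
    by (rule P.prob_eq_AE) (use AE_start[of x] False in \<open>auto elim!: eventually_mono\<close>)
  then show ?thesis using False by (simp add: p_def)
qed (use start in \<open>simp add: p_def\<close>)

lemma infinite_absorbing:
  assumes "\<omega> \<in> space (P x)" "0 \<le> s" "s \<le> t" "X s \<omega> = \<infinity>"
  shows "X t \<omega> = \<infinity>"
proof -
  have "explosion_time X \<omega> \<le> ereal s" using killed[OF assms(1,2)] assms(4) by simp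
  also have "ereal s \<le> ereal t" using assms(3) by simp
  finally show ?thesis using killed[OF assms(1), of t] assms(2,3) by simp
qed

lemma finite_before:
  assumes "\<omega> \<in> space (P x)" "0 \<le> s" "s \<le> t" "X t \<omega> = enat y"
  obtains z where "X s \<omega> = enat z"
  using infinite_absorbing[OF assms(1-3)] assms(4) by (cases "X s \<omega>") auto

lemma bounded_before:
  assumes "\<omega> \<in> space (P x)" "0 \<le> s" "X s \<omega> = enat y"
  obtains M where "\<And>r. 0 \<le> r \<Longrightarrow> r \<le> s \<Longrightarrow> \<exists>z\<le>M. X r \<omega> = enat z"
proof -
  have "ereal s < explosion_time X \<omega>"
    using killed[OF assms(1,2)] assms(3) by (simp add: not_le[symmetric])
  then obtain z where z: "ereal s < hit X {z..} \<omega>" by (auto simp: explosion_time_def less_SUP_iff)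
  obtain z0 where z0: "X 0 \<omega> = enat z0"
    by (rule finite_before[OF assms(1) order_refl assms(2,3)])
  \<comment> \<open>\<open>hit\<close> looks at positive times only, so the initial value has to be
    included in the bound separately.\<close>
  show thesis
  proof (rule that[of "max z z0"])
    fix r assume r: "0 \<le> r" "r \<le> s"
    obtain v where v: "X r \<omega> = enat v" by (rule finite_before[OF assms(1) r assms(3)])
    show "\<exists>z'\<le>max z z0. X r \<omega> = enat z'"
    proof (cases "r = 0")
      case True then show ?thesis using z0 by auto
    next
      case False
      have "v < z"
      proof (rule ccontr)
        assume "\<not> v < z"
        then have "hit X {z..} \<omega> \<le> ereal r"
          unfolding hit_def using False r v by (intro INF_lower) auto
        then show False using z r(2) by (metis ereal_less_eq(3) not_less order_trans)
      qed
      then show ?thesis using v by auto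
    qed
  qed
qed

text \<open>Points of the state space are isolated in \<open>enat\<close>, so right continuity means
  constancy on a right neighbourhood; the cemetery is not isolated, but it is absorbing.\<close>

lemma right_constant:
  assumes "\<omega> \<in> space (P x)" "0 \<le> t"
  obtains e where "0 < e" "\<And>s. t \<le> s \<Longrightarrow> s < t + e \<Longrightarrow> X s \<omega> = X t \<omega>"
proof (cases "X t \<omega>")
  case (enat y)
  have "\<forall>\<^sub>F s in at_right t. X s \<omega> \<in> {enat y}"
    by (rule topological_tendstoD[OF right_continuous[OF assms]]) (auto simp: enat open_enat)
  then obtain b where b: "t < b" "\<And>s. t < s \<Longrightarrow> s < b \<Longrightarrow> X s \<omega> = enat y"
    by (auto simp: eventually_at_right_field)
  show thesis
    by (rule that[of "b - t"]) (use b enat in \<open>auto simp: le_less\<close>)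
next
  case infinity
  show thesis
    by (rule that[of 1]) (use infinite_absorbing[OF assms] infinity in auto)
qed

text \<open>The general starting time \<open>c\<close> covers both \<open>hit\<close>
  (\<open>c = 0\<close>) and \<open>return_time\<close> (\<open>c\<close> the exit time). Were the
  path outside \<open>A\<close> at the infimum, it would stay outside for a while, and the infimum
  would be larger.\<close>

lemma first_time_attained:
  assumes \<omega>: "\<omega> \<in> space (P x)" and c: "0 \<le> c"
    and T: "T = (INF t\<in>{t. c < t \<and> X t \<omega> \<in> enat ` A}. ereal t)" "T < \<infinity>"
  obtains h where "T = ereal h" "c \<le> h" "X h \<omega> \<in> enat ` A" "\<And>t. c < t \<Longrightarrow> t < h \<Longrightarrow> X t \<omega> \<notin> enat ` A"
proof -
  have "ereal c \<le> T" unfolding T(1) by (rule INF_greatest) auto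
  then obtain h where h: "T = ereal h" using T(2) by (cases T) auto
  have ch: "c \<le> h" using \<open>ereal c \<le> T\<close> h by simp
  have before: "X t \<omega> \<notin> enat ` A" if "c < t" "t < h" for t
  proof
    assume "X t \<omega> \<in> enat ` A"
    then have "T \<le> ereal t" unfolding T(1) using that by (intro INF_lower) auto
    then show False using that h by simp
  qed
  have "X h \<omega> \<in> enat ` A"
  proof (rule ccontr)
    assume n: "X h \<omega> \<notin> enat ` A"
    obtain e where e: "0 < e" "\<And>s. h \<le> s \<Longrightarrow> s < h + e \<Longrightarrow> X s \<omega> = X h \<omega>"
      using right_constant[OF \<omega>, of h] c ch by (metis order_trans)
    have "ereal (h + e) \<le> T" unfolding T(1)
    proof (rule INF_greatest)
      fix t assume t: "t \<in> {t. c < t \<and> X t \<omega> \<in> enat ` A}"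
      then have "\<not> t < h" using before by auto
      moreover have "\<not> (h \<le> t \<and> t < h + e)" using e(2)[of t] n t by (metis mem_Collect_eq)
      ultimately show "ereal (h + e) \<le> ereal t" by auto
    qed
    then show False using h e(1) by simp
  qed
  then show thesis using that h ch before by blast
qed

lemma hit_attained:
  assumes "\<omega> \<in> space (P x)" "hit X A \<omega> < \<infinity>"
  obtains h where "hit X A \<omega> = ereal h" "0 \<le> h" "X h \<omega> \<in> enat ` A" "\<And>t. 0 < t \<Longrightarrow> t < h \<Longrightarrow> X t \<omega> \<notin> enat ` A"
  by (rule first_time_attained[OF assms(1) order_refl hit_def assms(2)]) blast

lemma hit_nonneg: "0 \<le> hit X A \<omega>"
  unfolding hit_def by (rule INF_greatest) auto

lemma hit_le: "0 < t \<Longrightarrow> X t \<omega> \<in> enat ` A \<Longrightarrow> hit X A \<omega> \<le> ereal t"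
  unfolding hit_def by (rule INF_lower) auto

text \<open>By right constancy a visit at time \<open>0\<close> is also seen at arbitrarily small
  positive times, so it counts although \<open>hit\<close> excludes time \<open>0\<close>.\<close>

lemma hit_le0:
  assumes "\<omega> \<in> space (P x)" "0 \<le> t" "X t \<omega> \<in> enat ` A"
  shows "hit X A \<omega> \<le> ereal t"
proof (rule ereal_le_epsilon2)
  fix d :: real assume d: "0 < d"
  obtain e where e: "0 < e" "\<And>s. t \<le> s \<Longrightarrow> s < t + e \<Longrightarrow> X s \<omega> = X t \<omega>"
    by (rule right_constant[OF assms(1,2)]) blast
  have "hit X A \<omega> \<le> ereal (t + min (e/2) d)"
    using e(2)[of "t + min (e/2) d"] e(1) d assms by (intro hit_le) auto
  also have "\<dots> \<le> ereal t + ereal d" by simp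
  finally show "hit X A \<omega> \<le> ereal t + ereal d" .
qed

lemma rational_in_right:
  assumes "\<omega> \<in> space (P x)" "0 \<le> t" "t < b"
  obtains q where "q \<in> \<rat>" "t < q" "q < b" "X q \<omega> = X t \<omega>"
proof -
  obtain e where e: "0 < e" "\<And>s. t \<le> s \<Longrightarrow> s < t + e \<Longrightarrow> X s \<omega> = X t \<omega>"
    by (rule right_constant[OF assms(1,2)]) blast
  obtain q where "q \<in> \<rat>" "t < q" "q < min b (t + e)"
    using Rats_dense_in_real[of t "min b (t + e)"] e(1) assms(3) by auto
  then show thesis using that[of q] e(2)[of q] by auto
qed

text \<open>Since a path lingers where it is, the time witnessing \<open>?T \<omega> < a\<close> can
  be chosen rational, which makes the event a countable union.\<close>

lemma measurable_first_time:
  assumes c: "c \<in> borel_measurable (P x)" and nn: "\<And>\<omega>. 0 \<le> c \<omega>"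
  shows "(\<lambda>\<omega>. INF t\<in>{t. c \<omega> < ereal t \<and> X t \<omega> \<in> enat ` A}. ereal t) \<in> borel_measurable (P x)"
    (is "?T \<in> _")
  unfolding borel_measurable_ereal_iff_Iio
proof (intro allI)
  fix a :: ereal
  have *: "(?T \<omega> < a) \<longleftrightarrow> (\<exists>q\<in>\<rat>. 0 \<le> q \<and> ereal q < a \<and> (c \<omega> < ereal q \<and> X q \<omega> \<in> enat ` A))"
    (is "?l \<longleftrightarrow> ?r") if \<omega>: "\<omega> \<in> space (P x)" for \<omega>
  proof
    assume ?l
    then obtain t where t: "c \<omega> < ereal t" "X t \<omega> \<in> enat ` A" "ereal t < a" by (auto simp: INF_less_iff)
    have "0 < t" using nn[of \<omega>] t(1) by (metis ereal_less(2) le_less_trans)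
    define b where "b = (if a = \<infinity> then t + 1 else real_of_ereal a)"
    have b: "t < b" "ereal b \<le> a" using t(3) by (cases a; simp add: b_def)+
    obtain q where q: "q \<in> \<rat>" "t < q" "q < b" "X q \<omega> = X t \<omega>"
      using rational_in_right[OF \<omega> less_imp_le[OF \<open>0 < t\<close>] b(1)] by metis
    have "c \<omega> < ereal q" using t(1) q(2) by (metis ereal_less_eq(3) less_le_trans less_imp_le)
    moreover have "ereal q < a" using q(3) b(2) by (metis less_ereal.simps(1) less_le_trans)
    ultimately show ?r using q \<open>0 < t\<close> t by (intro bexI[of _ q]) auto
  next
    assume ?r then show ?l by (auto simp: INF_less_iff)
  qed
  have "{\<omega> \<in> space (P x). \<exists>q\<in>\<rat>. 0 \<le> q \<and> ereal q < a \<and> (c \<omega> < ereal q \<and> X q \<omega> \<in> enat ` A)} =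
      (\<Union>q\<in>{q\<in>\<rat>. 0 \<le> q \<and> ereal q < a}. {\<omega> \<in> space (P x). c \<omega> < ereal q} \<inter> {\<omega> \<in> space (P x). X q \<omega> \<in> enat ` A})"
    by auto
  also have "\<dots> \<in> sets (P x)"
  proof (rule sets.countable_UN'')
    show "countable {q \<in> \<rat>. 0 \<le> q \<and> ereal q < a}"
      by (rule countable_subset[OF _ countable_rat]) auto
  qed (use c in \<open>auto intro!: sets.Int sets_X\<close>)
  finally show "?T -` {..<a} \<inter> space (P x) \<in> sets (P x)"
    using * by (simp add: vimage_def Int_def conj_commute cong: conj_cong rev_conj_cong)
qed

lemma measurable_hit: "hit X A \<in> borel_measurable (P x)"
  using measurable_first_time[of "\<lambda>_. 0" x A] by (simp add: hit_def[abs_def])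

lemma measurable_return_time: "return_time X z \<in> borel_measurable (P x)"
proof -
  have "return_time X z = (\<lambda>\<omega>. INF t\<in>{t. hit X (- {z}) \<omega> < ereal t \<and> X t \<omega> \<in> enat ` {z}}. ereal t)"
    by (simp add: return_time_def[abs_def])
  then show ?thesis by (simp only:) (rule measurable_first_time[OF measurable_hit hit_nonneg])
qed

lemma sigma_algebra_past: "sigma_algebra (space (P x)) (past (P x) X s)"
  unfolding past_def by (rule sigma_algebra_sigma_sets) auto

lemma past_X: "0 \<le> u \<Longrightarrow> u \<le> s \<Longrightarrow> {\<omega> \<in> space (P x). X u \<omega> \<in> B} \<in> past (P x) X s"
  unfolding past_def by (rule sigma_sets.Basic) (auto intro!: exI[of _ u] exI[of _ B])

lemma past_X_eq: "0 \<le> u \<Longrightarrow> u \<le> s \<Longrightarrow> {\<omega> \<in> space (P x). X u \<omega> = a} \<in> past (P x) X s"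
  using past_X[of u s x "{a}"] by simp

lemma past_mono: "s \<le> t \<Longrightarrow> past (P x) X s \<subseteq> past (P x) X t"
  unfolding past_def by (rule sigma_sets_mono') fastforce

lemma past_sets: "past (P x) X s \<subseteq> sets (P x)"
  unfolding past_def
  by (rule sets.sigma_sets_subset) (auto simp: measurable_sets[OF measurable_X])

lemma markov_p:
  assumes "0 \<le> s" "0 \<le> t" "A \<in> past (P x) X s"
  shows "measure (P x) (A \<inter> {\<omega> \<in> space (P x). X s \<omega> = enat y} \<inter> {\<omega> \<in> space (P x). X (s + t) \<omega> = enat z}) =
    measure (P x) (A \<inter> {\<omega> \<in> space (P x). X s \<omega> = enat y}) * p t y z"
proof -
  have "A \<inter> {\<omega> \<in> space (P x). X s \<omega> = enat y} \<inter> {\<omega> \<in> space (P x). X (s + t) \<omega> = enat z} =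
      {\<omega> \<in> space (P x). \<omega> \<in> A \<and> X s \<omega> = enat y \<and> X (s + t) \<omega> = enat z}" by auto
  moreover have "A \<inter> {\<omega> \<in> space (P x). X s \<omega> = enat y} = {\<omega> \<in> space (P x). \<omega> \<in> A \<and> X s \<omega> = enat y}" by auto
  ultimately show ?thesis using markov[OF assms, of y z] by (simp add: p_def)
qed

lemma markov_p2:
  assumes "0 \<le> s" "0 \<le> t"
  shows "measure (P x) ({\<omega> \<in> space (P x). X s \<omega> = enat y} \<inter> {\<omega> \<in> space (P x). X (s + t) \<omega> = enat z}) = p s x y * p t y z"
  using markov_p[OF assms, of "space (P x)" x y z] past_X[OF order_refl assms(1), of x UNIV]
  by (simp add: p_def Int_absorb1 Int_assoc[symmetric])

lemma chapman_kolmogorov: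
  assumes "0 \<le> s" "0 \<le> t"
  shows "(\<lambda>y. p s x y * p t y z) sums p (s + t) x z"
proof -
  let ?A = "\<lambda>y. {\<omega> \<in> space (P x). X s \<omega> = enat y} \<inter> {\<omega> \<in> space (P x). X (s + t) \<omega> = enat z}"
  have "(\<lambda>y. measure (P x) (?A y)) sums measure (P x) (\<Union>y. ?A y)"
    by (rule P.finite_measure_UNION) (use assms in \<open>auto simp: disjoint_family_on_def\<close>)
  moreover have "(\<Union>y. ?A y) = {\<omega> \<in> space (P x). X (s + t) \<omega> = enat z}"
    using assms by (auto intro: finite_before[of _ x s "s + t" z])
  ultimately show ?thesis by (simp add: markov_p2[OF assms] p_def[of "s + t"])
qed

lemma p_summable: "0 \<le> t \<Longrightarrow> summable (p t x)"
  and p_suminf_le: "0 \<le> t \<Longrightarrow> (\<Sum>y. p t x y) \<le> 1"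
proof -
  assume t: "0 \<le> t"
  let ?A = "\<lambda>y. {\<omega> \<in> space (P x). X t \<omega> = enat y}"
  have "(\<lambda>y. measure (P x) (?A y)) sums measure (P x) (\<Union>y. ?A y)"
    by (rule P.finite_measure_UNION) (use t in \<open>auto simp: disjoint_family_on_def\<close>)
  then have *: "p t x sums measure (P x) (\<Union>y. ?A y)" by (simp add: p_def[abs_def])
  then show "summable (p t x)" by (rule sums_summable)
  show "(\<Sum>y. p t x y) \<le> 1" unfolding sums_unique[OF *, symmetric] by simp
qed

lemma p_sum_le: "0 \<le> t \<Longrightarrow> finite S \<Longrightarrow> (\<Sum>y\<in>S. p t x y) \<le> 1"
  using sum_le_suminf[OF p_summable, of t S x] p_suminf_le[of t x] by auto

lemma Q_tendsto:
  assumes d: "d \<longlonglongrightarrow> 0" "\<And>n. 0 < d n"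
  shows "(\<lambda>n. (p (d n) x y - (if x = y then 1 else 0)) / d n) \<longlonglongrightarrow> Q x y"
proof -
  have "((\<lambda>t. (p t x y - p 0 x y) / (t - 0)) \<longlongrightarrow> Q x y) (at_right 0)"
    using Q_matrix[of x y] by (simp add: has_field_derivative_iff p_def)
  moreover have "filterlim d (at_right 0) sequentially"
    using d by (intro tendsto_imp_filterlim_at_right) auto
  ultimately have "(\<lambda>n. (p (d n) x y - p 0 x y) / (d n - 0)) \<longlonglongrightarrow> Q x y"
    by (rule filterlim_compose)
  then show ?thesis by (simp add: p_0)
qed

section \<open>Dyadic grids and impossible jumps\<close>

definition mesh :: "nat \<Rightarrow> real" where "mesh n = 1 / 2 ^ n"

lemma mesh_pos [simp]: "0 < mesh n" by (simp add: mesh_def)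

lemma mesh_tendsto: "mesh \<longlonglongrightarrow> 0"
  unfolding mesh_def[abs_def] by (rule LIMSEQ_divide_realpow_zero) simp

lemma eventually_mesh_less: "0 < e \<Longrightarrow> \<forall>\<^sub>F n in sequentially. mesh n < e"
  using order_tendstoD(2)[OF mesh_tendsto] by simp

lemma exp_mesh_tendsto: "(\<lambda>n. (exp (- l * mesh n) - 1) / mesh n) \<longlonglongrightarrow> - l"
proof -
  have "((\<lambda>h. exp (- l * h)) has_field_derivative exp (- l * 0) * (- l)) (at 0)"
    by (auto intro!: derivative_eq_intros)
  then have "((\<lambda>h. (exp (- l * (0 + h)) - exp (- l * 0)) / h) \<longlongrightarrow> - l) (at 0)"
    by (simp add: DERIV_def)
  moreover have "filterlim mesh (at 0) sequentially"
    using mesh_tendsto by (intro filterlim_atI) (auto simp: less_imp_neq[OF mesh_pos, symmetric])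
  ultimately have "(\<lambda>n. (exp (- l * (0 + mesh n)) - exp (- l * 0)) / mesh n) \<longlonglongrightarrow> - l"
    by (rule filterlim_compose)
  then show ?thesis by simp
qed

lemma Q_mesh: "(\<lambda>n. (p (mesh n) x y - (if x = y then 1 else 0)) / mesh n) \<longlonglongrightarrow> Q x y"
  by (rule Q_tendsto[OF mesh_tendsto]) simp

lemma Q_offdiag_nonneg: "x \<noteq> y \<Longrightarrow> 0 \<le> Q x y"
  by (rule LIMSEQ_le_const[OF Q_mesh]) (auto intro!: exI[of _ 0] divide_nonneg_pos)

text \<open>First moment bound: \<open>T * 2 ^ n\<close> grid steps produce a jump from
  \<open>C\<close> to \<open>u\<close> with probability at most \<open>T\<close> times the sum of
  \<open>p (mesh n) y u / mesh n\<close> over \<open>C\<close>, which tends to \<open>T\<close>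
  times the sum of the vanishing rates. Finiteness of \<open>C\<close> allows the termwise
  limit.\<close>

lemma AE_no_grid_jump:
  assumes C: "finite C" "u \<notin> C" "\<And>y. y \<in> C \<Longrightarrow> Q y u = 0"
  shows "AE \<omega> in P x. \<not> (\<forall>\<^sub>F n in sequentially.
    \<exists>k < T * 2 ^ n. X (real k * mesh n) \<omega> \<in> enat ` C \<and> X (real (Suc k) * mesh n) \<omega> = enat u)"
proof -
  define F where "F n = (\<Union>k<T * 2 ^ n. \<Union>y\<in>C. {\<omega> \<in> space (P x). X (real k * mesh n) \<omega> = enat y} \<inter>
      {\<omega> \<in> space (P x). X (real k * mesh n + mesh n) \<omega> = enat u})" for n
  have "measure (P x) (F n) \<le> real T * (\<Sum>y\<in>C. p (mesh n) y u / mesh n)" for n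
  proof -
    let ?G = "\<lambda>k y. {\<omega> \<in> space (P x). X (real k * mesh n) \<omega> = enat y} \<inter>
      {\<omega> \<in> space (P x). X (real k * mesh n + mesh n) \<omega> = enat u}"
    have G: "?G k y \<in> sets (P x)" for k y
      by (intro sets.Int sets_X_eq add_nonneg_nonneg mult_nonneg_nonneg) (simp_all add: less_imp_le)
    have mG: "measure (P x) (?G k y) = p (real k * mesh n) x y * p (mesh n) y u" for k y
      by (rule markov_p2) (simp_all add: less_imp_le)
    have "measure (P x) (F n) \<le> (\<Sum>k<T * 2 ^ n. measure (P x) (\<Union>y\<in>C. ?G k y))"
      unfolding F_def by (intro measure_UNION_le finite_lessThan sets.finite_UN C(1) G)
    also have "\<dots> \<le> (\<Sum>k<T * 2 ^ n. \<Sum>y\<in>C. measure (P x) (?G k y))"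
      by (intro sum_mono measure_UNION_le C(1) G)
    also have "\<dots> = (\<Sum>k<T * 2 ^ n. \<Sum>y\<in>C. p (real k * mesh n) x y * p (mesh n) y u)"
      unfolding mG ..
    also have "\<dots> \<le> (\<Sum>k<T * 2 ^ n. \<Sum>y\<in>C. 1 * p (mesh n) y u)"
      by (intro sum_mono mult_right_mono) auto
    also have "\<dots> = real T * (\<Sum>y\<in>C. p (mesh n) y u / mesh n)"
      by (simp add: mesh_def sum_distrib_left mult_ac)
    finally show ?thesis .
  qed
  moreover have "(\<lambda>n. real T * (\<Sum>y\<in>C. p (mesh n) y u / mesh n)) \<longlonglongrightarrow> real T * (\<Sum>y\<in>C. Q y u)"
  proof (intro tendsto_intros)
    fix y assume "y \<in> C"
    then have "y \<noteq> u" using C(2) by auto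
    then show "(\<lambda>n. p (mesh n) y u / mesh n) \<longlonglongrightarrow> Q y u" using Q_mesh[of y u] by simp
  qed
  then have "(\<lambda>n. real T * (\<Sum>y\<in>C. p (mesh n) y u / mesh n)) \<longlonglongrightarrow> 0"
    by (simp add: C(3))
  ultimately have lim: "(\<lambda>n. measure (P x) (F n)) \<longlonglongrightarrow> 0"
    by (intro tendsto_sandwich[where f = "\<lambda>_. 0" and g = "\<lambda>n. measure (P x) (F n)"
          and h = "\<lambda>n. real T * (\<Sum>y\<in>C. p (mesh n) y u / mesh n)"] always_eventually allI tendsto_const) simp_all
  have "AE \<omega> in P x. \<not> (\<forall>\<^sub>F n in sequentially. \<omega> \<in> F n)"
    by (rule AE_not_eventually_if_prob_tendsto_0[OF prob_space_P _ lim])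
      (unfold F_def, intro sets.finite_UN finite_lessThan C(1) sets.Int sets_X_eq add_nonneg_nonneg mult_nonneg_nonneg, simp_all add: less_imp_le)
  moreover have "(\<omega> \<in> F n) \<longleftrightarrow>
      (\<exists>k < T * 2 ^ n. X (real k * mesh n) \<omega> \<in> enat ` C \<and> X (real (Suc k) * mesh n) \<omega> = enat u)"
    if "\<omega> \<in> space (P x)" for \<omega> n
    using that by (auto simp: F_def algebra_simps)
  ultimately show ?thesis
    by (elim AE_mp) (intro AE_I2, simp)
qed

end

lemma measure_tendsto_AE:
  assumes "prob_space M" "\<And>n. F n \<in> sets M" "E \<in> sets M"
    and "AE \<omega> in M. \<forall>\<^sub>F n in sequentially. \<omega> \<in> F n \<longleftrightarrow> \<omega> \<in> E"
  shows "(\<lambda>n. measure M (F n)) \<longlonglongrightarrow> measure M E"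
proof -
  interpret prob_space M by fact
  have "(\<lambda>n. integral\<^sup>L M (indicator (F n) :: _ \<Rightarrow> real)) \<longlonglongrightarrow> integral\<^sup>L M (indicator E)"
  proof (rule integral_dominated_convergence[where w = "\<lambda>_. 1"])
    show "AE \<omega> in M. (\<lambda>n. indicator (F n) \<omega> :: real) \<longlonglongrightarrow> indicator E \<omega>"
      using assms(4)
    proof (rule eventually_mono)
      fix \<omega> assume "\<forall>\<^sub>F n in sequentially. \<omega> \<in> F n \<longleftrightarrow> \<omega> \<in> E"
      then have "\<forall>\<^sub>F n in sequentially. indicator (F n) \<omega> = (indicator E \<omega> :: real)"
        by (rule eventually_mono) (simp add: indicator_def)
      then show "(\<lambda>n. indicator (F n) \<omega> :: real) \<longlonglongrightarrow> indicator E \<omega>" by (rule tendsto_eventually)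
    qed
  qed (use assms in \<open>auto simp: indicator_def\<close>)
  then show ?thesis using assms by simp
qed

context killed_markov_chain
begin

lemma grid_point:
  assumes "0 \<le> t"
  obtains j where "t \<le> real j * mesh n" "real j * mesh n < t + mesh n"
proof -
  define j where "j = nat \<lceil>t / mesh n\<rceil>"
  have nn: "0 \<le> t / mesh n" using assms mesh_pos[of n] by (intro divide_nonneg_pos) auto
  then have rj: "real j = of_int \<lceil>t / mesh n\<rceil>" unfolding j_def by simp
  have "t / mesh n \<le> real j" "real j < t / mesh n + 1" unfolding rj by linarith+
  then have "t \<le> real j * mesh n" "real j * mesh n < (t / mesh n + 1) * mesh n"
    using mesh_pos[of n] by (simp add: field_simps, intro mult_strict_right_mono)
  then show thesis using that[of j] mesh_pos[of n] by (simp add: distrib_right)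
qed

text \<open>Up to \<open>s\<close> the path is bounded by some \<open>M\<close>, so \<open>C\<close>
  may be replaced by the finite set \<open>C \<inter> {..M}\<close>. Once the mesh is shorter than
  the stay in \<open>u\<close>, the first grid time after \<open>s\<close> sees \<open>u\<close> and
  the one before sees \<open>C\<close>, on every fine grid.\<close>

lemma AE_no_jump:
  assumes "u \<notin> C" "\<And>y. y \<in> C \<Longrightarrow> Q y u = 0"
  shows "AE \<omega> in P x. \<not> (\<exists>s>0. X s \<omega> = enat u \<and> (\<forall>r. 0 \<le> r \<and> r < s \<longrightarrow> X r \<omega> \<in> enat ` C))"
proof -
  have "AE \<omega> in P x. \<forall>T M. \<not> (\<forall>\<^sub>F n in sequentially.
      \<exists>k < T * 2 ^ n. X (real k * mesh n) \<omega> \<in> enat ` (C \<inter> {..M}) \<and> X (real (Suc k) * mesh n) \<omega> = enat u)"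
    unfolding AE_all_countable by (intro allI AE_no_grid_jump) (use assms in auto)
  then show ?thesis
  proof (rule AE_mp, intro AE_I2 impI notI)
    fix \<omega> assume \<omega>: "\<omega> \<in> space (P x)"
    assume no: "\<forall>T M. \<not> (\<forall>\<^sub>F n in sequentially.
      \<exists>k < T * 2 ^ n. X (real k * mesh n) \<omega> \<in> enat ` (C \<inter> {..M}) \<and> X (real (Suc k) * mesh n) \<omega> = enat u)"
    assume "\<exists>s>0. X s \<omega> = enat u \<and> (\<forall>r. 0 \<le> r \<and> r < s \<longrightarrow> X r \<omega> \<in> enat ` C)"
    then obtain s where s: "0 < s" "X s \<omega> = enat u" "\<And>r. 0 \<le> r \<Longrightarrow> r < s \<Longrightarrow> X r \<omega> \<in> enat ` C" by auto
    obtain M where M: "\<And>r. 0 \<le> r \<Longrightarrow> r \<le> s \<Longrightarrow> \<exists>z\<le>M. X r \<omega> = enat z"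
      using bounded_before[OF \<omega> _ s(2)] s(1) by (metis less_imp_le)
    obtain e where e: "0 < e" "\<And>t. s \<le> t \<Longrightarrow> t < s + e \<Longrightarrow> X t \<omega> = X s \<omega>"
      using right_constant[OF \<omega>, of s] s(1) by (metis less_imp_le)
    define T where "T = nat \<lceil>s\<rceil> + 1"
    have "\<forall>\<^sub>F n in sequentially. mesh n < min e 1" using e(1) by (intro eventually_mesh_less) simp
    then have "\<forall>\<^sub>F n in sequentially.
      \<exists>k < T * 2 ^ n. X (real k * mesh n) \<omega> \<in> enat ` (C \<inter> {..M}) \<and> X (real (Suc k) * mesh n) \<omega> = enat u"
    proof (rule eventually_mono)
      fix n assume n: "mesh n < min e 1"
      obtain j where j: "s \<le> real j * mesh n" "real j * mesh n < s + mesh n"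
        using grid_point[OF less_imp_le[OF s(1)]] by metis
      then obtain k where k: "j = Suc k" using s(1) by (cases j) auto
      have ks: "real k * mesh n < s" using j(2) k by (simp add: algebra_simps)
      have 1: "X (real j * mesh n) \<omega> = enat u" using e(2)[of "real j * mesh n"] j n s(2) by auto
      have 2: "X (real k * mesh n) \<omega> \<in> enat ` (C \<inter> {..M})"
        using s(3)[of "real k * mesh n"] M[of "real k * mesh n"] ks by (auto simp: less_imp_le)
      have "real k < real (T * 2 ^ n)"
      proof -
        have "real k < s / mesh n" using ks by (simp add: field_simps)
        also have "\<dots> = s * 2 ^ n" by (simp add: mesh_def)
        also have "\<dots> \<le> real T * 2 ^ n" unfolding T_def by (intro mult_right_mono) (auto, linarith)
        finally show ?thesis by simp
      qed
      then have "k < T * 2 ^ n" by (simp only: of_nat_less_iff)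
      then show "\<exists>k < T * 2 ^ n. X (real k * mesh n) \<omega> \<in> enat ` (C \<inter> {..M}) \<and> X (real (Suc k) * mesh n) \<omega> = enat u"
        using 1 2 k by blast
    qed
    then show False using no by blast
  qed
qed

text \<open>By \<open>AE_no_jump\<close> the path has left \<open>C\<close> before its first visit
  to \<open>B\<close>, and by minimality it is not in \<open>B\<close> at that moment: it needs a
  third class of states. This replaces arguments with the jump chain.\<close>

lemma AE_first_entrance:
  assumes x: "x \<in> C" and CB: "C \<inter> B = {}" "\<And>y u. y \<in> C \<Longrightarrow> u \<in> B \<Longrightarrow> Q y u = 0"
  shows "AE \<omega> in P x. \<forall>s\<ge>0. X s \<omega> \<in> enat ` B \<longrightarrow> (\<exists>r v. 0 \<le> r \<and> r < s \<and> X r \<omega> = enat v \<and> v \<notin> C \<and> v \<notin> B)"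
proof -
  have "AE \<omega> in P x. \<forall>u. u \<in> B \<longrightarrow> \<not> (\<exists>s>0. X s \<omega> = enat u \<and> (\<forall>r. 0 \<le> r \<and> r < s \<longrightarrow> X r \<omega> \<in> enat ` C))"
    unfolding AE_all_countable
  proof
    fix u
    show "AE \<omega> in P x. u \<in> B \<longrightarrow> \<not> (\<exists>s>0. X s \<omega> = enat u \<and> (\<forall>r. 0 \<le> r \<and> r < s \<longrightarrow> X r \<omega> \<in> enat ` C))"
      using AE_no_jump[of u C x] CB by (cases "u \<in> B") auto
  qed
  then show ?thesis
    using AE_start[of x]
  proof (elim AE_mp, intro AE_I2 impI allI, goal_cases)
    case (1 \<omega> s)
    then have no: "\<And>u s. u \<in> B \<Longrightarrow> 0 < s \<Longrightarrow> X s \<omega> = enat u \<Longrightarrow> \<exists>r. 0 \<le> r \<and> r < s \<and> X r \<omega> \<notin> enat ` C"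
      and X0: "X 0 \<omega> = enat x" and \<omega>: "\<omega> \<in> space (P x)" and s: "0 \<le> s" "X s \<omega> \<in> enat ` B" by blast+
    show ?case
    proof (rule ccontr)
      assume contra: "\<not> ?case"
      have "s \<noteq> 0" using s X0 x CB(1) by auto
      then have s0: "0 < s" using s by simp
      have hs: "hit X B \<omega> \<le> ereal s" by (rule hit_le[OF s0 s(2)])
      then have "hit X B \<omega> < \<infinity>" using less_ereal.simps(4) by (metis le_less_trans)
      then obtain h where h: "hit X B \<omega> = ereal h" "0 \<le> h" "X h \<omega> \<in> enat ` B" "\<And>t. 0 < t \<Longrightarrow> t < h \<Longrightarrow> X t \<omega> \<notin> enat ` B"
        using hit_attained[OF \<omega>] by metis
      have "h \<noteq> 0" using h(3) X0 x CB(1) by auto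
      then have h0: "0 < h" using h(2) by simp
      have "h \<le> s" using hs h(1) by simp
      obtain u where u: "u \<in> B" "X h \<omega> = enat u" using h(3) by auto
      obtain r where r: "0 \<le> r" "r < h" "X r \<omega> \<notin> enat ` C" using no[OF u(1) h0 u(2)] by auto
      have "r \<noteq> 0" using r X0 x by auto
      then have rB: "X r \<omega> \<notin> enat ` B" using h(4)[of r] r by simp
      obtain v where v: "X r \<omega> = enat v" by (rule finite_before[OF \<omega> r(1) less_imp_le[OF r(2)] u(2)])
      have "v \<notin> C" "v \<notin> B" "r < s" using r rB v \<open>h \<le> s\<close> by auto
      then show False using contra r(1) v by blast
    qed
  qed
qed

end

section \<open>Consequences of certain absorption at the trap\<close>

locale absorbed_chain = downward_skip_free_chain P X Q
  for P :: "nat \<Rightarrow> 'a measure" and X :: "real \<Rightarrow> 'a \<Rightarrow> enat" and Q :: "nat \<Rightarrow> nat \<Rightarrow> real" +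
  assumes absorbed: "\<P>(\<omega> in P x. hit X {0} \<omega> < \<infinity>) = 1"
begin

lemma AE_absorbed: "AE \<omega> in P x. hit X {0} \<omega> < \<infinity>"
proof -
  have [measurable]: "hit X {0} \<in> borel_measurable (P x)" by (rule measurable_hit)
  show ?thesis using absorbed[of x] by (subst (asm) P.prob_eq_1) auto
qed

lemma p_trap: "0 \<le> t \<Longrightarrow> p t 0 0 = 1"
  using trap by (simp add: p_def)

lemma p_trap':
  assumes "0 \<le> t" "0 < y" shows "p t 0 y = 0"
proof -
  have "(\<Sum>z\<in>{0, y}. p t 0 z) \<le> 1" by (rule p_sum_le) (use assms in auto)
  then show ?thesis using p_trap[OF assms(1)] assms(2) p_nonneg[of t 0 y] by simp
qed

lemma AE_trap: "AE \<omega> in P x. \<forall>s t. 0 \<le> s \<longrightarrow> s \<le> t \<longrightarrow> X s \<omega> = enat 0 \<longrightarrow> X t \<omega> = enat 0"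
proof -
  have "AE \<omega> in P x. X q \<omega> = enat 0 \<longrightarrow> X r \<omega> = enat 0" if qr: "0 \<le> q" "q \<le> r" for q r
  proof -
    have r0: "0 \<le> r" using qr by simp
    let ?A = "{\<omega> \<in> space (P x). X q \<omega> = enat 0}" and ?B = "{\<omega> \<in> space (P x). X r \<omega> = enat 0}"
    have "measure (P x) (?A \<inter> ?B) = p q x 0 * p (r - q) 0 0"
      using markov_p2[of q "r - q" x 0 0] qr by simp
    then have "measure (P x) (?A \<inter> ?B) = measure (P x) ?A" using p_trap[of "r - q"] qr by (simp add: p_def)
    moreover have AB: "?A \<in> sets (P x)" "?B \<in> sets (P x)" using qr r0 by auto
    ultimately have "measure (P x) (?A - ?B) = 0" by (subst P.finite_measure_Diff') auto
    then have "?A - ?B \<in> null_sets (P x)" using AB by (simp add: P.emeasure_eq_measure null_setsI)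
    then show ?thesis by (rule AE_I') auto
  qed
  then have "AE \<omega> in P x. 0 \<le> q \<longrightarrow> q \<le> r \<longrightarrow> X q \<omega> = enat 0 \<longrightarrow> X r \<omega> = enat 0" for q r
    by (cases "0 \<le> q \<and> q \<le> r") auto
  then have "AE \<omega> in P x. \<forall>q\<in>\<rat>. \<forall>r\<in>\<rat>. 0 \<le> q \<longrightarrow> q \<le> r \<longrightarrow> X q \<omega> = enat 0 \<longrightarrow> X r \<omega> = enat 0"
    by (simp add: AE_ball_countable countable_rat)
  then show ?thesis
  proof (elim AE_mp, intro AE_I2 impI allI)
    fix \<omega> s t assume \<omega>: "\<omega> \<in> space (P x)" and s: "0 \<le> s" "s \<le> t" "X s \<omega> = enat 0"
      and rat: "\<forall>q\<in>\<rat>. \<forall>r\<in>\<rat>. 0 \<le> q \<longrightarrow> q \<le> r \<longrightarrow> X q \<omega> = enat 0 \<longrightarrow> X r \<omega> = enat 0"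
    show "X t \<omega> = enat 0"
    proof (cases "s = t")
      case False
      then have st: "s < t" using s by simp
      obtain q where q: "q \<in> \<rat>" "s < q" "q < t" "X q \<omega> = X s \<omega>" by (rule rational_in_right[OF \<omega> s(1) st])
      have t0: "0 \<le> t" "t < t + 1" using s by auto
      obtain r where r: "r \<in> \<rat>" "t < r" "r < t + 1" "X r \<omega> = X t \<omega>" by (rule rational_in_right[OF \<omega> t0])
      have "X r \<omega> = enat 0" using rat[rule_format, OF q(1) r(1)] q r s by simp
      then show ?thesis using r by simp
    qed (use s in simp)
  qed
qed

lemma AE_hit_0: "AE \<omega> in P x. \<forall>t\<ge>0. hit X {0} \<omega> \<le> ereal t \<longleftrightarrow> X t \<omega> = enat 0"
  using AE_trap[of x]
proof (elim AE_mp, intro AE_I2 impI allI)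
  fix \<omega> t assume \<omega>: "\<omega> \<in> space (P x)" and t: "0 \<le> (t::real)"
    and trap: "\<forall>s t. 0 \<le> s \<longrightarrow> s \<le> t \<longrightarrow> X s \<omega> = enat 0 \<longrightarrow> X t \<omega> = enat 0"
  show "hit X {0} \<omega> \<le> ereal t \<longleftrightarrow> X t \<omega> = enat 0"
  proof
    assume le: "hit X {0} \<omega> \<le> ereal t"
    then have "hit X {0} \<omega> < \<infinity>" using less_ereal.simps(4) by (metis le_less_trans)
    then obtain h where "hit X {0} \<omega> = ereal h" "0 \<le> h" "X h \<omega> \<in> enat ` {0}"
      using hit_attained[OF \<omega>] by metis
    then show "X t \<omega> = enat 0" using trap le by auto
  next
    assume "X t \<omega> = enat 0"
    then show "hit X {0} \<omega> \<le> ereal t" using hit_le0[OF \<omega> t] by auto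
  qed
qed

lemma AE_eventually_0: "AE \<omega> in P x. \<exists>t\<ge>0. \<forall>s\<ge>t. X s \<omega> = enat 0"
  using AE_absorbed[of x] AE_trap[of x]
proof (elim AE_mp, intro AE_I2 impI)
  fix \<omega> assume \<omega>: "\<omega> \<in> space (P x)" "hit X {0} \<omega> < \<infinity>"
    and trap: "\<forall>s t. 0 \<le> s \<longrightarrow> s \<le> t \<longrightarrow> X s \<omega> = enat 0 \<longrightarrow> X t \<omega> = enat 0"
  obtain h where "0 \<le> h" "X h \<omega> \<in> enat ` {0}" using hit_attained[OF \<omega>] by metis
  then show "\<exists>t\<ge>0. \<forall>s\<ge>t. X s \<omega> = enat 0" using trap by (auto intro!: exI[of _ h])
qed

text \<open>Absorption excludes explosion: a path that is in \<open>0\<close> at a later time cannot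
  have been in the cemetery, which is never left.\<close>

lemma AE_finite: "AE \<omega> in P x. \<forall>t\<ge>0. \<exists>v. X t \<omega> = enat v"
  using AE_eventually_0[of x]
proof (elim AE_mp, intro AE_I2 impI allI)
  fix \<omega> t assume \<omega>: "\<omega> \<in> space (P x)" "\<exists>t\<ge>0. \<forall>s\<ge>t. X s \<omega> = enat 0" and t: "0 \<le> (t::real)"
  from \<omega>(2) obtain s where s: "0 \<le> s" "\<forall>t\<ge>s. X t \<omega> = enat 0" by auto
  then have "X (max s t) \<omega> = enat 0" by simp
  then obtain v where "X t \<omega> = enat v"
    using finite_before[OF \<omega>(1) t, of "max s t" 0] by (metis max.cobounded2)
  then show "\<exists>v. X t \<omega> = enat v" by blast
qed

lemma p_sums_1:
  assumes t: "0 \<le> t" shows "p t x sums 1"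
proof -
  let ?A = "\<lambda>y. {\<omega> \<in> space (P x). X t \<omega> = enat y}"
  have "(\<lambda>y. measure (P x) (?A y)) sums measure (P x) (\<Union>y. ?A y)"
    by (rule P.finite_measure_UNION) (use t in \<open>auto simp: disjoint_family_on_def\<close>)
  moreover have "measure (P x) (\<Union>y. ?A y) = 1"
  proof (rule P.prob_eq_1[THEN iffD2])
    show "AE \<omega> in P x. \<omega> \<in> (\<Union>y. ?A y)"
      using AE_finite[of x] by (elim AE_mp) (intro AE_I2, use t in auto)
  qed (use t in auto)
  ultimately show ?thesis by (simp add: p_def[abs_def])
qed

lemma p_absorbed_mono:
  assumes "0 \<le> s" "s \<le> t" shows "p s x 0 \<le> p t x 0"
proof -
  have ck: "(\<lambda>y. p s x y * p (t - s) y 0) sums p t x 0"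
    using chapman_kolmogorov[of s "t - s" x 0] assms by simp
  have "(\<Sum>y\<in>{0}. p s x y * p (t - s) y 0) \<le> p t x 0"
    unfolding sums_unique[OF ck] by (rule sum_le_suminf[OF sums_summable[OF ck]]) auto
  then show ?thesis using p_trap[of "t - s"] assms by simp
qed

lemma p_absorbed_tendsto: "(\<lambda>n. p (real n) x 0) \<longlonglongrightarrow> 1"
proof -
  have "(\<lambda>n. measure (P x) {\<omega> \<in> space (P x). X (real n) \<omega> = enat 0}) \<longlonglongrightarrow> measure (P x) (space (P x))"
  proof (rule measure_tendsto_AE[OF prob_space_P])
    show "AE \<omega> in P x. \<forall>\<^sub>F n in sequentially. \<omega> \<in> {\<omega> \<in> space (P x). X (real n) \<omega> = enat 0} \<longleftrightarrow> \<omega> \<in> space (P x)"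
      using AE_eventually_0[of x]
    proof (elim AE_mp, intro AE_I2 impI)
      fix \<omega> assume \<omega>: "\<omega> \<in> space (P x)" "\<exists>t\<ge>0. \<forall>s\<ge>t. X s \<omega> = enat 0"
      then obtain t where t: "\<forall>s\<ge>t. X s \<omega> = enat 0" by auto
      show "\<forall>\<^sub>F n in sequentially. \<omega> \<in> {\<omega> \<in> space (P x). X (real n) \<omega> = enat 0} \<longleftrightarrow> \<omega> \<in> space (P x)"
        using eventually_ge_at_top[of "nat \<lceil>t\<rceil>"]
        by (rule eventually_mono) (use t \<omega> in \<open>auto simp: nat_ceiling_le_eq\<close>)
    qed
  qed auto
  then show ?thesis by (simp add: p_def P.prob_space)
qed

text \<open>\<open>AE_first_entrance\<close> with \<open>C = {z<..}\<close> and
  \<open>B = {..<z}\<close>; the only state in neither set is \<open>z\<close>.\<close>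

lemma AE_passes:
  assumes "z < x"
  shows "AE \<omega> in P x. \<forall>s\<ge>0. \<forall>v<z. X s \<omega> = enat v \<longrightarrow> (\<exists>r. 0 < r \<and> r < s \<and> X r \<omega> = enat z)"
proof -
  have "AE \<omega> in P x. \<forall>s\<ge>0. X s \<omega> \<in> enat ` {..<z} \<longrightarrow>
      (\<exists>r v. 0 \<le> r \<and> r < s \<and> X r \<omega> = enat v \<and> v \<notin> {z<..} \<and> v \<notin> {..<z})"
    by (rule AE_first_entrance) (use assms skip_free in auto)
  then show ?thesis using AE_start[of x]
  proof (elim AE_mp, intro AE_I2 impI allI)
    fix \<omega> s v assume v: "v < z" "X s \<omega> = enat v" and s: "0 \<le> s" and X0: "X 0 \<omega> = enat x"
      and first: "\<forall>s\<ge>0. X s \<omega> \<in> enat ` {..<z} \<longrightarrow>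
        (\<exists>r v. 0 \<le> r \<and> r < s \<and> X r \<omega> = enat v \<and> v \<notin> {z<..} \<and> v \<notin> {..<z})"
    have "X s \<omega> \<in> enat ` {..<z}" using v by simp
    then obtain r w where r: "0 \<le> r" "r < s" "X r \<omega> = enat w" "w \<notin> {z<..}" "w \<notin> {..<z}"
      using first s by blast
    then have rz: "X r \<omega> = enat z" by simp
    moreover have "r \<noteq> 0" using rz X0 assms by auto
    ultimately show "\<exists>r. 0 < r \<and> r < s \<and> X r \<omega> = enat z" using r by (auto intro!: exI[of _ r])
  qed
qed

text \<open>If this rate vanished, no jump would lead from \<open>{Suc x..}\<close> to
  \<open>{..x}\<close>, and as these sets exhaust the states, \<open>0\<close> could not be
  reached.\<close>

lemma Q_down: "0 < Q (Suc x) x"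
proof (rule ccontr)
  assume "\<not> 0 < Q (Suc x) x"
  then have "Q (Suc x) x = 0" using Q_offdiag_nonneg[of "Suc x" x] by simp
  then have Q0: "Q y u = 0" if "Suc x \<le> y" "u \<le> x" for y u
    using skip_free[of u y] that by (cases "y = Suc x \<and> u = x") auto
  have "AE \<omega> in P (Suc x). \<forall>s\<ge>0. X s \<omega> \<in> enat ` {..x} \<longrightarrow>
      (\<exists>r v. 0 \<le> r \<and> r < s \<and> X r \<omega> = enat v \<and> v \<notin> {Suc x..} \<and> v \<notin> {..x})"
    by (rule AE_first_entrance) (use Q0 in auto)
  then have "AE \<omega> in P (Suc x). False" using AE_eventually_0[of "Suc x"]
  proof (elim AE_mp, intro AE_I2 impI)
    fix \<omega> assume "\<exists>t\<ge>0. \<forall>s\<ge>t. X s \<omega> = enat 0"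
      and *: "\<forall>s\<ge>0. X s \<omega> \<in> enat ` {..x} \<longrightarrow>
        (\<exists>r v. 0 \<le> r \<and> r < s \<and> X r \<omega> = enat v \<and> v \<notin> {Suc x..} \<and> v \<notin> {..x})"
    then obtain t where "0 \<le> t" "X t \<omega> = enat 0" by auto
    then have "X t \<omega> \<in> enat ` {..x}" by simp
    then obtain v where "v \<notin> {Suc x..}" "v \<notin> {..x}" using * \<open>0 \<le> t\<close> by blast
    then show False by simp
  qed
  then show False by simp
qed

lemma Q_0: "Q 0 y = 0"
proof -
  have "(\<lambda>n. (p (mesh n) 0 y - (if 0 = y then 1 else 0)) / mesh n) \<longlonglongrightarrow> 0"
    by (cases "y = 0") (simp_all add: p_trap p_trap' less_imp_le)
  then show ?thesis using LIMSEQ_unique Q_mesh by blast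
qed

text \<open>Otherwise the states below \<open>b\<close> could never be left, while irreducibility
  lets the chain go from \<open>1\<close> to \<open>b\<close>.\<close>

lemma Q_upward:
  assumes "2 \<le> b"
  shows "\<exists>z c. 0 < z \<and> z < b \<and> b \<le> c \<and> Q z c \<noteq> 0"
proof (rule ccontr)
  assume no: "\<not> ?thesis"
  have AE: "AE \<omega> in P 1. \<forall>s\<ge>0. X s \<omega> \<in> enat ` {b..} \<longrightarrow>
      (\<exists>r v. 0 \<le> r \<and> r < s \<and> X r \<omega> = enat v \<and> v \<notin> {..<b} \<and> v \<notin> {b..})"
  proof (rule AE_first_entrance)
    show "Q y u = 0" if "y \<in> {..<b}" "u \<in> {b..}" for y u
      using no Q_0[of u] that assms by (cases "y = 0") auto
  qed (use assms in auto)
  have "AE \<omega> in P 1. \<not> hit X {b} \<omega> < \<infinity>" using AE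
  proof (elim AE_mp, intro AE_I2 impI notI)
    fix \<omega> assume \<omega>: "\<omega> \<in> space (P 1)" "hit X {b} \<omega> < \<infinity>"
      and *: "\<forall>s\<ge>0. X s \<omega> \<in> enat ` {b..} \<longrightarrow>
        (\<exists>r v. 0 \<le> r \<and> r < s \<and> X r \<omega> = enat v \<and> v \<notin> {..<b} \<and> v \<notin> {b..})"
    obtain h where "0 \<le> h" "X h \<omega> \<in> enat ` {b}" using hit_attained[OF \<omega>] by metis
    moreover from this have "X h \<omega> \<in> enat ` {b..}" by auto
    ultimately obtain v where "v \<notin> {..<b}" "v \<notin> {b..}" using * by blast
    then show False by simp
  qed
  moreover have [measurable]: "hit X {b} \<in> borel_measurable (P 1)" by (rule measurable_hit)
  ultimately have "\<P>(\<omega> in P 1. hit X {b} \<omega> < \<infinity>) = 0"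
    by (subst P.prob_eq_0) (auto elim: eventually_mono)
  then show False using irreducible[of 1 b] by simp
qed

end

section \<open>Excursions and the scale matrix\<close>

context killed_markov_chain
begin

text \<open>Weight of the \<open>k\<close>-step paths of the skeleton chain with transition matrix
  \<open>p d\<close> that end in \<open>y\<close> and whose steps all satisfy \<open>L\<close>. With
  values in \<open>ennreal\<close> the sums over infinitely many states always make sense.\<close>

primrec chain_prob :: "(nat \<Rightarrow> nat \<Rightarrow> bool) \<Rightarrow> real \<Rightarrow> nat \<Rightarrow> nat \<Rightarrow> nat \<Rightarrow> ennreal" where
  "chain_prob L d y 0 x = (if x = y then 1 else 0)"
| "chain_prob L d y (Suc k) x =
    (\<integral>\<^sup>+v. (if L x v then ennreal (p d x v) * chain_prob L d y k v else 0) \<partial>count_space UNIV)"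

definition chain :: "(nat \<Rightarrow> nat \<Rightarrow> bool) \<Rightarrow> real \<Rightarrow> real \<Rightarrow> nat \<Rightarrow> nat \<Rightarrow> 'a \<Rightarrow> bool" where
  "chain L d s y k \<omega> \<longleftrightarrow> X (s + real k * d) \<omega> = enat y \<and>
     (\<forall>i<k. \<exists>v w. X (s + real i * d) \<omega> = enat v \<and> X (s + real (Suc i) * d) \<omega> = enat w \<and> L v w)"

lemma chain_Suc: "chain L d s y (Suc k) \<omega> \<longleftrightarrow>
    (\<exists>v w. X s \<omega> = enat v \<and> X (s + d) \<omega> = enat w \<and> L v w \<and> chain L d (s + d) y k \<omega>)"
proof -
  have *: "s + d + real i * d = s + real (Suc i) * d" for i by (simp add: algebra_simps)
  show ?thesis unfolding chain_def * All_less_Suc2 by auto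
qed

lemma chain_Suc_eq: "{\<omega> \<in> space (P x). chain L d s y (Suc k) \<omega>} =
    (\<Union>v. \<Union>w\<in>{w. L v w}. {\<omega> \<in> space (P x). X s \<omega> = enat v} \<inter> {\<omega> \<in> space (P x). X (s + d) \<omega> = enat w} \<inter>
      {\<omega> \<in> space (P x). chain L d (s + d) y k \<omega>})"
  by (auto simp: chain_Suc)

lemma sets_chain: "0 \<le> s \<Longrightarrow> 0 \<le> d \<Longrightarrow> {\<omega> \<in> space (P x). chain L d s y k \<omega>} \<in> sets (P x)"
proof (induction k arbitrary: s)
  case 0 then show ?case by (simp add: chain_def sets_X_eq)
next
  case (Suc k)
  then show ?case unfolding chain_Suc_eq
    by (intro sets.countable_UN' sets.countable_UN'' sets.Int sets_X_eq) auto
qed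

text \<open>In the induction the state at time \<open>s\<close> is moved into the past event
  \<open>A\<close>, and the chain restarts from the state at \<open>s + d\<close>; so only the
  Markov property at fixed times is used.\<close>

lemma emeasure_chain:
  assumes "0 \<le> s" "0 \<le> d" "A \<in> past (P x0) X s"
  shows "emeasure (P x0) (A \<inter> {\<omega> \<in> space (P x0). X s \<omega> = enat x} \<inter> {\<omega> \<in> space (P x0). chain L d s y k \<omega>}) =
    emeasure (P x0) (A \<inter> {\<omega> \<in> space (P x0). X s \<omega> = enat x}) * chain_prob L d y k x"
  using assms
proof (induction k arbitrary: s A x)
  case 0
  have "A \<inter> {\<omega> \<in> space (P x0). X s \<omega> = enat x} \<inter> {\<omega> \<in> space (P x0). chain L d s y 0 \<omega>} =
      (if x = y then A \<inter> {\<omega> \<in> space (P x0). X s \<omega> = enat x} else {})"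
    by (auto simp: chain_def)
  then show ?case by simp
next
  case (Suc k)
  let ?X = "\<lambda>s x. {\<omega> \<in> space (P x0). X s \<omega> = enat x}"
  let ?C = "{\<omega> \<in> space (P x0). chain L d (s + d) y k \<omega>}"
  define A' where "A' = A \<inter> ?X s x"
  interpret past: sigma_algebra "space (P x0)" "past (P x0) X (s + d)" by (rule sigma_algebra_past)
  have "A \<in> past (P x0) X (s + d)" using past_mono[of s "s + d" x0] Suc.prems by auto
  moreover have "?X s x \<in> past (P x0) X (s + d)" using Suc.prems by (intro past_X_eq) auto
  ultimately have A': "A' \<in> past (P x0) X (s + d)" unfolding A'_def by (rule past.Int)
  have A's: "A' \<in> sets (P x0)" using A' past_sets by blast
  have C: "?C \<in> sets (P x0)" using Suc.prems by (intro sets_chain) auto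
  have X: "?X (s + d) v \<in> sets (P x0)" for v using Suc.prems by auto
  have step: "emeasure (P x0) (A' \<inter> ?X (s + d) v \<inter> ?C) =
      emeasure (P x0) A' * (ennreal (p d x v) * chain_prob L d y k v)" for v
  proof -
    have "emeasure (P x0) (A' \<inter> ?X (s + d) v \<inter> ?C) = emeasure (P x0) (A' \<inter> ?X (s + d) v) * chain_prob L d y k v"
      using Suc.prems A' by (intro Suc.IH) auto
    also have "emeasure (P x0) (A' \<inter> ?X (s + d) v) = ennreal (measure (P x0) A' * p d x v)"
      unfolding P.emeasure_eq_measure A'_def using markov_p[OF Suc.prems, of x v] by simp
    finally show ?thesis by (simp add: P.emeasure_eq_measure ennreal_mult mult.assoc)
  qed
  have "A \<inter> ?X s x \<inter> {\<omega> \<in> space (P x0). chain L d s y (Suc k) \<omega>} = (\<Union>v\<in>{v. L x v}. A' \<inter> ?X (s + d) v \<inter> ?C)"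
    by (auto simp: A'_def chain_Suc)
  then have "emeasure (P x0) (A \<inter> ?X s x \<inter> {\<omega> \<in> space (P x0). chain L d s y (Suc k) \<omega>}) =
      emeasure (P x0) (\<Union>v\<in>{v. L x v}. A' \<inter> ?X (s + d) v \<inter> ?C)" by simp
  also have "\<dots> = (\<integral>\<^sup>+v. emeasure (P x0) (A' \<inter> ?X (s + d) v \<inter> ?C) \<partial>count_space {v. L x v})"
    by (rule emeasure_UN_countable) (use A's C X in \<open>auto simp: disjoint_family_on_def\<close>)
  also have "\<dots> = (\<integral>\<^sup>+v. emeasure (P x0) A' * (ennreal (p d x v) * chain_prob L d y k v) \<partial>count_space {v. L x v})"
    by (simp only: step)
  also have "\<dots> = emeasure (P x0) A' * (\<integral>\<^sup>+v. (ennreal (p d x v) * chain_prob L d y k v) \<partial>count_space {v. L x v})"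
    by (rule nn_integral_cmult) simp
  also have "(\<integral>\<^sup>+v. (ennreal (p d x v) * chain_prob L d y k v) \<partial>count_space {v. L x v}) = chain_prob L d y (Suc k) x"
    by (auto simp: nn_integral_count_space_indicator indicator_def intro!: nn_integral_cong)
  finally show ?case by (simp only: A'_def)
qed

text \<open>
  The relation of consecutive grid values that describes a path which starts in \<open>z\<close> or elsewhere,
  does not return to \<open>z\<close> once it has left it, and stops at its first visit to \<open>x\<close>.
\<close>

definition excursion_step :: "nat \<Rightarrow> nat \<Rightarrow> nat \<Rightarrow> nat \<Rightarrow> bool" where
  "excursion_step x z v w \<longleftrightarrow> v \<noteq> x \<and> (v \<noteq> z \<longrightarrow> w \<noteq> z)"

definition grid_excursion :: "nat \<Rightarrow> nat \<Rightarrow> real \<Rightarrow> 'a \<Rightarrow> bool" where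
  "grid_excursion x z d \<omega> \<longleftrightarrow> (\<exists>k. chain (excursion_step x z) d 0 x k \<omega>)"

lemma sets_grid_excursion: "0 \<le> d \<Longrightarrow> {\<omega> \<in> space (P w). grid_excursion x z d \<omega>} \<in> sets (P w)"
proof -
  assume d: "0 \<le> d"
  have "{\<omega> \<in> space (P w). grid_excursion x z d \<omega>} = (\<Union>k. {\<omega> \<in> space (P w). chain (excursion_step x z) d 0 x k \<omega>})"
    by (auto simp: grid_excursion_def)
  then show ?thesis using d by (auto intro!: sets_chain)
qed

text \<open>Steps must start off \<open>x\<close>, so the events for different \<open>k\<close> are
  disjoint and the probability is the series of \<open>chain_prob\<close>; as
  \<open>w \<noteq> x\<close>, the term \<open>k = 0\<close> vanishes and the first step can be
  split off.\<close>

lemma grid_excursion_first_step: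
  assumes d: "0 \<le> d" and w: "w \<noteq> x"
  shows "(\<lambda>v. if excursion_step x z w v then p d w v * \<P>(\<omega> in P v. grid_excursion x z d \<omega>) else 0) sums
    \<P>(\<omega> in P w. grid_excursion x z d \<omega>)"
proof -
  let ?L = "excursion_step x z"
  define g where "g v = \<P>(\<omega> in P v. grid_excursion x z d \<omega>)" for v
  have g: "ennreal (g v) = (\<Sum>k. chain_prob ?L d x k v)" for v
  proof -
    let ?C = "\<lambda>k. {\<omega> \<in> space (P v). chain ?L d 0 x k \<omega>}"
    have C: "?C k \<in> sets (P v)" for k using d by (intro sets_chain) auto
    have disj: "disjoint_family ?C"
    proof (rule disjoint_family_natI)
      fix j k :: nat assume "j < k"
      have False if jk: "chain ?L d 0 x j \<omega>" "chain ?L d 0 x k \<omega>" for \<omega>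
      proof -
        obtain u where "X (0 + real j * d) \<omega> = enat u" "u \<noteq> x"
          using jk(2) \<open>j < k\<close> unfolding chain_def excursion_step_def by blast
        then show False using jk(1) unfolding chain_def by simp
      qed
      then show "?C j \<inter> ?C k = {}" by blast
    qed
    have ec: "emeasure (P v) (?C k) = chain_prob ?L d x k v" for k
    proof -
      let ?S = "{\<omega> \<in> space (P v). X 0 \<omega> = enat v}"
      have "emeasure (P v) (?C k) = emeasure (P v) (space (P v) \<inter> ?S \<inter> ?C k)"
      proof (rule emeasure_eq_AE)
        show "AE \<omega> in P v. \<omega> \<in> ?C k \<longleftrightarrow> \<omega> \<in> space (P v) \<inter> ?S \<inter> ?C k"
          using AE_start[of v] by (elim AE_mp) (intro AE_I2, auto)
      qed (use C in auto)
      also have "\<dots> = emeasure (P v) (space (P v) \<inter> ?S) * chain_prob ?L d x k v"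
        by (rule emeasure_chain) (use d past_X[of 0 0 v UNIV] in auto)
      also have "emeasure (P v) (space (P v) \<inter> ?S) = 1"
        using p_0[of v v] by (simp add: P.emeasure_eq_measure p_def Int_absorb1)
      finally show ?thesis by simp
    qed
    have "{\<omega> \<in> space (P v). grid_excursion x z d \<omega>} = (\<Union>k. ?C k)" by (auto simp: grid_excursion_def)
    then have "ennreal (g v) = emeasure (P v) (\<Union>k. ?C k)" by (simp add: g_def P.emeasure_eq_measure)
    also have "\<dots> = (\<Sum>k. emeasure (P v) (?C k))"
      by (rule suminf_emeasure[symmetric]) (use C disj in auto)
    also have "\<dots> = (\<Sum>k. chain_prob ?L d x k v)" by (simp only: ec)
    finally show ?thesis .
  qed
  have "ennreal (g w) = chain_prob ?L d x 0 w + (\<Sum>k. chain_prob ?L d x (Suc k) w)"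
    using suminf_offset[OF summableI, of "\<lambda>k. chain_prob ?L d x k w" 1]
    by (simp add: g add.commute del: chain_prob.simps)
  also have "\<dots> = (\<Sum>k. \<integral>\<^sup>+v. (if ?L w v then ennreal (p d w v) * chain_prob ?L d x k v else 0) \<partial>count_space UNIV)"
    using w by simp
  also have "\<dots> = (\<integral>\<^sup>+v. (\<Sum>k. if ?L w v then ennreal (p d w v) * chain_prob ?L d x k v else 0) \<partial>count_space UNIV)"
    by (rule nn_integral_suminf[symmetric]) simp
  also have "\<dots> = (\<integral>\<^sup>+v. ennreal (if ?L w v then p d w v * g v else 0) \<partial>count_space UNIV)"
  proof (intro nn_integral_cong)
    fix v
    have "ennreal (p d w v * g v) = ennreal (p d w v) * ennreal (g v)"
      by (rule ennreal_mult) (simp_all add: g_def)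
    also have "\<dots> = (\<Sum>k. ennreal (p d w v) * chain_prob ?L d x k v)"
      unfolding g by (rule ennreal_suminf_cmult[symmetric])
    finally show "(\<Sum>k. if ?L w v then ennreal (p d w v) * chain_prob ?L d x k v else 0) =
        ennreal (if ?L w v then p d w v * g v else 0)"
      by simp
  qed
  also have "\<dots> = (\<Sum>v. ennreal (if ?L w v then p d w v * g v else 0))"
    by (rule nn_integral_count_space_nat)
  finally have *: "(\<Sum>v. ennreal (if ?L w v then p d w v * g v else 0)) = ennreal (g w)" by simp
  have nn: "0 \<le> (if ?L w v then p d w v * g v else 0)" for v by (simp add: g_def)
  have "(\<lambda>v. ennreal (if ?L w v then p d w v * g v else 0)) sums ennreal (g w)"
    using summable_sums[OF summableI, of "\<lambda>v. ennreal (if ?L w v then p d w v * g v else 0)"] * by simp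
  then have "(\<lambda>v. if ?L w v then p d w v * g v else 0) sums g w"
    by (subst (asm) sums_ennreal) (use nn in \<open>auto simp: g_def\<close>)
  then show ?thesis unfolding g_def .
qed

text \<open>The path stays for a positive time in the state entered at the exit from
  \<open>z\<close>, at the return to \<open>z\<close> and at the hit of \<open>x\<close>. A mesh
  shorter than these stays sees all of them in the right order.\<close>

lemma eventually_grid_excursion:
  assumes \<omega>: "\<omega> \<in> space (P w)" and fin: "\<And>t. 0 \<le> t \<Longrightarrow> \<exists>v. X t \<omega> = enat v" and "x \<noteq> z"
  shows "\<forall>\<^sub>F n in sequentially. grid_excursion x z (mesh n) \<omega> \<longleftrightarrow> hit X {x} \<omega> < return_time X z \<omega>"
proof (cases "hit X (- {z}) \<omega> = \<infinity>")
  case True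
  have Xz: "X t \<omega> = enat z" if "0 < t" for t
  proof (rule ccontr)
    assume "X t \<omega> \<noteq> enat z"
    moreover obtain v where "X t \<omega> = enat v" using fin[of t] \<open>0 < t\<close> by auto
    ultimately have "hit X (- {z}) \<omega> \<le> ereal t" using that by (intro hit_le) auto
    then show False using True by simp
  qed
  have X0: "X 0 \<omega> = enat z"
    using right_constant[OF \<omega> order_refl] Xz by (metis add_0 field_lbound_gt_zero less_imp_le)
  then have Xz': "X t \<omega> = enat z" if "0 \<le> t" for t using that Xz[of t] by (cases "t = 0") auto
  have "\<not> grid_excursion x z (mesh n) \<omega>" for n
  proof
    assume "grid_excursion x z (mesh n) \<omega>"
    then obtain k where "X (real k * mesh n) \<omega> = enat x" by (auto simp: grid_excursion_def chain_def)
    moreover have "0 \<le> real k * mesh n" by (simp add: less_imp_le)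
    ultimately show False using Xz' \<open>x \<noteq> z\<close> by (metis enat.inject)
  qed
  moreover have "hit X {x} \<omega> = \<infinity>" using Xz \<open>x \<noteq> z\<close> by (auto simp: hit_def top_ereal_def[symmetric])
  ultimately show ?thesis by simp
next
  case False
  then obtain \<sigma> where \<sigma>: "hit X (- {z}) \<omega> = ereal \<sigma>" "0 \<le> \<sigma>" "X \<sigma> \<omega> \<in> enat ` (- {z})"
      "\<And>t. 0 < t \<Longrightarrow> t < \<sigma> \<Longrightarrow> X t \<omega> \<notin> enat ` (- {z})"
    by (rule hit_attained[OF \<omega>, of "- {z}", unfolded ereal_infty_less]) blast
  have \<sigma>z: "X \<sigma> \<omega> \<noteq> enat z" using \<sigma>(3) by auto
  have before: "X t \<omega> = enat z" if t: "0 \<le> t" "t < \<sigma>" for t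
  proof -
    have *: "X t \<omega> = enat z" if "0 < t" "t < \<sigma>" for t
      using \<sigma>(4)[OF that] fin[of t] that by auto
    show ?thesis
    proof (cases "t = 0")
      case True
      have s0: "0 < \<sigma>" using t by simp
      obtain q where "0 < q" "q < \<sigma>" "X q \<omega> = X 0 \<omega>" by (rule rational_in_right[OF \<omega> order_refl s0])
      then show ?thesis using *[of q] True by simp
    qed (use * t in auto)
  qed
  obtain e0 where e0: "0 < e0" "\<And>s. \<sigma> \<le> s \<Longrightarrow> s < \<sigma> + e0 \<Longrightarrow> X s \<omega> = X \<sigma> \<omega>"
    using right_constant[OF \<omega> \<sigma>(2)] by metis
  have R_def: "return_time X z \<omega> = (INF t\<in>{t. \<sigma> < t \<and> X t \<omega> \<in> enat ` {z}}. ereal t)"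
    by (simp add: return_time_def \<sigma>(1))
  have R_le: "return_time X z \<omega> \<le> ereal t" if "\<sigma> < t" "X t \<omega> = enat z" for t
    unfolding R_def by (rule INF_lower) (use that in auto)
  show ?thesis
  proof (cases "hit X {x} \<omega> < return_time X z \<omega>")
    case True
    then have fin_hit: "hit X {x} \<omega> < \<infinity>" by auto
    obtain \<tau> where \<tau>: "hit X {x} \<omega> = ereal \<tau>" "0 \<le> \<tau>" "X \<tau> \<omega> = enat x"
        "\<And>t. 0 < t \<Longrightarrow> t < \<tau> \<Longrightarrow> X t \<omega> \<noteq> enat x"
      by (rule hit_attained[OF \<omega> fin_hit]) (use that in \<open>simp add: image_iff\<close>)
    obtain e where e: "0 < e" "\<And>s. \<tau> \<le> s \<Longrightarrow> s < \<tau> + e \<Longrightarrow> X s \<omega> = X \<tau> \<omega>"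
      using right_constant[OF \<omega> \<tau>(2)] by metis
    have noz: "X t \<omega> \<noteq> enat z" if t: "\<sigma> \<le> t" "t < \<tau> + e" for t
    proof (cases "t = \<sigma> \<or> \<tau> \<le> t")
      case True then show ?thesis using \<sigma>z e(2)[of t] t \<tau>(3) \<open>x \<noteq> z\<close> by auto
    next
      case False
      then show ?thesis using R_le[of t] \<open>hit X {x} \<omega> < return_time X z \<omega>\<close> t \<tau>(1)
        by (metis ereal_less_eq(3) less_le less_le_trans not_le)
    qed
    have nox: "X t \<omega> \<noteq> enat x" if "0 \<le> t" "t < \<tau>" for t
    proof (cases "t = 0")
      case True
      have "X 0 \<omega> \<noteq> enat x"
      proof
        assume "X 0 \<omega> = enat x"
        then have "hit X {x} \<omega> \<le> ereal 0" by (intro hit_le0[OF \<omega>]) auto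
        then show False using \<tau>(1) that True by simp
      qed
      then show ?thesis using True by simp
    qed (use \<tau>(4) that in auto)
    have "\<forall>\<^sub>F n in sequentially. mesh n < e" by (rule eventually_mesh_less[OF e(1)])
    then have "\<forall>\<^sub>F n in sequentially. grid_excursion x z (mesh n) \<omega>"
    proof (rule eventually_mono)
      fix n assume n: "mesh n < e"
      \<comment> \<open>The first grid time at or after \<open>\<tau>\<close>: the path still sits
        in \<open>x\<close>, and no earlier grid time sees \<open>x\<close>, so the chain may stop
        there.\<close>
      define k where "k = (LEAST k. \<tau> \<le> real k * mesh n)"
      obtain j where j: "\<tau> \<le> real j * mesh n" "real j * mesh n < \<tau> + mesh n"
        using grid_point[OF \<tau>(2)] by metis
      have k: "\<tau> \<le> real k * mesh n" "k \<le> j"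
        unfolding k_def using j(1) by (auto intro: LeastI Least_le)
      have least: "real i * mesh n < \<tau>" if "i < k" for i
        using not_less_Least[of i "\<lambda>k. \<tau> \<le> real k * mesh n"] that unfolding k_def by auto
      have "real k * mesh n \<le> real j * mesh n" using k(2) by (intro mult_right_mono) (auto simp: less_imp_le)
      then have ke: "real k * mesh n < \<tau> + e" using j(2) n by linarith
      have "chain (excursion_step x z) (mesh n) 0 x k \<omega>"
        unfolding chain_def add_0
      proof (intro conjI allI impI)
        show "X (real k * mesh n) \<omega> = enat x" using e(2)[OF k(1) ke] \<tau>(3) by simp
        fix i assume i: "i < k"
        have i0: "0 \<le> real i * mesh n" "0 \<le> real (Suc i) * mesh n" by (simp_all add: less_imp_le)
        obtain v where v: "X (real i * mesh n) \<omega> = enat v" using fin[OF i0(1)] by auto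
        obtain w where w: "X (real (Suc i) * mesh n) \<omega> = enat w" using fin[OF i0(2)] by auto
        have vx: "v \<noteq> x" using nox[OF i0(1) least[OF i]] v by auto
        have "real (Suc i) * mesh n \<le> real k * mesh n" using i by (intro mult_right_mono) (auto simp: less_imp_le)
        then have si: "real (Suc i) * mesh n < \<tau> + e" using ke by linarith
        have "w \<noteq> z" if "v \<noteq> z"
        proof -
          have "\<not> real i * mesh n < \<sigma>" using before[OF i0(1)] that v by auto
          moreover have "real i * mesh n \<le> real (Suc i) * mesh n" by (intro mult_right_mono) (auto simp: less_imp_le)
          ultimately have "\<sigma> \<le> real (Suc i) * mesh n" by linarith
          then show ?thesis using noz[OF _ si] w by auto
        qed
        then show "\<exists>v w. X (real i * mesh n) \<omega> = enat v \<and> X (real (Suc i) * mesh n) \<omega> = enat w \<and> excursion_step x z v w"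
          using v w vx by (auto simp: excursion_step_def)
      qed
      then show "grid_excursion x z (mesh n) \<omega>" by (auto simp: grid_excursion_def)
    qed
    then show ?thesis using True by simp
  next
    case False
    then have Rle: "return_time X z \<omega> \<le> hit X {x} \<omega>" by simp
    show ?thesis
    proof (cases "hit X {x} \<omega> = \<infinity>")
      case True
      have "X t \<omega> \<noteq> enat x" if "0 \<le> t" for t
        using hit_le0[OF \<omega> that, of "{x}"] True by auto
      then have "\<not> grid_excursion x z (mesh n) \<omega>" for n
        by (auto simp: grid_excursion_def chain_def less_imp_le)
      then show ?thesis using False by simp
    next
      case False
      then have fin_hit: "hit X {x} \<omega> < \<infinity>" by auto
      obtain \<tau> where \<tau>: "hit X {x} \<omega> = ereal \<tau>" "0 \<le> \<tau>" "X \<tau> \<omega> = enat x"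
        by (rule hit_attained[OF \<omega> fin_hit]) (use that in simp)
      have R_fin: "return_time X z \<omega> < \<infinity>" using Rle fin_hit by (rule le_less_trans)
      obtain r where r: "return_time X z \<omega> = ereal r" "\<sigma> \<le> r" "X r \<omega> \<in> enat ` {z}"
        by (rule first_time_attained[OF \<omega> \<sigma>(2) R_def R_fin]) blast
      have rz: "X r \<omega> = enat z" using r(3) by simp
      have "r \<noteq> \<sigma>" using rz \<sigma>z by auto
      then have \<sigma>r: "\<sigma> < r" using r(2) by simp
      have "r \<noteq> \<tau>" using rz \<tau>(3) \<open>x \<noteq> z\<close> by auto
      then have r\<tau>: "r < \<tau>" using Rle r(1) \<tau>(1) by simp
      have r0: "0 \<le> r" using \<sigma>(2) \<sigma>r by simp
      obtain e where e: "0 < e" "\<And>s. r \<le> s \<Longrightarrow> s < r + e \<Longrightarrow> X s \<omega> = X r \<omega>"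
        using right_constant[OF \<omega> r0] by metis
      have "\<forall>\<^sub>F n in sequentially. mesh n < min (min e (\<tau> - r)) (min e0 (r - \<sigma>))"
        by (rule eventually_mesh_less) (use e e0 r\<tau> \<sigma>r in auto)
      then have "\<forall>\<^sub>F n in sequentially. \<not> grid_excursion x z (mesh n) \<omega>"
      proof (rule eventually_mono, intro notI)
        fix n assume n: "mesh n < min (min e (\<tau> - r)) (min e0 (r - \<sigma>))"
        assume "grid_excursion x z (mesh n) \<omega>"
        then obtain k where k: "X (real k * mesh n) \<omega> = enat x"
          "\<And>i. i < k \<Longrightarrow> \<exists>v w. X (real i * mesh n) \<omega> = enat v \<and> X (real (Suc i) * mesh n) \<omega> = enat w \<and> excursion_step x z v w"
          by (auto simp: grid_excursion_def chain_def)
        have "hit X {x} \<omega> \<le> ereal (real k * mesh n)"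
          by (rule hit_le0[OF \<omega>]) (use k(1) in \<open>auto simp: less_imp_le\<close>)
        then have k\<tau>: "\<tau> \<le> real k * mesh n" using \<tau>(1) by simp
        \<comment> \<open>The grid times \<open>i < j < k\<close> see the path just after its exit
          from \<open>z\<close>, just after its return to \<open>z\<close>, and in \<open>x\<close>.
          By \<open>excursion_step\<close>, a grid path that is off \<open>z\<close> at
          \<open>i\<close> is never at \<open>z\<close> up to \<open>k\<close>, contrary to
          \<open>j\<close>.\<close>
        obtain i where i: "\<sigma> \<le> real i * mesh n" "real i * mesh n < \<sigma> + mesh n" using grid_point[OF \<sigma>(2)] by metis
        obtain j where j: "r \<le> real j * mesh n" "real j * mesh n < r + mesh n" using grid_point[OF r0] by metis
        have Xi: "X (real i * mesh n) \<omega> \<noteq> enat z" using e0(2)[OF i(1)] i(2) n \<sigma>z by auto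
        have Xj: "X (real j * mesh n) \<omega> = enat z" using e(2)[OF j(1)] j(2) n rz by auto
        have "real i * mesh n < real j * mesh n" using i j n by linarith
        then have ij: "i < j" using mesh_pos[of n] by (simp add: mult_less_cancel_right)
        have "real j * mesh n < real k * mesh n" using j(2) n k\<tau> by linarith
        then have jk: "j < k" using mesh_pos[of n] by (simp add: mult_less_cancel_right)
        have "X (real m * mesh n) \<omega> \<noteq> enat z" if "i \<le> m" "m \<le> j" for m
          using that
        proof (induction m rule: dec_induct)
          case base show ?case by (rule Xi)
        next
          case (step m)
          have "m < k" using step.prems jk by simp
          from k(2)[OF this] obtain v w where vw: "X (real m * mesh n) \<omega> = enat v"
            "X (real (Suc m) * mesh n) \<omega> = enat w" "excursion_step x z v w" by blast
          have "v \<noteq> z" using step vw(1) by auto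
          then show ?case using vw(2,3) by (auto simp: excursion_step_def)
        qed
        then show False using Xj ij by auto
      qed
      moreover have "\<not> hit X {x} \<omega> < return_time X z \<omega>" using Rle by simp
      ultimately show ?thesis by simp
    qed
  qed
qed

text \<open>The rows of \<open>Q\<close> sum to \<open>0\<close>, so the tails of the difference quotients are controlled by their heads.\<close>

lemma first_step_limit:
  assumes Q0: "(\<lambda>v. Q w v) sums 0"
    and g: "\<And>n v. 0 \<le> g n v" "\<And>n v. g n v \<le> 1" "\<And>v. (\<lambda>n. g n v) \<longlonglongrightarrow> g' v"
    and eq: "\<And>n. (\<lambda>v. p (mesh n) w v * g n v) sums g n w"
  shows "(\<lambda>v. Q w v * g' v) sums 0"
proof -
  define D where "D n v = (p (mesh n) w v - (if w = v then 1 else 0)) / mesh n" for n v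
  have D_lim: "(\<lambda>n. D n v) \<longlonglongrightarrow> Q w v" for v unfolding D_def by (rule Q_mesh)
  \<comment> \<open>For \<open>M > w\<close> the tail beyond \<open>M\<close> has no diagonal term,
    so it is nonnegative and at most \<open>(1 - (\<Sum>v<M. p (mesh n) w v)) / mesh n\<close>, the
    negative of the head of \<open>D\<close>. By \<open>eq\<close> the weighted head is minus the
    weighted tail.\<close>
  have bound: "\<bar>\<Sum>v<M. D n v * g n v\<bar> \<le> - (\<Sum>v<M. D n v)" if M: "w < M" for n M
  proof -
    let ?d = "mesh n"
    have d: "0 < ?d" by simp
    have split: "(\<Sum>v<M. p ?d w v * g n v) + (\<Sum>v. p ?d w (v + M) * g n (v + M)) = g n w"
      using suminf_split_initial_segment[OF sums_summable[OF eq[of n]], of M] sums_unique[OF eq[of n]] by simp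
    have sm: "summable (\<lambda>v. p ?d w (v + M) * g n (v + M))"
      using sums_summable[OF eq[of n]] by (simp add: summable_iff_shift[of "\<lambda>v. p ?d w v * g n v"])
    have smp: "summable (\<lambda>v. p ?d w (v + M))"
      using p_summable[of ?d w] by (simp add: summable_iff_shift less_imp_le)
    have "(\<Sum>v. p ?d w (v + M) * g n (v + M)) \<le> (\<Sum>v. p ?d w (v + M))"
      using g by (intro suminf_le sm smp) (simp add: mult_left_le)
    also have "\<dots> \<le> 1 - (\<Sum>v<M. p ?d w v)"
      using suminf_split_initial_segment[OF p_summable[of ?d w], of M] p_suminf_le[of ?d w] by (simp add: less_imp_le)
    finally have up: "(\<Sum>v. p ?d w (v + M) * g n (v + M)) \<le> 1 - (\<Sum>v<M. p ?d w v)" .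
    have lo: "0 \<le> (\<Sum>v. p ?d w (v + M) * g n (v + M))" using g by (intro suminf_nonneg sm) simp
    have 1: "(\<Sum>v<M. D n v * g n v) = ((\<Sum>v<M. p ?d w v * g n v) - g n w) / ?d"
    proof -
      have "(\<Sum>v<M. D n v * g n v) = (\<Sum>v<M. (p ?d w v * g n v - (if w = v then g n w else 0)) / ?d)"
        by (intro sum.cong) (auto simp: D_def algebra_simps)
      also have "\<dots> = ((\<Sum>v<M. p ?d w v * g n v) - (\<Sum>v<M. if w = v then g n w else 0)) / ?d"
        by (simp only: sum_divide_distrib[symmetric] sum_subtractf)
      finally show ?thesis using M by simp
    qed
    have 2: "(\<Sum>v<M. D n v) = ((\<Sum>v<M. p ?d w v) - 1) / ?d"
      using M by (simp add: D_def sum_divide_distrib[symmetric] sum_subtractf)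
    define T where "T = (\<Sum>v. p ?d w (v + M) * g n (v + M))"
    have "(\<Sum>v<M. p ?d w v * g n v) - g n w = - T" using split by (simp add: T_def)
    moreover have "\<bar>- T / ?d\<bar> = T / ?d" using lo by (simp add: T_def abs_of_pos[OF mesh_pos])
    moreover have "- (((\<Sum>v<M. p ?d w v) - 1) / ?d) = (1 - (\<Sum>v<M. p ?d w v)) / ?d"
      by (simp only: minus_divide_left minus_diff_eq)
    moreover have "T / ?d \<le> (1 - (\<Sum>v<M. p ?d w v)) / ?d" unfolding T_def by (rule divide_right_mono[OF up]) (simp add: less_imp_le)
    ultimately show ?thesis unfolding 1 2 by (simp only:)
  qed
  \<comment> \<open>The order of limits matters: first \<open>n\<close> at fixed \<open>M\<close>,
    where the sums are finite, then \<open>M\<close>, where the zero row sum makes the bound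
    vanish.\<close>
  have lim: "\<bar>\<Sum>v<M. Q w v * g' v\<bar> \<le> - (\<Sum>v<M. Q w v)" if M: "w < M" for M
  proof (rule LIMSEQ_le)
    show "(\<lambda>n. \<bar>\<Sum>v<M. D n v * g n v\<bar>) \<longlonglongrightarrow> \<bar>\<Sum>v<M. Q w v * g' v\<bar>" by (intro tendsto_intros D_lim g)
    show "(\<lambda>n. - (\<Sum>v<M. D n v)) \<longlonglongrightarrow> - (\<Sum>v<M. Q w v)" by (intro tendsto_intros D_lim)
  qed (use bound[OF M] in auto)
  have "(\<lambda>M. \<Sum>v<M. Q w v * g' v) \<longlonglongrightarrow> 0"
  proof (rule tendsto_rabs_zero_cancel, rule tendsto_sandwich[OF _ _ tendsto_const])
    show "(\<lambda>M. - (\<Sum>v<M. Q w v)) \<longlonglongrightarrow> 0" using tendsto_minus[OF Q0[unfolded sums_def]] by simp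
    show "\<forall>\<^sub>F M in sequentially. \<bar>\<Sum>v<M. Q w v * g' v\<bar> \<le> - (\<Sum>v<M. Q w v)"
      using eventually_gt_at_top[of w] by (rule eventually_mono) (rule lim)
  qed simp
  then show ?thesis by (simp add: sums_def)
qed

end

section \<open>Escape probabilities as harmonic functions\<close>

context absorbed_chain
begin

text \<open>The start \<open>w\<close> is free: for \<open>w = z\<close> this is the probability
  inside \<open>n_laplace\<close>, while for \<open>w\<close> different from both \<open>x\<close>
  and \<open>z\<close> the exit time from \<open>z\<close> is \<open>0\<close> almost surely and it
  is the probability of hitting \<open>x\<close> before \<open>z\<close>.\<close>

definition excursion_prob :: "nat \<Rightarrow> nat \<Rightarrow> nat \<Rightarrow> real" where
  "excursion_prob x z w = \<P>(\<omega> in P w. hit X {x} \<omega> < return_time X z \<omega>)"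

lemma sets_excursion: "{\<omega> \<in> space (P w). hit X {x} \<omega> < return_time X z \<omega>} \<in> sets (P w)"
  using measurable_hit[of "{x}" w] measurable_return_time[of z w] by measurable

lemma n_laplace_0: "n_laplace P X Q 0 z x = - Q z z * excursion_prob x z z"
proof -
  have "(LINT \<omega>|P z. exp (- 0 * real_of_ereal (hit X {x} \<omega> - hit X (- {z}) \<omega>)) *
        indicator {\<omega>. hit X {x} \<omega> < return_time X z \<omega>} \<omega>) =
      measure (P z) ({\<omega>. hit X {x} \<omega> < return_time X z \<omega>} \<inter> space (P z))"
    by simp
  also have "{\<omega>. hit X {x} \<omega> < return_time X z \<omega>} \<inter> space (P z) =
      {\<omega> \<in> space (P z). hit X {x} \<omega> < return_time X z \<omega>}" by auto
  finally show ?thesis by (simp add: n_laplace_def excursion_prob_def)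
qed

lemma grid_excursion_tendsto:
  assumes "x \<noteq> z"
  shows "(\<lambda>n. \<P>(\<omega> in P w. grid_excursion x z (mesh n) \<omega>)) \<longlonglongrightarrow> excursion_prob x z w"
  unfolding excursion_prob_def
proof (rule measure_tendsto_AE[OF prob_space_P])
  show "AE \<omega> in P w. \<forall>\<^sub>F n in sequentially. \<omega> \<in> {\<omega> \<in> space (P w). grid_excursion x z (mesh n) \<omega>} \<longleftrightarrow>
      \<omega> \<in> {\<omega> \<in> space (P w). hit X {x} \<omega> < return_time X z \<omega>}"
    using AE_finite[of w]
  proof (elim AE_mp, intro AE_I2 impI)
    fix \<omega> assume "\<omega> \<in> space (P w)" "\<forall>t\<ge>0. \<exists>v. X t \<omega> = enat v"
    then show "\<forall>\<^sub>F n in sequentially. \<omega> \<in> {\<omega> \<in> space (P w). grid_excursion x z (mesh n) \<omega>} \<longleftrightarrow>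
      \<omega> \<in> {\<omega> \<in> space (P w). hit X {x} \<omega> < return_time X z \<omega>}"
      using eventually_grid_excursion[OF _ _ assms, of \<omega> w] by (auto elim!: eventually_mono)
  qed
qed (auto intro: sets_grid_excursion sets_excursion simp: less_imp_le)

text \<open>From \<open>w \<noteq> z\<close> a step to \<open>z\<close> is a return and contributes
  \<open>0\<close>; from \<open>z\<close> itself a grid step to \<open>z\<close> only prolongs the
  initial stay. This is why the value at \<open>v = z\<close> depends on \<open>w\<close>.\<close>

lemma excursion_prob_harmonic:
  assumes "x \<noteq> z" "w \<noteq> x"
  shows "(\<lambda>v. Q w v * (if w \<noteq> z \<and> v = z then 0 else excursion_prob x z v)) sums 0"
proof (rule first_step_limit[where g = "\<lambda>n v. if w \<noteq> z \<and> v = z then 0 else \<P>(\<omega> in P v. grid_excursion x z (mesh n) \<omega>)"])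
  fix n
  have "(\<lambda>v. p (mesh n) w v * (if w \<noteq> z \<and> v = z then 0 else \<P>(\<omega> in P v. grid_excursion x z (mesh n) \<omega>))) =
      (\<lambda>v. if excursion_step x z w v then p (mesh n) w v * \<P>(\<omega> in P v. grid_excursion x z (mesh n) \<omega>) else 0)"
    using assms(2) by (auto simp: excursion_step_def)
  then show "(\<lambda>v. p (mesh n) w v * (if w \<noteq> z \<and> v = z then 0 else \<P>(\<omega> in P v. grid_excursion x z (mesh n) \<omega>))) sums
      (if w \<noteq> z \<and> w = z then 0 else \<P>(\<omega> in P w. grid_excursion x z (mesh n) \<omega>))"
    using grid_excursion_first_step[of "mesh n" w x z] assms(2) by (simp add: less_imp_le)
next
  fix v
  show "(\<lambda>n. if w \<noteq> z \<and> v = z then 0 else \<P>(\<omega> in P v. grid_excursion x z (mesh n) \<omega>)) \<longlonglongrightarrow>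
      (if w \<noteq> z \<and> v = z then 0 else excursion_prob x z v)"
    using grid_excursion_tendsto[OF assms(1), of v] by auto
qed (auto intro: conservative)

lemma excursion_prob_target:
  assumes "x \<noteq> z" shows "excursion_prob x z x = 1"
proof -
  have "\<P>(\<omega> in P x. grid_excursion x z (mesh n) \<omega>) = 1" for n
  proof (subst P.prob_eq_1)
    show "AE \<omega> in P x. \<omega> \<in> {\<omega> \<in> space (P x). grid_excursion x z (mesh n) \<omega>}"
      using AE_start[of x]
    proof (elim AE_mp, intro AE_I2 impI)
      fix \<omega> assume "\<omega> \<in> space (P x)" "X 0 \<omega> = enat x"
      then show "\<omega> \<in> {\<omega> \<in> space (P x). grid_excursion x z (mesh n) \<omega>}"
        by (auto simp: grid_excursion_def chain_def intro!: exI[of _ 0])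
    qed
  qed (auto intro: sets_grid_excursion simp: less_imp_le)
  then have "(\<lambda>n. 1) \<longlonglongrightarrow> excursion_prob x z x" using grid_excursion_tendsto[OF assms, of x] by simp
  then show ?thesis by (simp add: LIMSEQ_const_iff)
qed

text \<open>By \<open>AE_passes\<close> the path meets \<open>z\<close> before \<open>x\<close>, and
  having started off \<open>z\<close> this meeting is a return.\<close>

lemma excursion_prob_above:
  assumes "x < z" "z < v" shows "excursion_prob x z v = 0"
proof -
  have "AE \<omega> in P v. \<not> hit X {x} \<omega> < return_time X z \<omega>"
    using AE_passes[OF assms(2)] AE_start[of v]
  proof (elim AE_mp, intro AE_I2 impI notI)
    fix \<omega> assume \<omega>: "\<omega> \<in> space (P v)" "hit X {x} \<omega> < return_time X z \<omega>" and X0: "X 0 \<omega> = enat v"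
      and passes: "\<forall>s\<ge>0. \<forall>v<z. X s \<omega> = enat v \<longrightarrow> (\<exists>r>0. r < s \<and> X r \<omega> = enat z)"
    have fin_hit: "hit X {x} \<omega> < \<infinity>" using \<omega>(2) by auto
    obtain \<tau> where \<tau>: "hit X {x} \<omega> = ereal \<tau>" "0 \<le> \<tau>" "X \<tau> \<omega> = enat x"
      by (rule hit_attained[OF \<omega>(1) fin_hit]) (use that in simp)
    obtain r where r: "0 < r" "r < \<tau>" "X r \<omega> = enat z" using passes \<tau> assms(1) by blast
    have "hit X (- {z}) \<omega> \<le> ereal 0" by (rule hit_le0[OF \<omega>(1)]) (use X0 assms in auto)
    also have "\<dots> < ereal r" using r by simp
    finally have "return_time X z \<omega> \<le> ereal r"
      unfolding return_time_def by (intro INF_lower) (use r in auto)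
    also have "\<dots> < ereal \<tau>" using r by simp
    finally show False using \<omega>(2) \<tau>(1) by simp
  qed
  then show ?thesis unfolding excursion_prob_def using sets_excursion[of v x z]
    by (subst P.prob_eq_0) (auto elim: eventually_mono)
qed

lemma excursion_prob_sum:
  assumes "x < y" "y < z" shows "(\<Sum>v<z. Q y v * excursion_prob x z v) = 0"
proof -
  have xz: "x \<noteq> z" and yx: "y \<noteq> x" using assms by auto
  have "(\<lambda>v. Q y v * (if y \<noteq> z \<and> v = z then 0 else excursion_prob x z v)) sums
      (\<Sum>v<z. Q y v * (if y \<noteq> z \<and> v = z then 0 else excursion_prob x z v))"
    by (rule sums_finite) (use assms in \<open>auto simp: not_less le_less excursion_prob_above\<close>)
  then have "(\<Sum>v<z. Q y v * (if y \<noteq> z \<and> v = z then 0 else excursion_prob x z v)) = 0"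
    using sums_unique2 excursion_prob_harmonic[OF xz yx] by blast
  then show ?thesis by simp
qed

text \<open>Harmonicity in the row \<open>Suc y\<close> itself: states above contribute nothing, and
  the only state below reached by a jump is \<open>y\<close>.\<close>

lemma n_laplace_eq:
  assumes "x \<le> y" shows "n_laplace P X Q 0 (Suc y) x = Q (Suc y) y * excursion_prob x (Suc y) y"
proof -
  let ?z = "Suc y"
  have xz: "x \<noteq> ?z" "?z \<noteq> x" using assms by auto
  have "(\<lambda>v. Q ?z v * (if ?z \<noteq> ?z \<and> v = ?z then 0 else excursion_prob x ?z v)) sums
      (\<Sum>v\<le>?z. Q ?z v * (if ?z \<noteq> ?z \<and> v = ?z then 0 else excursion_prob x ?z v))"
    by (rule sums_finite) (use assms in \<open>auto simp: not_le excursion_prob_above\<close>)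
  then have "(\<Sum>v\<le>?z. Q ?z v * (if ?z \<noteq> ?z \<and> v = ?z then 0 else excursion_prob x ?z v)) = 0"
    using sums_unique2 excursion_prob_harmonic[OF xz] by blast
  then have "(\<Sum>v<?z. Q ?z v * excursion_prob x ?z v) + Q ?z ?z * excursion_prob x ?z ?z = 0"
    by (simp add: lessThan_Suc_atMost[symmetric])
  moreover have "(\<Sum>v<?z. Q ?z v * excursion_prob x ?z v) = (\<Sum>v\<in>{y}. Q ?z v * excursion_prob x ?z v)"
    by (rule sum.mono_neutral_right) (auto simp: skip_free)
  ultimately show ?thesis by (simp add: n_laplace_0)
qed

text \<open>Row \<open>Suc v\<close> involves \<open>f v\<close>, with coefficient
  \<open>Q (Suc v) v \<noteq> 0\<close>, and otherwise only values to the right, so the value at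
  \<open>z - 1\<close> determines all others.\<close>

lemma harmonic_zero:
  assumes f: "\<And>y. x < y \<Longrightarrow> y < z \<Longrightarrow> (\<Sum>v<z. Q y v * f v) = 0" and "f (z - 1) = 0"
    and "x \<le> v" "v < z"
  shows "f v = 0"
  using assms(3,4)
proof (induction "z - v" arbitrary: v rule: less_induct)
  case less
  show ?case
  proof (cases "v = z - 1")
    case False
    then have v: "Suc v < z" using less.prems by simp
    have "(\<Sum>w<z. Q (Suc v) w * f w) = (\<Sum>w\<in>{v}. Q (Suc v) w * f w)"
    proof (rule sum.mono_neutral_right)
      show "\<forall>w\<in>{..<z} - {v}. Q (Suc v) w * f w = 0"
      proof
        fix w assume w: "w \<in> {..<z} - {v}"
        show "Q (Suc v) w * f w = 0"
        proof (cases "w < v")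
          case True then show ?thesis by (simp add: skip_free)
        next
          case False
          then have "f w = 0" using w less.prems by (intro less.hyps) auto
          then show ?thesis by simp
        qed
      qed
    qed (use v in auto)
    then show ?thesis using f[of "Suc v"] v less.prems Q_down[of v] by simp
  qed (use assms(2) in simp)
qed

text \<open>The factorisation of \<open>excursion_prob 0 z y\<close> at an intermediate state
  \<open>v\<close>, usually the strong Markov property, is obtained from uniqueness:
  \<open>f\<close> combines two harmonic functions so as to vanish at \<open>y\<close>, hence it
  vanishes at \<open>v\<close>, where \<open>excursion_prob v z v = 1\<close>. It shows that column
  \<open>z\<close> of the scale matrix is proportional to \<open>excursion_prob 0 z\<close>.\<close>

lemma scale_nonneg_0: "v \<le> y \<Longrightarrow> scale_nonneg P X Q 0 v (Suc y) =
    excursion_prob 0 (Suc y) v / (Q (Suc y) y * excursion_prob 0 (Suc y) y)"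
  and excursion_prob_nonzero: "excursion_prob 0 (Suc y) y \<noteq> 0"
proof -
  let ?z = "Suc y"
  show nz: "excursion_prob 0 ?z y \<noteq> 0"
  proof
    assume "excursion_prob 0 ?z y = 0"
    then have "excursion_prob 0 ?z 0 = 0"
      by (intro harmonic_zero[of 0 ?z "excursion_prob 0 ?z" 0]) (auto simp: excursion_prob_sum simp del: sum.lessThan_Suc)
    then show False using excursion_prob_target[of 0 ?z] by simp
  qed
  assume v: "v \<le> y"
  define f where "f w = excursion_prob 0 ?z y * excursion_prob v ?z w - excursion_prob v ?z y * excursion_prob 0 ?z w" for w
  have "f v = 0"
  proof (rule harmonic_zero[of v ?z f v])
    fix u assume u: "v < u" "u < ?z"
    have "(\<Sum>w<?z. Q u w * f w) = excursion_prob 0 ?z y * (\<Sum>w<?z. Q u w * excursion_prob v ?z w) -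
        excursion_prob v ?z y * (\<Sum>w<?z. Q u w * excursion_prob 0 ?z w)"
      unfolding f_def sum_distrib_left sum_subtractf[symmetric] by (intro sum.cong) (auto simp: algebra_simps)
    then show "(\<Sum>w<?z. Q u w * f w) = 0"
      using excursion_prob_sum[of v u ?z] excursion_prob_sum[of 0 u ?z] u by simp
  qed (use v in \<open>auto simp: f_def\<close>)
  then have *: "excursion_prob 0 ?z y = excursion_prob v ?z y * excursion_prob 0 ?z v"
    using v by (simp add: f_def excursion_prob_target)
  then have "excursion_prob 0 ?z v \<noteq> 0" "excursion_prob v ?z y \<noteq> 0" using nz by auto
  then show "scale_nonneg P X Q 0 v ?z = excursion_prob 0 ?z v / (Q ?z y * excursion_prob 0 ?z y)"
    using v Q_down[of y] by (simp add: scale_nonneg_def n_laplace_eq * field_simps)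
qed

text \<open>Rows strictly below the index \<open>z\<close> vanish by harmonicity and rows above it
  by skip-freeness; in row \<open>z\<close> only \<open>v = z - 1\<close> is left, and there the
  normalisation of the column gives \<open>1\<close>.\<close>

lemma skip_free_matrix_scale: "skip_free_matrix Q (scale_nonneg P X Q 0)"
proof
  fix y z
  let ?W = "scale_nonneg P X Q 0"
  show "(\<Sum>v<z. Q (Suc y) v * ?W v z) = (if Suc y = z then 1 else 0)"
  proof (cases z)
    case (Suc m)
    have *: "(\<Sum>v<z. Q (Suc y) v * ?W v z) =
        (\<Sum>v<z. Q (Suc y) v * excursion_prob 0 z v) / (Q z m * excursion_prob 0 z m)"
      unfolding sum_divide_distrib by (intro sum.cong) (auto simp: Suc scale_nonneg_0)
    consider "Suc y < z" | "Suc y = z" | "z \<le> y" by linarith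
    then show ?thesis
    proof cases
      case 1 then show ?thesis unfolding * by (simp add: excursion_prob_sum)
    next
      case 2
      then have "(\<Sum>v<z. Q (Suc y) v * excursion_prob 0 z v) = (\<Sum>v\<in>{m}. Q (Suc y) v * excursion_prob 0 z v)"
        using Suc by (intro sum.mono_neutral_right) (auto simp: skip_free)
      then show ?thesis unfolding * using 2 Suc Q_down[of m] excursion_prob_nonzero[of m] by simp
    next
      case 3
      then show ?thesis unfolding * by (simp add: skip_free)
    qed
  qed simp
qed (auto simp: conservative skip_free Q_offdiag_nonneg Q_down scale_nonneg_def)

sublocale skip_free_matrix Q "scale_nonneg P X Q 0"
  by (rule skip_free_matrix_scale)

lemma scale_fun_eq_V: "scale_fun P X Q q x y = V q x y"
  by (simp add: scale_fun_def V_def)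

lemma nu_eq: "nu P X Q l x = l * V (- l) 0 x"
  by (simp add: nu_def scale_fun_eq_V)

end

section \<open>A supersolution from exponential moments\<close>

context absorbed_chain
begin

text \<open>On its way to \<open>0\<close> the path from \<open>Suc x\<close> visits
  \<open>x\<close> and then has less time left. The decomposition by the first grid time in
  \<open>x\<close> needs the Markov property at fixed times only, and it exhausts the event as the
  mesh shrinks.\<close>

lemma p_absorbed_antimono: "p t (Suc x) 0 \<le> p t x 0" if t: "0 \<le> t"
proof (cases "x = 0")
  case True then show ?thesis using p_trap[OF t] by simp
next
  case False
  define V where "V n k = {\<omega> \<in> space (P (Suc x)). \<forall>i<k. X (real i * mesh n) \<omega> \<in> - {enat x}} \<inter>
      {\<omega> \<in> space (P (Suc x)). X (real k * mesh n) \<omega> = enat x}" for n k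
  define Z where "Z = {\<omega> \<in> space (P (Suc x)). X t \<omega> = enat 0}"
  define K where "K n = {k. real k * mesh n \<le> t}" for n
  have K_fin: "finite (K n)" for n
  proof (rule finite_subset)
    show "K n \<subseteq> {..nat \<lceil>t / mesh n\<rceil>}"
    proof
      fix k assume "k \<in> K n"
      then have "real k \<le> t / mesh n" using mesh_pos[of n] by (simp add: K_def field_simps)
      then have "real k \<le> of_int \<lceil>t / mesh n\<rceil>" by linarith
      then show "k \<in> {..nat \<lceil>t / mesh n\<rceil>}" by simp
    qed
  qed simp
  have before: "{\<omega> \<in> space (P (Suc x)). \<forall>i<k. X (real i * mesh n) \<omega> \<in> - {enat x}} \<in> past (P (Suc x)) X (real k * mesh n)" for n k
  proof -
    interpret past: sigma_algebra "space (P (Suc x))" "past (P (Suc x)) X (real k * mesh n)" by (rule sigma_algebra_past)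
    have "{\<omega> \<in> space (P (Suc x)). \<forall>i<k. X (real i * mesh n) \<omega> \<in> - {enat x}} =
        space (P (Suc x)) \<inter> (\<Inter>i\<in>{..<k}. {\<omega> \<in> space (P (Suc x)). X (real i * mesh n) \<omega> \<in> - {enat x}})" by auto
    also have "\<dots> \<in> past (P (Suc x)) X (real k * mesh n)"
    proof (cases "k = 0")
      case False
      have "(\<Inter>i\<in>{..<k}. {\<omega> \<in> space (P (Suc x)). X (real i * mesh n) \<omega> \<in> - {enat x}}) \<in> past (P (Suc x)) X (real k * mesh n)"
      proof (rule past.finite_INT)
        fix i assume "i \<in> {..<k}"
        then have "real i * mesh n \<le> real k * mesh n" by (intro mult_right_mono) (auto simp: less_imp_le)
        then show "{\<omega> \<in> space (P (Suc x)). X (real i * mesh n) \<omega> \<in> - {enat x}} \<in> past (P (Suc x)) X (real k * mesh n)"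
          by (intro past_X) (simp_all add: less_imp_le)
      qed (use False in auto)
      then show ?thesis by (intro past.Int past.top)
    qed (use past.top in simp)
    finally show ?thesis .
  qed
  have V_sets: "V n k \<in> sets (P (Suc x))" for n k
    unfolding V_def by (intro sets.Int sets_X_eq subsetD[OF past_sets before]) (simp add: less_imp_le)
  have Z_sets: "Z \<in> sets (P (Suc x))" unfolding Z_def using t by simp
  have V_disj: "disjoint_family (V n)" for n
    by (rule disjoint_family_natI) (unfold V_def, blast)
  have VZ: "measure (P (Suc x)) (V n k \<inter> Z) = measure (P (Suc x)) (V n k) * p (t - real k * mesh n) x 0" if "k \<in> K n" for n k
    unfolding V_def Z_def
    using markov_p[where s = "real k * mesh n" and t = "t - real k * mesh n" and y = x and z = 0, OF _ _ before[of k n]] that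
    by (simp add: K_def less_imp_le)
  define F where "F n = (\<Union>k\<in>K n. V n k \<inter> Z)" for n
  have F_sets: "F n \<in> sets (P (Suc x))" for n
    unfolding F_def using K_fin V_sets Z_sets by (intro sets.finite_UN) auto
  have F_le: "measure (P (Suc x)) (F n) \<le> p t x 0" for n
  proof -
    have "measure (P (Suc x)) (F n) = (\<Sum>k\<in>K n. measure (P (Suc x)) (V n k \<inter> Z))"
      unfolding F_def
    proof (rule P.finite_measure_finite_Union[OF K_fin])
      show "disjoint_family_on (\<lambda>k. V n k \<inter> Z) (K n)"
        using V_disj[of n] unfolding disjoint_family_on_def by blast
    qed (use V_sets Z_sets in auto)
    also have "\<dots> \<le> (\<Sum>k\<in>K n. measure (P (Suc x)) (V n k) * p t x 0)"
    proof (rule sum_mono)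
      fix k assume k: "k \<in> K n"
      show "measure (P (Suc x)) (V n k \<inter> Z) \<le> measure (P (Suc x)) (V n k) * p t x 0"
        unfolding VZ[OF k] by (intro mult_left_mono p_absorbed_mono) (use k in \<open>auto simp: K_def less_imp_le\<close>)
    qed
    also have "\<dots> = measure (P (Suc x)) (\<Union>k\<in>K n. V n k) * p t x 0"
      unfolding sum_distrib_right[symmetric]
      by (subst P.finite_measure_finite_Union[OF K_fin])
        (use V_sets V_disj[of n] in \<open>auto intro: disjoint_family_on_mono\<close>)
    also have "\<dots> \<le> 1 * p t x 0" by (intro mult_right_mono) auto
    finally show ?thesis by simp
  qed
  have "(\<lambda>n. measure (P (Suc x)) (F n)) \<longlonglongrightarrow> measure (P (Suc x)) Z"
  proof (rule measure_tendsto_AE[OF prob_space_P F_sets Z_sets])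
    have "x < Suc x" by simp
    from AE_passes[OF this] show "AE \<omega> in P (Suc x). \<forall>\<^sub>F n in sequentially. \<omega> \<in> F n \<longleftrightarrow> \<omega> \<in> Z"
    proof (elim AE_mp, intro AE_I2 impI)
      fix \<omega> assume \<omega>: "\<omega> \<in> space (P (Suc x))"
        and passes: "\<forall>s\<ge>0. \<forall>v<x. X s \<omega> = enat v \<longrightarrow> (\<exists>r>0. r < s \<and> X r \<omega> = enat x)"
      show "\<forall>\<^sub>F n in sequentially. \<omega> \<in> F n \<longleftrightarrow> \<omega> \<in> Z"
      proof (cases "\<omega> \<in> Z")
        case True
        then have "X t \<omega> = enat 0" by (simp add: Z_def)
        then obtain r where r: "0 < r" "r < t" "X r \<omega> = enat x" using passes t False by blast
        obtain e where e: "0 < e" "\<And>s. r \<le> s \<Longrightarrow> s < r + e \<Longrightarrow> X s \<omega> = X r \<omega>"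
          by (rule right_constant[OF \<omega> less_imp_le[OF r(1)]]) blast
        have "\<forall>\<^sub>F n in sequentially. mesh n < min e (t - r)"
          by (rule eventually_mesh_less) (use e r in auto)
        then show ?thesis
        proof (rule eventually_mono)
          fix n assume n: "mesh n < min e (t - r)"
          obtain j where j: "r \<le> real j * mesh n" "real j * mesh n < r + mesh n"
            by (rule grid_point[OF less_imp_le[OF r(1)]]) blast
          have Xj: "X (real j * mesh n) \<omega> = enat x" using e(2)[OF j(1)] j(2) n r(3) by simp
          define k where "k = (LEAST k. X (real k * mesh n) \<omega> = enat x)"
          have Xk: "X (real k * mesh n) \<omega> = enat x" unfolding k_def by (rule LeastI[of "\<lambda>k. X (real k * mesh n) \<omega> = enat x", OF Xj])
          have "k \<le> j" unfolding k_def by (rule Least_le[of "\<lambda>k. X (real k * mesh n) \<omega> = enat x", OF Xj])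
          then have "real k * mesh n \<le> real j * mesh n" by (intro mult_right_mono) (auto simp: less_imp_le)
          then have "real k * mesh n \<le> t" using j(2) n by linarith
          then have "k \<in> K n" by (simp add: K_def)
          moreover have "\<omega> \<in> V n k"
            unfolding V_def using \<omega> Xk not_less_Least[of _ "\<lambda>k. X (real k * mesh n) \<omega> = enat x"] by (simp add: k_def)
          ultimately show "\<omega> \<in> F n \<longleftrightarrow> \<omega> \<in> Z" using True by (auto simp: F_def)
        qed
      qed (simp add: F_def)
    qed
  qed
  then show ?thesis
    using LIMSEQ_le_const2[of _ "measure (P (Suc x)) Z" "p t x 0"] F_le by (auto simp: Z_def p_def)
qed

text \<open>With \<open>max 0 t\<close> the function is antitone on the whole real line, which makes
  it Borel measurable for the later integrals.\<close>

definition survival :: "real \<Rightarrow> nat \<Rightarrow> real" where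
  "survival t x = 1 - p (max 0 t) x 0"

lemma survival_nonneg [simp]: "0 \<le> survival t x" by (simp add: survival_def)

lemma survival_le_1: "survival t x \<le> 1" by (simp add: survival_def)

lemma survival_antimono: "s \<le> t \<Longrightarrow> survival t x \<le> survival s x"
  unfolding survival_def using p_absorbed_mono[of "max 0 s" "max 0 t" x] by auto

lemma survival_mono: "mono (survival t)"
  unfolding mono_iff_le_Suc survival_def using p_absorbed_antimono[of "max 0 t"] by auto

lemma survival_measurable [measurable]: "(\<lambda>t. survival t x) \<in> borel_measurable borel"
proof -
  have "mono (\<lambda>t. - survival t x)" by (intro monoI) (simp add: survival_antimono)
  then have "(\<lambda>t. - survival t x) \<in> borel_measurable borel" by (rule borel_measurable_mono)
  then have "(\<lambda>t. - (- survival t x)) \<in> borel_measurable borel" by measurable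
  then show ?thesis by simp
qed

lemma survival_eq: "0 \<le> t \<Longrightarrow> survival t x = \<P>(\<omega> in P x. ereal t < hit X {0} \<omega>)"
proof -
  assume t: "0 \<le> t"
  have [measurable]: "hit X {0} \<in> borel_measurable (P x)" by (rule measurable_hit)
  have "\<P>(\<omega> in P x. ereal t < hit X {0} \<omega>) = \<P>(\<omega> in P x. \<not> (X t \<omega> = enat 0))"
  proof (rule P.prob_eq_AE)
    show "AE \<omega> in P x. ereal t < hit X {0} \<omega> \<longleftrightarrow> \<not> (X t \<omega> = enat 0)"
      using AE_hit_0[of x]
    proof (elim AE_mp, intro AE_I2 impI)
      fix \<omega> assume "\<forall>t\<ge>0. (hit X {0} \<omega> \<le> ereal t) = (X t \<omega> = enat 0)"
      then have "(hit X {0} \<omega> \<le> ereal t) = (X t \<omega> = enat 0)" using t by blast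
      then show "ereal t < hit X {0} \<omega> \<longleftrightarrow> \<not> (X t \<omega> = enat 0)" by (simp only: not_le[symmetric])
    qed
  qed (use t in auto)
  also have "\<dots> = 1 - p t x 0"
    unfolding p_def by (rule P.prob_neg) (use t in auto)
  finally show ?thesis using t by (simp add: survival_def)
qed

lemma survival_chapman_kolmogorov:
  assumes "0 \<le> s" "0 \<le> t"
  shows "(\<lambda>y. p s x y * survival t y) sums survival (s + t) x"
proof -
  have "(\<lambda>y. p s x y - p s x y * p t y 0) sums (1 - p (s + t) x 0)"
    by (intro sums_diff p_sums_1 chapman_kolmogorov assms)
  then show ?thesis using assms by (simp add: survival_def right_diff_distrib)
qed

text \<open>In the state \<open>x\<close> this is Markov's inequality. Irreducibility gives
  \<open>p s x y > 0\<close> for some \<open>s\<close>, and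
  \<open>p s x y * survival t y \<le> survival (s + t) x\<close> transfers the bound to an arbitrary
  state \<open>y\<close>.\<close>

lemma survival_exp_bound:
  assumes l: "0 < l" and x: "1 \<le> x" and fin: "(\<integral>\<^sup>+\<omega>. exp_ereal (ereal l * hit X {0} \<omega>) \<partial>P x) < \<infinity>"
  shows "\<exists>C. \<forall>t\<ge>0. survival t y \<le> C * exp (- l * t)"
proof -
  define I where "I = (\<integral>\<^sup>+\<omega>. exp_ereal (ereal l * hit X {0} \<omega>) \<partial>P x)"
  have I: "ennreal (enn2real I) = I" using fin by (simp add: I_def)
  have bx: "survival t x \<le> enn2real I * exp (- l * t)" if t: "0 \<le> t" for t
  proof -
    have [measurable]: "hit X {0} \<in> borel_measurable (P x)" by (rule measurable_hit)
    let ?A = "{\<omega> \<in> space (P x). ereal t < hit X {0} \<omega>}"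
    have "ennreal (exp (l * t) * survival t x) = ennreal (exp (l * t)) * emeasure (P x) ?A"
      by (simp add: survival_eq[OF t] P.emeasure_eq_measure ennreal_mult)
    also have "\<dots> = (\<integral>\<^sup>+\<omega>. ennreal (exp (l * t)) * indicator ?A \<omega> \<partial>P x)"
      by (rule nn_integral_cmult_indicator[symmetric]) measurable
    also have "\<dots> \<le> I" unfolding I_def
    proof (rule nn_integral_mono)
      fix \<omega>
      show "ennreal (exp (l * t)) * indicator ?A \<omega> \<le> exp_ereal (ereal l * hit X {0} \<omega>)"
      proof (cases "\<omega> \<in> ?A")
        case True
        then show ?thesis using l by (cases "hit X {0} \<omega>") (auto simp: exp_ereal_def intro!: ennreal_leI)
      qed simp
    qed
    finally have "ennreal (exp (l * t) * survival t x) \<le> ennreal (enn2real I)" by (simp only: I)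
    then have "exp (l * t) * survival t x \<le> enn2real I" by (subst (asm) ennreal_le_iff) auto
    then show ?thesis by (simp add: exp_minus field_simps)
  qed
  have "\<exists>s\<ge>0. 0 < p s x y"
  proof (rule ccontr)
    assume "\<not> ?thesis"
    then have p0: "p s x y = 0" if "0 \<le> s" for s using that p_nonneg[of s x y] by (metis less_eq_real_def)
    have "AE \<omega> in P x. \<not> X q \<omega> = enat y" if "0 \<le> q" for q
      using p0[OF that] sets_X_eq[OF that, of x "enat y"] unfolding p_def by (subst (asm) P.prob_eq_0) auto
    then have "AE \<omega> in P x. 0 \<le> q \<longrightarrow> \<not> X q \<omega> = enat y" for q by (cases "0 \<le> q") auto
    then have "AE \<omega> in P x. \<forall>q\<in>\<rat>. 0 \<le> q \<longrightarrow> \<not> X q \<omega> = enat y" by (simp add: AE_ball_countable countable_rat)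
    then have "AE \<omega> in P x. \<not> hit X {y} \<omega> < \<infinity>"
    proof (elim AE_mp, intro AE_I2 impI notI)
      fix \<omega> assume \<omega>: "\<omega> \<in> space (P x)" "hit X {y} \<omega> < \<infinity>" and no: "\<forall>q\<in>\<rat>. 0 \<le> q \<longrightarrow> \<not> X q \<omega> = enat y"
      obtain h where h: "0 \<le> h" "X h \<omega> \<in> enat ` {y}" by (rule hit_attained[OF \<omega>]) blast
      have h1: "h < h + 1" by simp
      obtain q where "q \<in> \<rat>" "h < q" "X q \<omega> = X h \<omega>" by (rule rational_in_right[OF \<omega>(1) h(1) h1]) blast
      then show False using no h by auto
    qed
    moreover have [measurable]: "hit X {y} \<in> borel_measurable (P x)" by (rule measurable_hit)
    ultimately have "\<P>(\<omega> in P x. hit X {y} \<omega> < \<infinity>) = 0"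
      by (subst P.prob_eq_0) (auto elim: eventually_mono)
    then show False using irreducible[OF x, of y] by simp
  qed
  then obtain s where s: "0 \<le> s" "0 < p s x y" by auto
  have "survival t y \<le> (enn2real I * exp (- l * s) / p s x y) * exp (- l * t)" if t: "0 \<le> t" for t
  proof -
    note ck = survival_chapman_kolmogorov[OF s(1) t, of x]
    have "(\<Sum>y\<in>{y}. p s x y * survival t y) \<le> survival (s + t) x"
      unfolding sums_unique[OF ck] by (rule sum_le_suminf[OF sums_summable[OF ck]]) auto
    also have "\<dots> \<le> enn2real I * exp (- l * (s + t))" using s t by (intro bx) auto
    also have "exp (- l * (s + t)) = exp (- l * s) * exp (- l * t)" by (simp add: algebra_simps flip: exp_add)
    finally show ?thesis using s(2) by (simp add: field_simps)
  qed
  then show ?thesis by blast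
qed

text \<open>For \<open>l > 0\<close>, \<open>1 + l * survival_laplace l x\<close> is the exponential
  moment \<open>E\<^sub>x[exp (l \<tau>\<^sub>0)]\<close>. The integral form gives access to the
  Chapman-Kolmogorov equation; finiteness is a separate matter.\<close>

definition survival_laplace :: "real \<Rightarrow> nat \<Rightarrow> ennreal" where
  "survival_laplace l x = (\<integral>\<^sup>+t. ennreal (exp (l * t) * survival t x) * indicator {0..} t \<partial>lborel)"

lemma survival_laplace_finite:
  assumes C: "\<And>t. 0 \<le> t \<Longrightarrow> survival t x \<le> C * exp (- k * t)" and l: "l < k"
  shows "survival_laplace l x < \<infinity>"
proof -
  have C0: "0 \<le> C" using order_trans[OF survival_nonneg C[of 0]] by simp
  have "survival_laplace l x \<le> (\<integral>\<^sup>+t. ennreal (C * exp (- (k - l) * t)) * indicator {0..} t \<partial>lborel)"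
    unfolding survival_laplace_def
  proof (rule nn_integral_mono)
    fix t :: real
    show "ennreal (exp (l * t) * survival t x) * indicator {0..} t \<le> ennreal (C * exp (- (k - l) * t)) * indicator {0..} t"
    proof (cases "0 \<le> t")
      case True
      have "exp (l * t) * survival t x \<le> exp (l * t) * (C * exp (- k * t))" using C[OF True] by (intro mult_left_mono) auto
      also have "\<dots> = C * exp (- (k - l) * t)" by (simp add: algebra_simps flip: exp_add)
      finally show ?thesis by (intro mult_right_mono ennreal_leI) auto
    qed simp
  qed
  also have "\<dots> = ennreal (0 - (- C / (k - l) * exp (- (k - l) * 0)))"
  proof (rule nn_integral_FTC_atLeast)
    fix t :: real
    show "DERIV (\<lambda>t. - C / (k - l) * exp (- (k - l) * t)) t :> C * exp (- (k - l) * t)"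
    proof (rule DERIV_cong)
      show "DERIV (\<lambda>t. - C / (k - l) * exp (- (k - l) * t)) t :> - C / (k - l) * (exp (- (k - l) * t) * (- (k - l)))"
        by (rule DERIV_cmult) (auto intro!: derivative_eq_intros)
      show "- C / (k - l) * (exp (- (k - l) * t) * (- (k - l))) = C * exp (- (k - l) * t)"
      proof -
        have "- C / m * (E * (- m)) = C * E" if "m \<noteq> 0" for m E :: real using that by simp
        moreover have "k - l \<noteq> 0" using l by simp
        ultimately show ?thesis by blast
      qed
    qed
    show "0 \<le> C * exp (- (k - l) * t)" using C0 by simp
  next
    have "filterlim (\<lambda>t. - (k - l) * t) at_bot at_top"
      using l by (intro filterlim_tendsto_neg_mult_at_bot[OF tendsto_const]) (auto intro: filterlim_ident)
    then have "((\<lambda>t. - C / (k - l) * exp (- (k - l) * t)) \<longlongrightarrow> - C / (k - l) * 0) at_top"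
      by (intro tendsto_mult tendsto_const filterlim_compose[OF exp_at_bot])
    then show "((\<lambda>t. - C / (k - l) * exp (- (k - l) * t)) \<longlongrightarrow> 0) at_top" by simp
  qed simp
  finally show ?thesis by (simp add: le_less_trans)
qed

lemma survival_laplace_mono: "mono (survival_laplace l)"
proof (rule monoI)
  fix x y :: nat assume "x \<le> y"
  then have "survival t x \<le> survival t y" for t using survival_mono by (simp add: mono_def)
  then show "survival_laplace l x \<le> survival_laplace l y"
    unfolding survival_laplace_def by (intro nn_integral_mono mult_right_mono ennreal_leI mult_left_mono) auto
qed

text \<open>By Chapman-Kolmogorov the sum is at most the integral with survival shifted by
  \<open>d\<close>; after substitution the factor \<open>exp (l * d)\<close> makes it the part of
  the integral over \<open>{d..}\<close>. The part over \<open>{0..<d}\<close> is at least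
  \<open>d * survival d x\<close>.\<close>

lemma survival_laplace_step:
  assumes d: "0 < d" and l: "0 < l" and S: "finite S"
  shows "ennreal (exp (l * d)) * (\<Sum>w\<in>S. ennreal (p d x w) * survival_laplace l w) + ennreal (d * survival d x) \<le> survival_laplace l x"
proof -
  have "(\<Sum>w\<in>S. ennreal (p d x w) * survival_laplace l w) =
      (\<integral>\<^sup>+t. (\<Sum>w\<in>S. ennreal (p d x w) * (ennreal (exp (l * t) * survival t w) * indicator {0..} t)) \<partial>lborel)"
    unfolding survival_laplace_def by (simp add: nn_integral_sum nn_integral_cmult)
  also have "\<dots> \<le> (\<integral>\<^sup>+t. ennreal (exp (l * t) * survival (d + t) x) * indicator {0..} t \<partial>lborel)"
  proof (rule nn_integral_mono)
    fix t :: real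
    show "(\<Sum>w\<in>S. ennreal (p d x w) * (ennreal (exp (l * t) * survival t w) * indicator {0..} t)) \<le>
        ennreal (exp (l * t) * survival (d + t) x) * indicator {0..} t"
    proof (cases "0 \<le> t")
      case True
      note ck = survival_chapman_kolmogorov[OF less_imp_le[OF d] True, of x]
      have "(\<Sum>w\<in>S. p d x w * survival t w) \<le> survival (d + t) x"
        unfolding sums_unique[OF ck] by (rule sum_le_suminf[OF sums_summable[OF ck] S]) auto
      then have "exp (l * t) * (\<Sum>w\<in>S. p d x w * survival t w) \<le> exp (l * t) * survival (d + t) x" by simp
      then have "ennreal (\<Sum>w\<in>S. p d x w * (exp (l * t) * survival t w)) \<le> ennreal (exp (l * t) * survival (d + t) x)"
        by (intro ennreal_leI) (simp add: sum_distrib_left mult_ac)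
      also have "ennreal (\<Sum>w\<in>S. p d x w * (exp (l * t) * survival t w)) = (\<Sum>w\<in>S. ennreal (p d x w) * ennreal (exp (l * t) * survival t w))"
        by (subst sum_ennreal[symmetric]) (auto simp: ennreal_mult)
      finally show ?thesis using True by simp
    qed simp
  qed
  also have "\<dots> = (\<integral>\<^sup>+t. ennreal (exp (l * (t - d)) * survival t x) * indicator {d..} t \<partial>lborel)"
    by (subst (2) nn_integral_real_affine[where c = 1 and t = d])
      (auto simp: indicator_def intro!: nn_integral_cong)
  finally have "ennreal (exp (l * d)) * (\<Sum>w\<in>S. ennreal (p d x w) * survival_laplace l w) \<le>
      ennreal (exp (l * d)) * (\<integral>\<^sup>+t. ennreal (exp (l * (t - d)) * survival t x) * indicator {d..} t \<partial>lborel)"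
    by (rule mult_left_mono) simp
  also have "\<dots> = (\<integral>\<^sup>+t. ennreal (exp (l * d)) * (ennreal (exp (l * (t - d)) * survival t x) * indicator {d..} t) \<partial>lborel)"
    by (rule nn_integral_cmult[symmetric]) simp
  also have "\<dots> = (\<integral>\<^sup>+t. ennreal (exp (l * t) * survival t x) * indicator {d..} t \<partial>lborel)"
    by (intro nn_integral_cong)
      (simp add: ennreal_mult[symmetric] mult.assoc[symmetric] exp_add[symmetric] algebra_simps)
  finally have 1: "ennreal (exp (l * d)) * (\<Sum>w\<in>S. ennreal (p d x w) * survival_laplace l w) \<le>
      (\<integral>\<^sup>+t. ennreal (exp (l * t) * survival t x) * indicator {d..} t \<partial>lborel)" .
  have 2: "ennreal (d * survival d x) = (\<integral>\<^sup>+t. ennreal (survival d x) * indicator {0..<d} t \<partial>lborel)"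
    by (subst nn_integral_cmult_indicator) (use d in \<open>simp_all add: ennreal_mult mult.commute\<close>)
  have "ennreal (exp (l * d)) * (\<Sum>w\<in>S. ennreal (p d x w) * survival_laplace l w) + ennreal (d * survival d x) \<le>
      (\<integral>\<^sup>+t. ennreal (exp (l * t) * survival t x) * indicator {d..} t \<partial>lborel) +
      (\<integral>\<^sup>+t. ennreal (survival d x) * indicator {0..<d} t \<partial>lborel)"
    unfolding 2 by (rule add_right_mono[OF 1])
  also have "\<dots> = (\<integral>\<^sup>+t. ennreal (exp (l * t) * survival t x) * indicator {d..} t + ennreal (survival d x) * indicator {0..<d} t \<partial>lborel)"
    by (rule nn_integral_add[symmetric]) simp_all
  also have "\<dots> \<le> survival_laplace l x"
    unfolding survival_laplace_def
  proof (rule nn_integral_mono)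
    fix t :: real
    have "survival d x \<le> exp (l * t) * survival t x" if "0 \<le> t" "t < d"
    proof -
      have "1 * survival d x \<le> exp (l * t) * survival t x"
        using that l by (intro mult_mono survival_antimono) auto
      then show ?thesis by simp
    qed
    then show "ennreal (exp (l * t) * survival t x) * indicator {d..} t + ennreal (survival d x) * indicator {0..<d} t \<le>
        ennreal (exp (l * t) * survival t x) * indicator {0..} t"
      using d by (auto simp: indicator_def intro!: ennreal_leI)
  qed
  finally show ?thesis .
qed

text \<open>The witness is the exponential moment of the absorption time, written as
  \<open>1 + l * F x\<close>; the gap between \<open>l\<close> and \<open>k\<close> makes
  \<open>F\<close> finite. The inequalities are proved for partial sums, from which summability is
  deduced.\<close>

lemma ex_monotone_supersolution:
  assumes l: "0 < l" "l < k" and x: "1 \<le> x0" and fin: "(\<integral>\<^sup>+\<omega>. exp_ereal (ereal k * hit X {0} \<omega>) \<partial>P x0) < \<infinity>"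
  shows "\<exists>f. supersolution l f \<and> mono f"
proof -
  define F where "F x = enn2real (survival_laplace l x)" for x
  have fin: "survival_laplace l x < \<infinity>" for x
  proof -
    obtain C where "\<And>t. 0 \<le> t \<Longrightarrow> survival t x \<le> C * exp (- k * t)"
      using survival_exp_bound[OF _ x fin, of x] l by auto
    then show ?thesis using l(2) by (rule survival_laplace_finite)
  qed
  have F: "ennreal (F x) = survival_laplace l x" for x using fin[of x] by (simp add: F_def)
  have F_nonneg: "0 \<le> F x" for x by (simp add: F_def)
  have F_mono: "mono F"
    using survival_laplace_mono fin unfolding mono_def F_def by (auto intro!: enn2real_mono)
  have step: "exp (l * d) * (\<Sum>w\<in>S. p d x w * F w) + d * survival d x \<le> F x" if d: "0 < d" and S: "finite S" for d S x
  proof -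
    have "ennreal (exp (l * d) * (\<Sum>w\<in>S. p d x w * F w) + d * survival d x) =
        ennreal (exp (l * d)) * (\<Sum>w\<in>S. ennreal (p d x w) * survival_laplace l w) + ennreal (d * survival d x)"
      using d F_nonneg by (simp add: ennreal_mult sum_nonneg F[symmetric] flip: sum_ennreal)
    also have "\<dots> \<le> ennreal (F x)" unfolding F by (rule survival_laplace_step[OF d l(1) S])
    finally show ?thesis by (subst (asm) ennreal_le_iff) (auto simp: F_nonneg)
  qed
  \<comment> \<open>\<open>survival_laplace_step\<close> is divided by the mesh. The
    \<open>- 1\<close> is the limit of the extra term \<open>d * survival d x\<close> divided by
    \<open>d\<close>, as a start off the trap survives short times with probability close to
    \<open>1\<close>.\<close>
  have Q_F: "(\<Sum>w<M. Q x w * F w) \<le> - l * F x - 1" if x: "0 < x" "x < M" for x M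
  proof (rule LIMSEQ_le)
    show "(\<lambda>n. \<Sum>w<M. (p (mesh n) x w - (if x = w then 1 else 0)) / mesh n * F w) \<longlonglongrightarrow> (\<Sum>w<M. Q x w * F w)"
      by (intro tendsto_intros Q_mesh)
    have s: "(\<lambda>n. survival (mesh n) x) \<longlonglongrightarrow> 1"
    proof -
      have "(\<lambda>n. (p (mesh n) x 0 - (if x = 0 then 1 else 0)) / mesh n * mesh n) \<longlonglongrightarrow> Q x 0 * 0"
        by (intro tendsto_mult Q_mesh mesh_tendsto)
      moreover have "(p (mesh n) x 0 - (if x = 0 then 1 else 0)) / mesh n * mesh n = p (mesh n) x 0" for n
        using x less_imp_neq[OF mesh_pos[of n]] by simp
      ultimately have "(\<lambda>n. 1 - p (mesh n) x 0) \<longlonglongrightarrow> 1 - 0" by (intro tendsto_diff tendsto_const) simp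
      then show ?thesis by (simp add: survival_def max_absorb2 less_imp_le)
    qed
    have "(\<lambda>n. exp (- l * mesh n)) \<longlonglongrightarrow> exp (- l * 0)" by (intro tendsto_intros mesh_tendsto)
    then have "(\<lambda>n. (exp (- l * mesh n) - 1) / mesh n * F x - exp (- l * mesh n) * survival (mesh n) x) \<longlonglongrightarrow> - l * F x - exp (- l * 0) * 1"
      by (intro tendsto_diff tendsto_mult exp_mesh_tendsto s tendsto_const)
    then show "(\<lambda>n. (exp (- l * mesh n) - 1) / mesh n * F x - exp (- l * mesh n) * survival (mesh n) x) \<longlonglongrightarrow> - l * F x - 1" by simp
    have "(\<Sum>w<M. (p (mesh n) x w - (if x = w then 1 else 0)) / mesh n * F w) \<le>
        (exp (- l * mesh n) - 1) / mesh n * F x - exp (- l * mesh n) * survival (mesh n) x" for n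
    proof -
      define d where "d = mesh n"
      define E where "E = exp (- l * d)"
      have d: "0 < d" by (simp add: d_def)
      have E: "0 < E" "E * exp (l * d) = 1" by (simp_all add: E_def flip: exp_add)
      have "E * (exp (l * d) * (\<Sum>w<M. p d x w * F w) + d * survival d x) \<le> E * F x"
        using step[OF d, of "{..<M}" x] E by (intro mult_left_mono) auto
      moreover have "E * (exp (l * d) * (\<Sum>w<M. p d x w * F w) + d * survival d x) =
          (E * exp (l * d)) * (\<Sum>w<M. p d x w * F w) + d * (E * survival d x)"
        by (simp only: distrib_left mult.assoc mult.left_commute)
      ultimately have *: "(\<Sum>w<M. p d x w * F w) \<le> E * F x - d * (E * survival d x)"
        unfolding E(2) by simp
      have "(\<Sum>w<M. (p d x w - (if x = w then 1 else 0)) / d * F w) = (\<Sum>w<M. (p d x w * F w - (if x = w then F x else 0)) / d)"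
        by (intro sum.cong) (auto simp: algebra_simps)
      also have "\<dots> = ((\<Sum>w<M. p d x w * F w) - (\<Sum>w<M. if x = w then F x else 0)) / d"
        by (simp only: sum_divide_distrib[symmetric] sum_subtractf)
      also have "(\<Sum>w<M. if x = w then F x else 0) = F x" using x by simp
      also have "((\<Sum>w<M. p d x w * F w) - F x) / d \<le> (E * F x - d * (E * survival d x) - F x) / d"
        using * d by (intro divide_right_mono) auto
      also have "\<dots> = (E - 1) / d * F x - E * survival d x" using d by (simp add: field_simps)
      finally show ?thesis by (simp add: d_def E_def)
    qed
    then show "\<exists>N. \<forall>n\<ge>N. (\<Sum>w<M. (p (mesh n) x w - (if x = w then 1 else 0)) / mesh n * F w) \<le>
        (exp (- l * mesh n) - 1) / mesh n * F x - exp (- l * mesh n) * survival (mesh n) x" by blast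
  qed
  define f where "f x = 1 + l * F x" for x
  have f_pos: "0 < f x" for x using l F_nonneg[of x] by (simp add: f_def add_pos_nonneg)
  have f_mono: "mono f" using F_mono l by (auto simp: mono_def f_def)
  have bound: "(\<Sum>w<M. Q (Suc x) w * f w) \<le> - l * f (Suc x)" if M: "Suc x < M" for x M
  proof -
    have "(\<Sum>w<M. Q (Suc x) w) \<le> 0"
    proof (rule LIMSEQ_le_const)
      show "(\<lambda>N. \<Sum>w<N. Q (Suc x) w) \<longlonglongrightarrow> 0" using conservative[of "Suc x"] by (simp add: sums_def)
      show "\<exists>N. \<forall>n\<ge>N. (\<Sum>w<M. Q (Suc x) w) \<le> (\<Sum>w<n. Q (Suc x) w)"
        using M by (intro exI[of _ M] allI impI sum_mono2) (auto intro!: Q_offdiag_nonneg)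
    qed
    moreover have "l * (\<Sum>w<M. Q (Suc x) w * F w) \<le> l * (- l * F (Suc x) - 1)"
      using Q_F[OF _ M] l by (intro mult_left_mono) auto
    moreover have "(\<Sum>w<M. Q (Suc x) w * f w) = (\<Sum>w<M. Q (Suc x) w) + l * (\<Sum>w<M. Q (Suc x) w * F w)"
      by (simp add: f_def algebra_simps sum.distrib sum_distrib_left)
    ultimately show ?thesis by (simp add: f_def algebra_simps)
  qed
  have "summable (\<lambda>w. Q (Suc x) w * f w)" for x
  proof -
    \<comment> \<open>Beyond the diagonal all terms are nonnegative, so the upper bound for the
      partial sums yields summability.\<close>
    define h where "h w = Q (Suc x) (w + Suc (Suc x)) * f (w + Suc (Suc x))" for w
    have "summable h"
    proof (rule summableI_nonneg_bounded)
      show "0 \<le> h w" for w unfolding h_def using f_pos less_imp_le by (intro mult_nonneg_nonneg Q_offdiag_nonneg) auto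
      show "(\<Sum>w<n. h w) \<le> - l * f (Suc x) - (\<Sum>w<Suc (Suc x). Q (Suc x) w * f w)" for n
      proof -
        have "(\<Sum>w<n + Suc (Suc x). Q (Suc x) w * f w) = (\<Sum>w<Suc (Suc x). Q (Suc x) w * f w) + (\<Sum>w<n. h w)"
          unfolding h_def by (induction n) (simp_all add: ac_simps)
        then show ?thesis using bound[of x "n + Suc (Suc x)"] by simp
      qed
    qed
    then show ?thesis unfolding h_def by (subst (asm) summable_iff_shift)
  qed
  note sm = this
  have "(\<Sum>w. Q (Suc x) w * f w) \<le> - l * f (Suc x)" for x
    by (rule LIMSEQ_le_const2[OF summable_LIMSEQ[OF sm]]) (use bound[of x] in \<open>auto intro!: exI[of _ "Suc (Suc x)"]\<close>)
  then have "supersolution l f"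
    unfolding supersolution_def using f_pos sm by blast
  then show ?thesis using f_mono by blast
qed

end

section \<open>Forward comparison\<close>

text \<open>From \<open>(1 - z + z^2) (1 + z) = 1 + z^3\<close> and
  \<open>1 + z \<le> exp z\<close>. It makes the one-step error of the forward comparison quadratic
  in the step.\<close>

lemma exp_minus_le: "exp (- z) \<le> 1 - z + z\<^sup>2" if "0 \<le> z" for z :: real
proof -
  have "1 \<le> 1 + z * z\<^sup>2" using that by simp
  also have "\<dots> = (1 - z + z\<^sup>2) * (1 + z)" by (simp add: algebra_simps power2_eq_square)
  also have "\<dots> \<le> (1 - z + z\<^sup>2) * exp z"
  proof (rule mult_left_mono)
    have "0 \<le> (1 - z)\<^sup>2 + z" using that by simp
    also have "\<dots> = 1 - z + z\<^sup>2" by (simp add: algebra_simps power2_eq_square)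
    finally show "0 \<le> 1 - z + z\<^sup>2" .
  qed (use exp_ge_add_one_self[of z] in simp)
  finally show ?thesis by (simp add: exp_minus field_simps)
qed

context killed_markov_chain
begin

text \<open>Grid version of the chain killed on leaving \<open>{..M}\<close>; with finitely many
  states the errors of the difference quotients are uniformly small.\<close>

definition bounded_grid :: "nat \<Rightarrow> real \<Rightarrow> nat \<Rightarrow> nat \<Rightarrow> nat \<Rightarrow> 'a set" where
  "bounded_grid M d k x y = {\<omega> \<in> space (P x). (\<forall>i\<le>k. X (real i * d) \<omega> \<in> enat ` {..M}) \<and> X (real k * d) \<omega> = enat y}"

lemma bounded_past: "0 \<le> d \<Longrightarrow> {\<omega> \<in> space (P x). \<forall>i\<le>k. X (real i * d) \<omega> \<in> enat ` {..M}} \<in> past (P x) X (real k * d)"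
proof -
  assume d: "0 \<le> d"
  interpret past: sigma_algebra "space (P x)" "past (P x) X (real k * d)" by (rule sigma_algebra_past)
  have "{\<omega> \<in> space (P x). \<forall>i\<le>k. X (real i * d) \<omega> \<in> enat ` {..M}} =
      (\<Inter>i\<in>{..k}. {\<omega> \<in> space (P x). X (real i * d) \<omega> \<in> enat ` {..M}})" by auto
  also have "\<dots> \<in> past (P x) X (real k * d)"
  proof (rule past.finite_INT)
    fix i assume "i \<in> {..k}"
    then have "real i * d \<le> real k * d" using d by (intro mult_right_mono) auto
    then show "{\<omega> \<in> space (P x). X (real i * d) \<omega> \<in> enat ` {..M}} \<in> past (P x) X (real k * d)"
      using d by (intro past_X) auto
  qed auto
  finally show ?thesis .
qed

lemma bounded_grid_eq: "bounded_grid M d k x y =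
    {\<omega> \<in> space (P x). \<forall>i\<le>k. X (real i * d) \<omega> \<in> enat ` {..M}} \<inter> {\<omega> \<in> space (P x). X (real k * d) \<omega> = enat y}"
  by (auto simp: bounded_grid_def)

lemma sets_bounded_grid: "0 \<le> d \<Longrightarrow> bounded_grid M d k x y \<in> sets (P x)"
  unfolding bounded_grid_eq by (intro sets.Int sets_X_eq subsetD[OF past_sets bounded_past]) simp_all

lemma bounded_grid_Suc:
  assumes d: "0 \<le> d" and y: "y \<le> M"
  shows "measure (P x) (bounded_grid M d (Suc k) x y) = (\<Sum>v\<le>M. measure (P x) (bounded_grid M d k x v) * p d v y)"
proof -
  let ?Y = "{\<omega> \<in> space (P x). X (real k * d + d) \<omega> = enat y}"
  have Suc: "real (Suc k) * d = real k * d + d" by (simp add: algebra_simps)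
  have Y: "?Y \<in> sets (P x)" using d by simp
  define A where "A v = bounded_grid M d k x v \<inter> ?Y" for v
  have "bounded_grid M d (Suc k) x y = (\<Union>v\<le>M. A v)"
  proof (intro equalityI subsetI)
    fix \<omega> assume "\<omega> \<in> bounded_grid M d (Suc k) x y"
    then have \<omega>: "\<omega> \<in> space (P x)" "\<And>i. i \<le> Suc k \<Longrightarrow> X (real i * d) \<omega> \<in> enat ` {..M}" "X (real k * d + d) \<omega> = enat y"
      unfolding bounded_grid_def Suc by auto
    have "X (real k * d) \<omega> \<in> enat ` {..M}" by (rule \<omega>(2)) simp
    then obtain v where "v \<le> M" "X (real k * d) \<omega> = enat v" by blast
    then have "\<omega> \<in> A v" using \<omega> by (simp add: A_def bounded_grid_def)
    then show "\<omega> \<in> (\<Union>v\<le>M. A v)" using \<open>v \<le> M\<close> by blast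
  next
    fix \<omega> assume "\<omega> \<in> (\<Union>v\<le>M. A v)"
    then have \<omega>: "\<omega> \<in> space (P x)" "\<And>i. i \<le> k \<Longrightarrow> X (real i * d) \<omega> \<in> enat ` {..M}" "X (real k * d + d) \<omega> = enat y"
      by (auto simp: A_def bounded_grid_def)
    have "X (real i * d) \<omega> \<in> enat ` {..M}" if "i \<le> Suc k" for i
    proof (cases "i = Suc k")
      case True
      show ?thesis unfolding True Suc \<omega>(3) using y by simp
    qed (use that \<omega>(2) in auto)
    then show "\<omega> \<in> bounded_grid M d (Suc k) x y" using \<omega> by (simp add: bounded_grid_def Suc del: of_nat_Suc)
  qed
  moreover have "measure (P x) (\<Union>v\<le>M. A v) = (\<Sum>v\<le>M. measure (P x) (A v))"
  proof (rule P.finite_measure_finite_Union)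
    show "disjoint_family_on A {..M}" by (auto simp: disjoint_family_on_def A_def bounded_grid_def)
  qed (use sets_bounded_grid[OF d] Y in \<open>auto simp: A_def\<close>)
  ultimately have "measure (P x) (bounded_grid M d (Suc k) x y) = (\<Sum>v\<le>M. measure (P x) (bounded_grid M d k x v \<inter> ?Y))"
    by (simp add: A_def)
  moreover have "measure (P x) (bounded_grid M d k x v \<inter> ?Y) = measure (P x) (bounded_grid M d k x v) * p d v y" for v
    unfolding bounded_grid_eq by (rule markov_p[OF _ d bounded_past[OF d]]) (use d in simp)
  ultimately show ?thesis by (simp only:)
qed

lemma bounded_grid_0: "measure (P x) (bounded_grid M d 0 x y) \<le> (if x = y then 1 else 0)"
proof -
  have "measure (P x) (bounded_grid M d 0 x y) \<le> p 0 x y"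
    unfolding p_def by (rule P.finite_measure_mono) (auto simp: bounded_grid_def)
  then show ?thesis by (simp add: p_0)
qed

text \<open>
  The right-hand side solves, up to an arbitrarily small error, the forward differential inequality
  of the chain truncated at a level \<open>M\<close>; the assertion is compared with it along grids and then \<open>M\<close>
  tends to infinity. The last term records the defect \<open>s\<close> of \<open>\<nu>\<close> from being invariant.
\<close>

lemma forward_comparison:
  assumes \<nu>: "\<And>y. 0 \<le> \<nu> y" "\<nu> 0 = 0" and l: "0 \<le> l"
    and Q: "\<And>y. Q 0 y = 0" "\<And>x y. y + 2 \<le> x \<Longrightarrow> Q x y = 0"
    and s: "\<And>y. s y = (if y = 0 then l else 0) - l * \<nu> y - (\<Sum>x\<le>Suc y. \<nu> x * Q x y)" "\<And>y. 0 \<le> s y"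
    and T: "0 < T"
  shows "(\<Sum>x<n. \<nu> x * p T x y) \<le>
    exp (- l * T) * \<nu> y + (if y = 0 then 1 - exp (- l * T) else 0) - T * (exp (- l * T) * s y / (1 + T * \<bar>Q y y\<bar>))"
proof -
  \<comment> \<open>The largest constant, of this form, that the defect can pay for: subtracting
    \<open>t * \<kappa> y\<close> from the candidate costs at most
    \<open>\<kappa> y * (1 + T * \<bar>Q y y\<bar>)\<close> in the differential inequality, and this
    equals \<open>exp (- l * T) * s y\<close>.\<close>
  define \<kappa> where "\<kappa> y = exp (- l * T) * s y / (1 + T * \<bar>Q y y\<bar>)" for y
  define \<mu> where "\<mu> t y = exp (- l * t) * \<nu> y + (if y = 0 then 1 - exp (- l * t) else 0) - t * \<kappa> y" for t y
  have \<kappa>_nonneg: "0 \<le> \<kappa> y" for y using s(2)[of y] T by (auto simp: \<kappa>_def intro!: divide_nonneg_nonneg)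
  have pos1: "0 < 1 + T * \<bar>Q y y\<bar>" for y using T by (simp add: add_pos_nonneg)
  have drift: "(\<Sum>v\<le>M. \<mu> t v * Q v y) \<le> exp (- l * t) * (l * ((if y = 0 then 1 else 0) - \<nu> y)) - \<kappa> y"
    if t: "0 \<le> t" "t \<le> T" and y: "y \<le> M" for t y M
  proof -
    \<comment> \<open>For \<open>y = M\<close> the row \<open>Suc y\<close> lies outside the
      truncation; its contribution is nonnegative, so dropping it preserves the inequality.\<close>
    have "(\<Sum>v\<le>M. \<nu> v * Q v y) \<le> (\<Sum>v\<le>Suc y. \<nu> v * Q v y)"
    proof -
      have "(\<Sum>v\<le>M. \<nu> v * Q v y) \<le> (\<Sum>v\<le>Suc M. \<nu> v * Q v y)"
        using \<nu>(1)[of "Suc M"] Q_offdiag_nonneg[of "Suc M" y] y by simp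
      also have "\<dots> = (\<Sum>v\<le>Suc y. \<nu> v * Q v y)"
        by (rule sum.mono_neutral_right) (use y in \<open>auto simp: Q\<close>)
      finally show ?thesis .
    qed
    then have 1: "exp (- l * t) * (\<Sum>v\<le>M. \<nu> v * Q v y) \<le>
        exp (- l * t) * (l * ((if y = 0 then 1 else 0) - \<nu> y)) - exp (- l * t) * s y"
      unfolding right_diff_distrib[symmetric] by (intro mult_left_mono) (auto simp: s(1) algebra_simps)
    have 2: "(\<Sum>v\<le>M. (if v = 0 then 1 - exp (- l * t) else 0) * Q v y) = 0"
      by (rule sum.neutral) (auto simp: Q)
    have "- (\<kappa> y * \<bar>Q y y\<bar>) \<le> (\<Sum>v\<in>{y}. \<kappa> v * Q v y)"
      using mult_left_mono[OF abs_ge_minus_self[of "Q y y"] \<kappa>_nonneg[of y]] by simp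
    also have "\<dots> \<le> (\<Sum>v\<le>M. \<kappa> v * Q v y)"
      by (rule sum_mono2) (use y \<kappa>_nonneg Q_offdiag_nonneg in auto)
    finally have 3: "t * - (\<kappa> y * \<bar>Q y y\<bar>) \<le> t * (\<Sum>v\<le>M. \<kappa> v * Q v y)" using t by (intro mult_left_mono) auto
    have "\<kappa> y * (1 + t * \<bar>Q y y\<bar>) \<le> \<kappa> y * (1 + T * \<bar>Q y y\<bar>)"
      using t \<kappa>_nonneg by (intro mult_left_mono add_left_mono mult_right_mono) auto
    also have "\<dots> = exp (- l * T) * s y" using pos1[of y] by (simp add: \<kappa>_def)
    also have "\<dots> \<le> exp (- l * t) * s y"
      using t l s(2) by (intro mult_right_mono) (auto intro: mult_left_mono)
    finally have 4: "\<kappa> y + t * (\<kappa> y * \<bar>Q y y\<bar>) \<le> exp (- l * t) * s y" by (simp add: algebra_simps)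
    have "(\<Sum>v\<le>M. \<mu> t v * Q v y) = exp (- l * t) * (\<Sum>v\<le>M. \<nu> v * Q v y) +
        (\<Sum>v\<le>M. (if v = 0 then 1 - exp (- l * t) else 0) * Q v y) - t * (\<Sum>v\<le>M. \<kappa> v * Q v y)"
      unfolding \<mu>_def left_diff_distrib distrib_right sum.distrib sum_subtractf
      by (simp add: sum_distrib_left mult.assoc)
    then show ?thesis using 1 2 3 4 by linarith
  qed
  \<comment> \<open>For \<open>y \<noteq> 0\<close> convexity of the exponential suffices; at
    \<open>y = 0\<close> the exponential enters with the opposite sign, which costs the quadratic
    term.\<close>
  have incr: "d * (exp (- l * t) * (l * ((if y = 0 then 1 else 0) - \<nu> y)) - \<kappa> y) \<le> \<mu> (t + d) y - \<mu> t y + (l * d)\<^sup>2"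
    if "0 \<le> t" "0 \<le> d" for t d y
  proof -
    define a where "a = exp (- l * t)"
    define b where "b = exp (- l * d)"
    have ab: "exp (- l * (t + d)) = a * b" by (simp add: a_def b_def algebra_simps flip: exp_add)
    have ld: "0 \<le> l * d" using l that by simp
    have a: "0 \<le> a" "a \<le> 1" using l that by (auto simp: a_def)
    show ?thesis
    proof (cases "y = 0")
      case True
      have "l * d - (l * d)\<^sup>2 \<le> 1 - b" using exp_minus_le[OF ld] by (simp add: b_def)
      then have "a * (l * d - (l * d)\<^sup>2) \<le> a * (1 - b)" using a by (intro mult_left_mono) auto
      moreover have "a * (l * d)\<^sup>2 \<le> (l * d)\<^sup>2" using a by (intro mult_left_le_one_le) auto
      moreover have "\<mu> (t + d) y - \<mu> t y = a * (1 - b) - d * \<kappa> y"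
        unfolding \<mu>_def ab a_def[symmetric] using True \<nu>(2) by (simp add: algebra_simps)
      moreover have "d * (a * (l * ((if y = 0 then 1 else 0) - \<nu> y)) - \<kappa> y) = a * (l * d - (l * d)\<^sup>2) + a * (l * d)\<^sup>2 - d * \<kappa> y"
        using True \<nu>(2) by (simp add: algebra_simps)
      ultimately show ?thesis unfolding a_def[symmetric] by linarith
    next
      case False
      have "1 - l * d \<le> b" using exp_ge_add_one_self[of "- l * d"] by (simp add: b_def)
      then have "(a * \<nu> y) * (1 - l * d) \<le> (a * \<nu> y) * b"
        using a \<nu>(1)[of y] by (intro mult_left_mono) auto
      moreover have "\<mu> (t + d) y - \<mu> t y = (a * \<nu> y) * b - a * \<nu> y - d * \<kappa> y"
        unfolding \<mu>_def ab a_def[symmetric] using False by (simp add: algebra_simps)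
      moreover have "d * (a * (l * ((if y = 0 then 1 else 0) - \<nu> y)) - \<kappa> y) = (a * \<nu> y) * (1 - l * d) - a * \<nu> y - d * \<kappa> y"
        using False by (simp add: algebra_simps)
      moreover have "0 \<le> (l * d)\<^sup>2" by simp
      ultimately show ?thesis unfolding a_def[symmetric] by linarith
    qed
  qed
  \<comment> \<open>\<open>\<epsilon>\<close> is the error per unit of time in one state: difference
    quotients are replaced by \<open>Q\<close> on the block \<open>{..M}\<close>, weighted with a
    bound for the candidate, and \<open>incr\<close> adds its quadratic error. For fixed
    \<open>M\<close> it vanishes as \<open>N\<close> grows.\<close>
  have grid: "(\<Sum>x<n. \<nu> x * measure (P x) (bounded_grid M (T / 2 ^ N) (2 ^ N) x y)) \<le> \<mu> T y + T * (real (Suc M) * \<epsilon>)"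
    if y: "y \<le> M" and \<epsilon>: "\<epsilon> = (\<Sum>v\<le>M. (\<nu> v + 1 + T * \<kappa> v) * (\<Sum>w\<le>M. \<bar>(p (T / 2 ^ N) v w - (if v = w then 1 else 0)) / (T / 2 ^ N) - Q v w\<bar>)) + l\<^sup>2 * (T / 2 ^ N)"
    for M N y \<epsilon>
  proof -
    define d where "d = T / 2 ^ N"
    have d: "0 < d" using T by (simp add: d_def)
    define \<eta> where "\<eta> v w = (p d v w - (if v = w then 1 else 0)) / d - Q v w" for v w
    have p_eq: "p d v w = (if v = w then 1 else 0) + d * Q v w + d * \<eta> v w" for v w
      using d by (simp add: \<eta>_def field_simps)
    have \<mu>_abs: "\<bar>\<mu> t v\<bar> \<le> \<nu> v + 1 + T * \<kappa> v" if "0 \<le> t" "t \<le> T" for t v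
    proof -
      have et: "0 \<le> exp (- l * t)" "exp (- l * t) \<le> 1" using l that by auto
      have "\<bar>exp (- l * t) * \<nu> v\<bar> \<le> \<nu> v" using et \<nu>(1)[of v] by (simp add: abs_mult mult_left_le_one_le)
      moreover have "\<bar>if v = 0 then 1 - exp (- l * t) else 0\<bar> \<le> 1" using et by auto
      moreover have "\<bar>t * \<kappa> v\<bar> \<le> T * \<kappa> v" using that \<kappa>_nonneg[of v] by (simp add: abs_mult mult_right_mono)
      ultimately show ?thesis unfolding \<mu>_def by linarith
    qed
    have \<epsilon>_eq: "\<epsilon> = (\<Sum>v\<le>M. (\<nu> v + 1 + T * \<kappa> v) * (\<Sum>w\<le>M. \<bar>\<eta> v w\<bar>)) + l\<^sup>2 * d"
      by (simp add: \<epsilon> \<eta>_def d_def)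
    have c_nonneg: "0 \<le> \<nu> v + 1 + T * \<kappa> v" for v using \<nu>(1)[of v] \<kappa>_nonneg[of v] T by simp
    have \<epsilon>_nonneg: "0 \<le> \<epsilon>"
    proof -
      have "0 \<le> (\<Sum>v\<le>M. (\<nu> v + 1 + T * \<kappa> v) * (\<Sum>w\<le>M. \<bar>\<eta> v w\<bar>))"
        by (intro sum_nonneg mult_nonneg_nonneg[OF c_nonneg]) auto
      moreover have "0 \<le> l\<^sup>2 * d" using d by simp
      ultimately show ?thesis unfolding \<epsilon>_eq by linarith
    qed
    have step: "(\<Sum>v\<le>M. \<mu> t v * p d v w) \<le> \<mu> (t + d) w + \<epsilon> * d"
      if t: "0 \<le> t" "t \<le> T" and w: "w \<le> M" for t w
    proof -
      have "(\<Sum>v\<le>M. \<mu> t v * p d v w) = (\<Sum>v\<le>M. \<mu> t v * (if v = w then 1 else 0)) + d * (\<Sum>v\<le>M. \<mu> t v * Q v w) + d * (\<Sum>v\<le>M. \<mu> t v * \<eta> v w)"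
        unfolding p_eq distrib_left sum.distrib by (simp add: sum_distrib_left mult_ac)
      also have "(\<Sum>v\<le>M. \<mu> t v * (if v = w then 1 else 0)) = \<mu> t w"
        using w by (simp add: if_distrib[of "\<lambda>t. _ * t"] cong: if_cong)
      also have "d * (\<Sum>v\<le>M. \<mu> t v * Q v w) \<le> d * (exp (- l * t) * (l * ((if w = 0 then 1 else 0) - \<nu> w)) - \<kappa> w)"
        using d by (intro mult_left_mono drift t w) auto
      also have "\<dots> \<le> \<mu> (t + d) w - \<mu> t w + (l * d)\<^sup>2" using d t by (intro incr) auto
      also have "(\<Sum>v\<le>M. \<mu> t v * \<eta> v w) \<le> (\<Sum>v\<le>M. (\<nu> v + 1 + T * \<kappa> v) * (\<Sum>w\<le>M. \<bar>\<eta> v w\<bar>))"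
      proof (rule sum_mono)
        fix v
        have "\<mu> t v * \<eta> v w \<le> \<bar>\<mu> t v\<bar> * \<bar>\<eta> v w\<bar>" by (simp flip: abs_mult)
        also have "\<bar>\<mu> t v\<bar> * \<bar>\<eta> v w\<bar> \<le> (\<nu> v + 1 + T * \<kappa> v) * (\<Sum>w\<le>M. \<bar>\<eta> v w\<bar>)"
          using w by (intro mult_mono \<mu>_abs t member_le_sum) (auto simp: c_nonneg)
        finally show "\<mu> t v * \<eta> v w \<le> (\<nu> v + 1 + T * \<kappa> v) * (\<Sum>w\<le>M. \<bar>\<eta> v w\<bar>)" .
      qed
      finally show ?thesis using d by (simp add: \<epsilon>_eq algebra_simps power2_eq_square)
    qed
    define N' where "N' k w = (\<Sum>x<n. \<nu> x * measure (P x) (bounded_grid M d k x w))" for k w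
    have N'_Suc: "N' (Suc k) w = (\<Sum>v\<le>M. N' k v * p d v w)" if "w \<le> M" for k w
    proof -
      have "N' (Suc k) w = (\<Sum>x<n. \<Sum>v\<le>M. \<nu> x * measure (P x) (bounded_grid M d k x v) * p d v w)"
        unfolding N'_def bounded_grid_Suc[OF less_imp_le[OF d] that] by (simp add: sum_distrib_left mult.assoc)
      then show ?thesis unfolding N'_def sum_distrib_right by (subst sum.swap)
    qed
    define e where "e k w = N' k w - \<mu> (real k * d) w" for k w
    \<comment> \<open>Total positive excess over the candidate. As \<open>p d\<close> is
      substochastic, a step increases it by at most the new error \<open>\<epsilon> * d\<close> in
      each of the \<open>Suc M\<close> states; there are \<open>T / d\<close> steps.\<close>
    define E where "E k = (\<Sum>w\<le>M. max 0 (e k w))" for k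
    have E_bound: "E k \<le> real k * (real (Suc M) * (\<epsilon> * d))" if "k \<le> 2 ^ N" for k
      using that
    proof (induction k)
      case 0
      have "N' 0 w \<le> \<nu> w" for w
      proof -
        have "N' 0 w \<le> (\<Sum>x<n. \<nu> x * (if x = w then 1 else 0))"
          unfolding N'_def by (intro sum_mono mult_left_mono bounded_grid_0 \<nu>)
        also have "\<dots> \<le> \<nu> w" using \<nu>(1)[of w] by (simp add: if_distrib[of "\<lambda>t. _ * t"] cong: if_cong)
        finally show ?thesis .
      qed
      then have "e 0 w \<le> 0" for w by (simp add: e_def \<mu>_def)
      then show ?case by (simp add: E_def max_absorb1)
    next
      case (Suc k)
      have kd: "real k * d \<le> T"
      proof -
        have "real k \<le> 2 ^ N" using Suc.prems by (metis Suc_leD of_nat_le_iff of_nat_numeral of_nat_power)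
        then have "real k * d \<le> 2 ^ N * d" using d by (intro mult_right_mono) auto
        then show ?thesis by (simp add: d_def)
      qed
      have "max 0 (e (Suc k) w) \<le> (\<Sum>v\<le>M. max 0 (e k v) * p d v w) + \<epsilon> * d" if w: "w \<le> M" for w
      proof -
        have "e (Suc k) w = (\<Sum>v\<le>M. e k v * p d v w) + (\<Sum>v\<le>M. \<mu> (real k * d) v * p d v w) - \<mu> (real k * d + d) w"
          unfolding e_def N'_Suc[OF w] left_diff_distrib sum_subtractf by (simp add: algebra_simps)
        also have "\<dots> \<le> (\<Sum>v\<le>M. e k v * p d v w) + \<epsilon> * d" using step[OF _ kd w] d by simp
        also have "\<dots> \<le> (\<Sum>v\<le>M. max 0 (e k v) * p d v w) + \<epsilon> * d"
          by (intro add_right_mono sum_mono mult_right_mono) auto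
        finally have "e (Suc k) w \<le> (\<Sum>v\<le>M. max 0 (e k v) * p d v w) + \<epsilon> * d" .
        moreover have "0 \<le> (\<Sum>v\<le>M. max 0 (e k v) * p d v w) + \<epsilon> * d"
          using \<epsilon>_nonneg d by (intro add_nonneg_nonneg sum_nonneg mult_nonneg_nonneg) auto
        ultimately show ?thesis by simp
      qed
      then have "E (Suc k) \<le> (\<Sum>w\<le>M. (\<Sum>v\<le>M. max 0 (e k v) * p d v w) + \<epsilon> * d)"
        unfolding E_def by (intro sum_mono) auto
      also have "\<dots> = (\<Sum>v\<le>M. max 0 (e k v) * (\<Sum>w\<le>M. p d v w)) + real (Suc M) * (\<epsilon> * d)"
        unfolding sum.distrib sum_distrib_left by (subst sum.swap) simp
      also have "(\<Sum>v\<le>M. max 0 (e k v) * (\<Sum>w\<le>M. p d v w)) \<le> (\<Sum>v\<le>M. max 0 (e k v) * 1)"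
        using d by (intro sum_mono mult_left_mono p_sum_le) auto
      finally have "E (Suc k) \<le> E k + real (Suc M) * (\<epsilon> * d)" by (simp add: E_def)
      also have "E k \<le> real k * (real (Suc M) * (\<epsilon> * d))" using Suc by simp
      finally show ?case by (simp add: algebra_simps)
    qed
    have "e (2 ^ N) y \<le> E (2 ^ N)"
    proof -
      have "e (2 ^ N) y \<le> max 0 (e (2 ^ N) y)" by simp
      also have "\<dots> \<le> E (2 ^ N)" unfolding E_def using y by (intro member_le_sum) auto
      finally show ?thesis .
    qed
    also have "\<dots> \<le> real (2 ^ N) * (real (Suc M) * (\<epsilon> * d))" by (rule E_bound) simp
    also have "\<dots> = T * (real (Suc M) * \<epsilon>)" by (simp add: d_def)
    finally have "N' (2 ^ N) y - \<mu> (real (2 ^ N) * d) y \<le> T * (real (Suc M) * \<epsilon>)" by (simp only: e_def)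
    moreover have "real (2 ^ N) * d = T" by (simp add: d_def)
    ultimately show ?thesis by (simp add: N'_def d_def)
  qed
  \<comment> \<open>Boundedness at all grid times of all levels at once does not depend on
    \<open>N\<close>, so the mesh can tend to \<open>0\<close> at fixed \<open>M\<close>; afterwards
    \<open>M\<close> grows, and \<open>bounded_before\<close> shows that nothing is lost.\<close>
  define G where "G M x = (\<Inter>N. bounded_grid M (T / 2 ^ N) (2 ^ N) x y)" for M x
  have G_sets: "G M x \<in> sets (P x)" for M x
    unfolding G_def by (intro sets.countable_INT) (use T in \<open>auto intro!: sets_bounded_grid\<close>)
  have G_bound: "(\<Sum>x<n. \<nu> x * measure (P x) (G M x)) \<le> \<mu> T y" if y: "y \<le> M" for M
  proof (rule LIMSEQ_le_const)
    let ?d = "\<lambda>N. T / 2 ^ N"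
    define eps where "eps N = (\<Sum>v\<le>M. (\<nu> v + 1 + T * \<kappa> v) * (\<Sum>w\<le>M. \<bar>(p (?d N) v w - (if v = w then 1 else 0)) / ?d N - Q v w\<bar>)) + l\<^sup>2 * ?d N" for N
    have d: "?d \<longlonglongrightarrow> 0" "\<And>N. 0 < ?d N" using T by (auto intro: LIMSEQ_divide_realpow_zero)
    have "eps \<longlonglongrightarrow> (\<Sum>v\<le>M. (\<nu> v + 1 + T * \<kappa> v) * (\<Sum>w\<le>M. \<bar>Q v w - Q v w\<bar>)) + l\<^sup>2 * 0"
      unfolding eps_def[abs_def] by (intro tendsto_intros Q_tendsto[OF d] d(1))
    then have eps: "eps \<longlonglongrightarrow> 0" by simp
    have "(\<lambda>N. \<mu> T y + T * (real (Suc M) * eps N)) \<longlonglongrightarrow> \<mu> T y + T * (real (Suc M) * 0)"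
      by (intro tendsto_add tendsto_mult tendsto_const eps)
    then show "(\<lambda>N. \<mu> T y + T * (real (Suc M) * eps N)) \<longlonglongrightarrow> \<mu> T y" by simp
    have "(\<Sum>x<n. \<nu> x * measure (P x) (G M x)) \<le> \<mu> T y + T * (real (Suc M) * eps N)" for N
    proof -
      have "(\<Sum>x<n. \<nu> x * measure (P x) (G M x)) \<le> (\<Sum>x<n. \<nu> x * measure (P x) (bounded_grid M (T / 2 ^ N) (2 ^ N) x y))"
        using \<nu>(1) T by (intro sum_mono mult_left_mono P.finite_measure_mono sets_bounded_grid) (auto simp: G_def)
      also have "\<dots> \<le> \<mu> T y + T * (real (Suc M) * eps N)" by (rule grid[OF y eps_def])
      finally show ?thesis .
    qed
    then show "\<exists>N. \<forall>m\<ge>N. (\<Sum>x<n. \<nu> x * measure (P x) (G M x)) \<le> \<mu> T y + T * (real (Suc M) * eps m)" by blast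
  qed
  have "(\<lambda>M. measure (P x) (G M x)) \<longlonglongrightarrow> p T x y" for x
  proof -
    have G_iff: "\<omega> \<in> G M x \<longleftrightarrow> \<omega> \<in> space (P x) \<and> X T \<omega> = enat y \<and> (\<forall>N. \<forall>i\<le>2 ^ N. X (real i * (T / 2 ^ N)) \<omega> \<in> enat ` {..M})" for M \<omega>
      by (auto simp: G_def bounded_grid_def)
    have inc: "incseq (\<lambda>M. G M x)"
    proof (intro incseq_SucI subsetI)
      fix M \<omega> assume "\<omega> \<in> G M x"
      moreover have "enat ` {..M} \<subseteq> enat ` {..Suc M}" by (intro image_mono) auto
      ultimately show "\<omega> \<in> G (Suc M) x" unfolding G_iff by blast
    qed
    have "(\<Union>M. G M x) = {\<omega> \<in> space (P x). X T \<omega> = enat y}"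
    proof (intro equalityI subsetI)
      fix \<omega> assume "\<omega> \<in> {\<omega> \<in> space (P x). X T \<omega> = enat y}"
      then have \<omega>: "\<omega> \<in> space (P x)" "X T \<omega> = enat y" by auto
      obtain M where M: "\<And>r. 0 \<le> r \<Longrightarrow> r \<le> T \<Longrightarrow> \<exists>z\<le>M. X r \<omega> = enat z"
        by (rule bounded_before[OF \<omega>(1) less_imp_le[OF T] \<omega>(2)]) blast
      have "X (real i * (T / 2 ^ N)) \<omega> \<in> enat ` {..M}" if "i \<le> 2 ^ N" for i N
      proof -
        have "real i \<le> 2 ^ N" using that by (metis of_nat_le_iff of_nat_numeral of_nat_power)
        then have "real i * T \<le> 2 ^ N * T" using T by (intro mult_right_mono) auto
        then have "real i * (T / 2 ^ N) \<le> T" by (simp add: field_simps)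
        then show ?thesis using M[of "real i * (T / 2 ^ N)"] T by auto
      qed
      then have "\<omega> \<in> G M x" using \<omega> by (simp add: G_iff)
      then show "\<omega> \<in> (\<Union>M. G M x)" by blast
    qed (auto simp: G_iff)
    then show ?thesis
      using P.finite_Lim_measure_incseq[of "\<lambda>M. G M x" x] G_sets inc by (auto simp: p_def)
  qed
  then have "(\<lambda>M. \<Sum>x<n. \<nu> x * measure (P x) (G M x)) \<longlonglongrightarrow> (\<Sum>x<n. \<nu> x * p T x y)"
    by (intro tendsto_sum tendsto_mult tendsto_const)
  then have "(\<Sum>x<n. \<nu> x * p T x y) \<le> \<mu> T y"
    by (rule LIMSEQ_le_const2) (use G_bound in blast)
  then show ?thesis by (simp add: \<mu>_def \<kappa>_def)
qed

end

section \<open>Quasi-stationary distributions\<close>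

text \<open>Tonelli's theorem for double series, by passing through \<open>ennreal\<close>.\<close>

lemma sums_swap:
  fixes a :: "nat \<Rightarrow> nat \<Rightarrow> real"
  assumes nn: "\<And>x y. 0 \<le> a x y" and b: "\<And>x. a x sums b x" and c: "b sums c" and d: "\<And>y. (\<lambda>x. a x y) sums d y"
  shows "d sums c"
proof -
  have b_nn: "0 \<le> b x" for x by (rule sums_le[OF _ sums_zero b]) (simp add: nn)
  have d_nn: "0 \<le> d y" for y by (rule sums_le[OF _ sums_zero d]) (simp add: nn)
  have c_nn: "0 \<le> c" by (rule sums_le[OF _ sums_zero c]) (simp add: b_nn)
  have "(\<Sum>y. ennreal (d y)) = (\<Sum>y. \<Sum>x. ennreal (a x y))"
    by (intro suminf_cong suminf_ennreal_eq[symmetric] nn d)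
  also have "\<dots> = (\<integral>\<^sup>+x. (\<Sum>y. ennreal (a x y)) \<partial>count_space UNIV)"
    by (subst nn_integral_suminf) (simp_all add: nn_integral_count_space_nat)
  also have "\<dots> = (\<Sum>x. \<Sum>y. ennreal (a x y))" by (rule nn_integral_count_space_nat)
  also have "\<dots> = (\<Sum>x. ennreal (b x))"
    by (intro suminf_cong suminf_ennreal_eq nn b)
  also have "\<dots> = ennreal c" by (intro suminf_ennreal_eq b_nn c)
  finally have "(\<lambda>y. ennreal (d y)) sums ennreal c"
    using summable_sums[OF summableI, of "\<lambda>y. ennreal (d y)"] by simp
  then show ?thesis by (subst (asm) sums_ennreal) (auto simp: d_nn c_nn)
qed

context killed_markov_chain
begin

lemma space_initial_law: "space (initial_law P \<nu>) = space (P 0)"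
  unfolding initial_law_def by (simp add: space_measure_of_conv)

lemma emeasure_initial_law:
  assumes "A \<in> sets (P 0)"
  shows "emeasure (initial_law P \<nu>) A = (\<Sum>y. ennreal (\<nu> y) * emeasure (P y) A)"
  unfolding initial_law_def
proof (rule emeasure_measure_of_sigma)
  show "countably_additive (sets (P 0)) (\<lambda>A. \<Sum>y. ennreal (\<nu> y) * emeasure (P y) A)"
    unfolding countably_additive_def
  proof (intro allI impI)
    fix A :: "nat \<Rightarrow> 'a set" assume A: "range A \<subseteq> sets (P 0)" "disjoint_family A"
    have "(\<Sum>i. \<Sum>y. ennreal (\<nu> y) * emeasure (P y) (A i)) = (\<integral>\<^sup>+y. (\<Sum>i. ennreal (\<nu> y) * emeasure (P y) (A i)) \<partial>count_space UNIV)"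
      by (subst nn_integral_suminf) (simp_all add: nn_integral_count_space_nat)
    also have "\<dots> = (\<Sum>y. \<Sum>i. ennreal (\<nu> y) * emeasure (P y) (A i))" by (rule nn_integral_count_space_nat)
    also have "\<dots> = (\<Sum>y. ennreal (\<nu> y) * emeasure (P y) (\<Union>i. A i))"
    proof (rule suminf_cong)
      fix y
      have "range A \<subseteq> sets (P y)" using A(1) sets_P by blast
      then show "(\<Sum>i. ennreal (\<nu> y) * emeasure (P y) (A i)) = ennreal (\<nu> y) * emeasure (P y) (\<Union>i. A i)"
        by (simp add: suminf_emeasure A(2))
    qed
    finally show "(\<Sum>i. \<Sum>y. ennreal (\<nu> y) * emeasure (P y) (A i)) = (\<Sum>y. ennreal (\<nu> y) * emeasure (P y) (\<Union>i. A i))" .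
  qed
qed (auto simp: positive_def assms sets.sigma_algebra_axioms)

lemma sums_initial_law:
  assumes \<nu>: "prob_distribution \<nu>" and A: "A \<in> sets (P 0)"
  shows "(\<lambda>y. \<nu> y * measure (P y) A) sums measure (initial_law P \<nu>) A"
proof -
  have nn: "0 \<le> \<nu> y * measure (P y) A" for y using \<nu> by (simp add: prob_distribution_def)
  have "summable (\<lambda>y. \<nu> y * measure (P y) A)"
  proof (rule summable_comparison_test'[of \<nu> 0])
    show "summable \<nu>" using \<nu> by (auto simp: prob_distribution_def sums_iff)
    show "norm (\<nu> y * measure (P y) A) \<le> \<nu> y" for y
      using \<nu> by (simp add: prob_distribution_def abs_mult mult_left_le)
  qed
  then have s: "(\<lambda>y. \<nu> y * measure (P y) A) sums (\<Sum>y. \<nu> y * measure (P y) A)" by (rule summable_sums)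
  have "emeasure (initial_law P \<nu>) A = (\<Sum>y. ennreal (\<nu> y * measure (P y) A))"
    using \<nu> by (simp add: emeasure_initial_law[OF A] P.emeasure_eq_measure ennreal_mult prob_distribution_def)
  also have "\<dots> = ennreal (\<Sum>y. \<nu> y * measure (P y) A)" by (rule suminf_ennreal_eq[OF nn s])
  finally have "measure (initial_law P \<nu>) A = (\<Sum>y. \<nu> y * measure (P y) A)"
    using suminf_nonneg[OF sums_summable[OF s] nn] by (simp add: measure_def)
  then show ?thesis using s by simp
qed

end

section \<open>Evolution of an initial law and quasi-stationarity\<close>

context absorbed_chain
begin

definition law_at :: "(nat \<Rightarrow> real) \<Rightarrow> real \<Rightarrow> nat \<Rightarrow> real" where
  "law_at \<nu> t y = (\<Sum>x. \<nu> x * p t x y)"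

definition mean_survival :: "(nat \<Rightarrow> real) \<Rightarrow> real \<Rightarrow> real" where
  "mean_survival \<nu> t = (\<Sum>x. \<nu> x * survival t x)"

lemma weighted_sums:
  assumes "prob_distribution \<nu>" "\<And>x. 0 \<le> g x" "\<And>x. g x \<le> 1"
  shows "(\<lambda>x. \<nu> x * g x) sums (\<Sum>x. \<nu> x * g x)"
proof (rule summable_sums, rule summable_comparison_test'[of \<nu> 0])
  show "summable \<nu>" using assms by (auto simp: prob_distribution_def sums_iff)
  show "norm (\<nu> y * g y) \<le> \<nu> y" for y
    using assms by (simp add: prob_distribution_def abs_mult mult_left_le)
qed

lemma law_at_sums: "prob_distribution \<nu> \<Longrightarrow> (\<lambda>x. \<nu> x * p t x y) sums law_at \<nu> t y"
  unfolding law_at_def by (rule weighted_sums) auto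

lemma mean_survival_sums: "prob_distribution \<nu> \<Longrightarrow> (\<lambda>x. \<nu> x * survival t x) sums mean_survival \<nu> t"
  unfolding mean_survival_def by (rule weighted_sums) (auto simp: survival_le_1)

lemma law_at_sums_1:
  assumes "prob_distribution \<nu>" "0 \<le> t" shows "law_at \<nu> t sums 1"
proof (rule sums_swap)
  show "(\<lambda>y. \<nu> x * p t x y) sums \<nu> x" for x using sums_mult[OF p_sums_1[OF assms(2)], of "\<nu> x" x] by simp
qed (use assms law_at_sums in \<open>auto simp: prob_distribution_def\<close>)

lemma mean_survival_eq:
  assumes "prob_distribution \<nu>" "0 \<le> t" shows "mean_survival \<nu> t = 1 - law_at \<nu> t 0"
proof -
  have "\<nu> sums 1" using assms by (simp add: prob_distribution_def)
  from sums_diff[OF this law_at_sums[OF assms(1), of t 0]]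
  have "(\<lambda>x. \<nu> x * survival t x) sums (1 - law_at \<nu> t 0)" using assms(2) by (simp add: survival_def algebra_simps)
  then show ?thesis using sums_unique2 mean_survival_sums[OF assms(1)] by blast
qed

text \<open>Almost surely, survival beyond \<open>t\<close> means that the path is not in
  \<open>0\<close> at time \<open>t\<close>. So the conditional law is the law at \<open>t\<close>
  on positive states, divided by the survival probability, and its vanishing at \<open>0\<close>
  forces \<open>\<nu> 0 = 0\<close>.\<close>

lemma quasi_stationary_iff:
  "quasi_stationary P X \<nu> \<longleftrightarrow> prob_distribution \<nu> \<and> \<nu> 0 = 0 \<and>
    (\<forall>y t. 0 < y \<longrightarrow> 0 \<le> t \<longrightarrow> \<nu> y = law_at \<nu> t y / mean_survival \<nu> t)"
proof -
  have cond: "\<P>(\<omega> in initial_law P \<nu>. X t \<omega> = enat y \<bar> ereal t < hit X {0} \<omega>) =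
      (if y = 0 then 0 else law_at \<nu> t y) / mean_survival \<nu> t" if \<nu>: "prob_distribution \<nu>" and t: "0 \<le> t" for t y
  proof -
    let ?L = "initial_law P \<nu>"
    have [measurable]: "hit X {0} \<in> borel_measurable (P x)" for x by (rule measurable_hit)
    have S_sets: "{\<omega> \<in> space (P x). ereal t < hit X {0} \<omega>} \<in> sets (P x)" for x by measurable
    have J_sets: "{\<omega> \<in> space (P x). X t \<omega> = enat y \<and> ereal t < hit X {0} \<omega>} \<in> sets (P x)" for x
    proof -
      have "{\<omega> \<in> space (P x). X t \<omega> = enat y \<and> ereal t < hit X {0} \<omega>} =
          {\<omega> \<in> space (P x). X t \<omega> = enat y} \<inter> {\<omega> \<in> space (P x). ereal t < hit X {0} \<omega>}" by auto
      then show ?thesis using sets.Int[OF sets_X_eq[OF t] S_sets] by (simp only:)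
    qed
    have S: "measure ?L {\<omega> \<in> space (P 0). ereal t < hit X {0} \<omega>} = mean_survival \<nu> t"
    proof -
      have "(\<lambda>x. \<nu> x * survival t x) sums measure ?L {\<omega> \<in> space (P 0). ereal t < hit X {0} \<omega>}"
      proof -
        have "survival t x = measure (P x) {\<omega> \<in> space (P 0). ereal t < hit X {0} \<omega>}" for x
          using survival_eq[OF t, of x] space_P[of x 0] by simp
        then show ?thesis using sums_initial_law[OF \<nu> S_sets[of 0]] by (simp only:)
      qed
      then show ?thesis using sums_unique2 mean_survival_sums[OF \<nu>] by blast
    qed
    have J: "\<P>(\<omega> in P x. X t \<omega> = enat y \<and> ereal t < hit X {0} \<omega>) = (if y = 0 then 0 else p t x y)" for x
    proof -
      have "\<P>(\<omega> in P x. X t \<omega> = enat y \<and> ereal t < hit X {0} \<omega>) = \<P>(\<omega> in P x. y \<noteq> 0 \<and> X t \<omega> = enat y)"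
      proof (rule P.prob_eq_AE)
        show "AE \<omega> in P x. X t \<omega> = enat y \<and> ereal t < hit X {0} \<omega> \<longleftrightarrow> y \<noteq> 0 \<and> X t \<omega> = enat y"
          using AE_hit_0[of x]
        proof (elim AE_mp, intro AE_I2 impI)
          fix \<omega> assume "\<forall>t\<ge>0. (hit X {0} \<omega> \<le> ereal t) = (X t \<omega> = enat 0)"
          then have "(hit X {0} \<omega> \<le> ereal t) = (X t \<omega> = enat 0)" using t by blast
          then have "ereal t < hit X {0} \<omega> \<longleftrightarrow> X t \<omega> \<noteq> enat 0" by (simp only: not_le[symmetric])
          then show "X t \<omega> = enat y \<and> ereal t < hit X {0} \<omega> \<longleftrightarrow> y \<noteq> 0 \<and> X t \<omega> = enat y" by auto
        qed
      qed (use J_sets t in auto)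
      then show ?thesis by (cases "y = 0") (simp_all add: p_def)
    qed
    have "measure ?L {\<omega> \<in> space (P 0). X t \<omega> = enat y \<and> ereal t < hit X {0} \<omega>} = (if y = 0 then 0 else law_at \<nu> t y)"
    proof -
      have "(\<lambda>x. \<nu> x * (if y = 0 then 0 else p t x y)) sums measure ?L {\<omega> \<in> space (P 0). X t \<omega> = enat y \<and> ereal t < hit X {0} \<omega>}"
      proof -
        have "(if y = 0 then 0 else p t x y) = measure (P x) {\<omega> \<in> space (P 0). X t \<omega> = enat y \<and> ereal t < hit X {0} \<omega>}" for x
          using J[of x] space_P[of x 0] by simp
        then show ?thesis using sums_initial_law[OF \<nu> J_sets[of 0]] by (simp only:)
      qed
      then show ?thesis using sums_unique2[OF _ law_at_sums[OF \<nu>, of t y]] sums_unique2[OF _ sums_zero]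
        by (cases "y = 0") auto
    qed
    then show ?thesis by (simp add: cond_prob_def space_initial_law S)
  qed
  show ?thesis
  proof
    assume qs: "quasi_stationary P X \<nu>"
    then have \<nu>: "prob_distribution \<nu>" by (simp add: quasi_stationary_def)
    have *: "\<nu> y = (if y = 0 then 0 else law_at \<nu> t y) / mean_survival \<nu> t" if "0 \<le> t" for y t
      using qs cond[OF \<nu> that, of y] that unfolding quasi_stationary_def by metis
    have "\<nu> 0 = 0" using *[of 0 0] by simp
    moreover have "\<forall>y t. 0 < y \<longrightarrow> 0 \<le> t \<longrightarrow> \<nu> y = law_at \<nu> t y / mean_survival \<nu> t" using * by force
    ultimately show "prob_distribution \<nu> \<and> \<nu> 0 = 0 \<and>
      (\<forall>y t. 0 < y \<longrightarrow> 0 \<le> t \<longrightarrow> \<nu> y = law_at \<nu> t y / mean_survival \<nu> t)" using \<nu> by blast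
  next
    assume r: "prob_distribution \<nu> \<and> \<nu> 0 = 0 \<and>
      (\<forall>y t. 0 < y \<longrightarrow> 0 \<le> t \<longrightarrow> \<nu> y = law_at \<nu> t y / mean_survival \<nu> t)"
    then show "quasi_stationary P X \<nu>"
      unfolding quasi_stationary_def by (auto simp: cond)
  qed
qed

text \<open>The law at time \<open>t\<close> under an initial law that decays at rate \<open>l\<close>.\<close>

definition decayed :: "real \<Rightarrow> (nat \<Rightarrow> real) \<Rightarrow> real \<Rightarrow> nat \<Rightarrow> real" where
  "decayed l \<nu> t y = exp (- l * t) * \<nu> y + (if y = 0 then 1 - exp (- l * t) else 0)"

lemma law_at_le:
  assumes \<nu>: "prob_distribution \<nu>" "\<nu> 0 = 0" and l: "0 \<le> l"
    and s: "\<And>y. s y = (if y = 0 then l else 0) - l * \<nu> y - (\<Sum>x\<le>Suc y. \<nu> x * Q x y)" "\<And>y. 0 \<le> s y"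
    and t: "0 < t"
  shows "law_at \<nu> t y \<le> decayed l \<nu> t y - t * (exp (- l * t) * s y / (1 + t * \<bar>Q y y\<bar>))"
  unfolding law_at_def decayed_def
proof (rule suminf_le_const)
  show "summable (\<lambda>x. \<nu> x * p t x y)" using law_at_sums[OF \<nu>(1)] by (rule sums_summable)
  fix n
  show "(\<Sum>x<n. \<nu> x * p t x y) \<le> exp (- l * t) * \<nu> y + (if y = 0 then 1 - exp (- l * t) else 0) -
      t * (exp (- l * t) * s y / (1 + t * \<bar>Q y y\<bar>))"
    by (rule forward_comparison) (use \<nu> l s t Q_0 skip_free in \<open>auto simp: prob_distribution_def\<close>)
qed

text \<open>With defect \<open>0\<close> the forward comparison gives
  \<open>law_at \<nu> t y \<le> decayed l \<nu> t y\<close> in every state; both sides have total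
  mass \<open>1\<close>, so they are equal.\<close>

lemma quasi_stationary_if_left_solution:
  assumes \<nu>: "prob_distribution \<nu>" "\<nu> 0 = 0" and l: "0 \<le> l"
    and left: "\<And>y. (\<Sum>x\<le>Suc y. \<nu> x * Q x y) = (if y = 0 then l else 0) - l * \<nu> y"
  shows "quasi_stationary P X \<nu>"
proof -
  have eq: "law_at \<nu> t y = decayed l \<nu> t y" if t: "0 < t" for t y
  proof -
    have le: "0 \<le> decayed l \<nu> t y - law_at \<nu> t y" for y
      using law_at_le[OF \<nu> l, of "\<lambda>_. 0" t y] left t by simp
    have sum1: "\<nu> sums 1" using \<nu>(1) by (simp add: prob_distribution_def)
    have "decayed l \<nu> t sums (exp (- l * t) * 1 + (1 - exp (- l * t)))"
      unfolding decayed_def[abs_def]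
    proof (intro sums_add sums_mult sum1)
      show "(\<lambda>y. if y = 0 then 1 - exp (- l * t) else 0) sums (1 - exp (- l * t))"
        using sums_single[of 0 "\<lambda>_. 1 - exp (- l * t)"] by simp
    qed
    from sums_diff[OF this law_at_sums_1[OF \<nu>(1) less_imp_le[OF t]]]
    have z: "(\<lambda>y. decayed l \<nu> t y - law_at \<nu> t y) sums 0" by simp
    then have "decayed l \<nu> t y - law_at \<nu> t y = 0"
      using suminf_eq_zero_iff[OF sums_summable[OF z]] le sums_unique[OF z] by simp
    then show ?thesis by simp
  qed
  have "\<nu> y = law_at \<nu> t y / mean_survival \<nu> t" if y: "0 < y" and t: "0 \<le> t" for y t
  proof (cases "t = 0")
    case True
    have "law_at \<nu> 0 z = \<nu> z" for z
    proof -
      have "(\<lambda>x. \<nu> x * p 0 x z) = (\<lambda>x. if x = z then \<nu> z else 0)" by (auto simp: p_0)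
      then show ?thesis unfolding law_at_def using sums_unique[OF sums_single[of z "\<lambda>_. \<nu> z"]] by simp
    qed
    then show ?thesis using True \<nu> by (simp add: mean_survival_eq)
  next
    case False
    then show ?thesis using y t eq[of t] \<nu> by (simp add: mean_survival_eq decayed_def)
  qed
  then show ?thesis using \<nu> by (simp add: quasi_stationary_iff)
qed

text \<open>While the absorption time lies in the interval from \<open>n\<close> to
  \<open>n + 1\<close>, the integrand is at most \<open>exp (l * (n + 1))\<close>; summing over
  \<open>n\<close> gives a geometric series with ratio \<open>exp (- (k - l))\<close>. The extra
  \<open>1\<close> covers absorption at time \<open>0\<close>.\<close>

lemma exp_moment_finite:
  assumes l: "0 < l" "l < k" and C: "\<And>n. survival (real n) x \<le> C * exp (- k * real n)"
  shows "(\<integral>\<^sup>+\<omega>. exp_ereal (ereal l * hit X {0} \<omega>) \<partial>P x) < \<infinity>"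
proof -
  have [measurable]: "hit X {0} \<in> borel_measurable (P x)" by (rule measurable_hit)
  let ?A = "\<lambda>n. {\<omega> \<in> space (P x). ereal (real n) < hit X {0} \<omega>}"
  define r where "r = exp (- (k - l))"
  have r: "0 \<le> r" "r < 1" using l by (auto simp: r_def)
  have C0: "0 \<le> C" using order_trans[OF survival_nonneg C[of 0]] by simp
  have "(\<integral>\<^sup>+\<omega>. exp_ereal (ereal l * hit X {0} \<omega>) \<partial>P x) \<le>
      (\<integral>\<^sup>+\<omega>. 1 + (\<Sum>n. ennreal (exp (l * (real n + 1))) * indicator (?A n) \<omega>) \<partial>P x)"
  proof (rule nn_integral_mono_AE)
    show "AE \<omega> in P x. exp_ereal (ereal l * hit X {0} \<omega>) \<le> 1 + (\<Sum>n. ennreal (exp (l * (real n + 1))) * indicator (?A n) \<omega>)"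
      using AE_absorbed[of x]
    proof (elim AE_mp, intro AE_I2 impI)
      fix \<omega> assume \<omega>: "\<omega> \<in> space (P x)" "hit X {0} \<omega> < \<infinity>"
      obtain h where h: "hit X {0} \<omega> = ereal h" "0 \<le> h" by (rule hit_attained[OF \<omega>]) blast
      show "exp_ereal (ereal l * hit X {0} \<omega>) \<le> 1 + (\<Sum>n. ennreal (exp (l * (real n + 1))) * indicator (?A n) \<omega>)"
      proof (cases "h = 0")
        case True then show ?thesis by (simp add: h exp_ereal_def)
      next
        case False
        define n where "n = nat (\<lceil>h\<rceil> - 1)"
        have "0 < h" using False h by simp
        then have "real n = of_int \<lceil>h\<rceil> - 1" by (simp add: n_def)
        then have n: "real n < h" "h \<le> real n + 1" by linarith+
        have "exp_ereal (ereal l * hit X {0} \<omega>) = ennreal (exp (l * h))" by (simp add: h exp_ereal_def)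
        also have "\<dots> \<le> ennreal (exp (l * (real n + 1))) * indicator (?A n) \<omega>"
          using n l \<omega> h by (auto intro!: ennreal_leI)
        also have "\<dots> \<le> (\<Sum>m. ennreal (exp (l * (real m + 1))) * indicator (?A m) \<omega>)"
        proof -
          define g where "g m = ennreal (exp (l * (real m + 1))) * indicator (?A m) \<omega>" for m
          have "sum g {n} \<le> suminf g" by (rule sum_le_suminf) auto
          then have "g n \<le> suminf g" by simp
          then show ?thesis unfolding g_def .
        qed
        also have "\<dots> \<le> 1 + (\<Sum>m. ennreal (exp (l * (real m + 1))) * indicator (?A m) \<omega>)" by simp
        finally show ?thesis .
      qed
    qed
  qed
  also have "\<dots> = 1 + (\<Sum>n. \<integral>\<^sup>+\<omega>. ennreal (exp (l * (real n + 1))) * indicator (?A n) \<omega> \<partial>P x)"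
    by (subst nn_integral_add) (simp_all add: nn_integral_suminf P.emeasure_space_1)
  also have "(\<Sum>n. \<integral>\<^sup>+\<omega>. ennreal (exp (l * (real n + 1))) * indicator (?A n) \<omega> \<partial>P x) \<le>
      (\<Sum>n. ennreal (C * exp l * r ^ n))"
  proof (intro suminf_le summableI)
    fix n
    have "(\<integral>\<^sup>+\<omega>. ennreal (exp (l * (real n + 1))) * indicator (?A n) \<omega> \<partial>P x) =
        ennreal (exp (l * (real n + 1))) * emeasure (P x) (?A n)"
      by (rule nn_integral_cmult_indicator) measurable
    also have "\<dots> = ennreal (exp (l * (real n + 1)) * survival (real n) x)"
      by (simp add: survival_eq P.emeasure_eq_measure ennreal_mult)
    also have "\<dots> \<le> ennreal (C * exp l * r ^ n)"
    proof (rule ennreal_leI)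
      have "exp (l * (real n + 1)) * survival (real n) x \<le> exp (l * (real n + 1)) * (C * exp (- k * real n))"
        using C by (intro mult_left_mono) auto
      also have "\<dots> = C * (exp (l * (real n + 1)) * exp (- k * real n))" by simp
      also have "exp (l * (real n + 1)) * exp (- k * real n) = exp l * r ^ n"
        unfolding r_def exp_of_nat_mult[symmetric] exp_add[symmetric] by (simp add: algebra_simps)
      finally show "exp (l * (real n + 1)) * survival (real n) x \<le> C * exp l * r ^ n" by (simp add: mult.assoc)
    qed
    finally show "(\<integral>\<^sup>+\<omega>. ennreal (exp (l * (real n + 1))) * indicator (?A n) \<omega> \<partial>P x) \<le> ennreal (C * exp l * r ^ n)" .
  qed
  also have "(\<Sum>n. ennreal (C * exp l * r ^ n)) = ennreal (C * exp l * (1 / (1 - r)))"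
    using r C0 by (intro suminf_ennreal_eq sums_mult geometric_sums) auto
  also have "1 + \<dots> < \<infinity>" by simp
  finally show ?thesis by (simp add: add_left_mono)
qed

text \<open>On positive states the law at \<open>s\<close> is a multiple of \<open>\<nu>\<close>,
  and the state \<open>0\<close> has survival probability \<open>0\<close>; Chapman-Kolmogorov then
  factorises.\<close>

lemma mean_survival_add:
  assumes \<nu>: "prob_distribution \<nu>" and law: "\<And>y. 0 < y \<Longrightarrow> law_at \<nu> s y = mean_survival \<nu> s * \<nu> y"
    and st: "0 \<le> s" "0 \<le> t"
  shows "mean_survival \<nu> (s + t) = mean_survival \<nu> s * mean_survival \<nu> t"
proof -
  have nn: "0 \<le> \<nu> x" for x using \<nu> by (simp add: prob_distribution_def)
  have "(\<lambda>y. law_at \<nu> s y * survival t y) sums mean_survival \<nu> (s + t)"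
  proof (rule sums_swap)
    show "(\<lambda>y. \<nu> x * p s x y * survival t y) sums (\<nu> x * survival (s + t) x)" for x
      using sums_mult[OF survival_chapman_kolmogorov[OF st, of x], of "\<nu> x"] by (simp add: mult.assoc)
    show "(\<lambda>x. \<nu> x * p s x y * survival t y) sums (law_at \<nu> s y * survival t y)" for y
      by (rule sums_mult2[OF law_at_sums[OF \<nu>]])
  qed (use nn mean_survival_sums[OF \<nu>] in auto)
  moreover have "law_at \<nu> s y * survival t y = mean_survival \<nu> s * (\<nu> y * survival t y)" for y
    using law[of y] st(2) by (cases "y = 0") (simp_all add: survival_def p_trap)
  moreover have "(\<lambda>y. mean_survival \<nu> s * (\<nu> y * survival t y)) sums (mean_survival \<nu> s * mean_survival \<nu> t)"
    by (rule sums_mult[OF mean_survival_sums[OF \<nu>]])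
  ultimately show ?thesis using sums_unique2 by simp
qed

text \<open>The survival probability is multiplicative in time, hence exponential; this is
  identified at integers and at mesh points, the times at which it is used. The difference quotients
  at \<open>0\<close> give the left equation as an inequality, and the forward comparison turns it
  into an equality.\<close>

lemma quasi_stationary_imp_nu:
  assumes qs: "quasi_stationary P X \<nu>"
  shows "\<exists>l>0. ereal l \<le> decay_parameter P X \<and> \<nu> = nu P X Q l"
proof -
  define S where "S = mean_survival \<nu>"
  have \<nu>: "prob_distribution \<nu>" "\<nu> 0 = 0"
    and qs': "\<And>y t. 0 < y \<Longrightarrow> 0 \<le> t \<Longrightarrow> \<nu> y = law_at \<nu> t y / S t"
    using qs by (auto simp: quasi_stationary_iff S_def)
  have nn: "0 \<le> \<nu> x" for x using \<nu> by (simp add: prob_distribution_def)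
  have sum1: "\<nu> sums 1" using \<nu>(1) by (simp add: prob_distribution_def)
  have "\<nu> \<noteq> (\<lambda>_. 0)" using sum1 sums_unique2[OF sums_zero] by fastforce
  then obtain x1 where x1: "\<nu> x1 \<noteq> 0" by auto
  have S_sums: "(\<lambda>x. \<nu> x * survival t x) sums S t" for t unfolding S_def by (rule mean_survival_sums[OF \<nu>(1)])
  have S_pos: "0 < S t" if "0 \<le> t" for t
  proof -
    have "0 \<le> S t" by (rule sums_le[OF _ sums_zero S_sums]) (simp add: nn)
    moreover have "S t \<noteq> 0" using qs'[of x1 t] x1 \<nu>(2) that by (cases "x1 = 0") auto
    ultimately show ?thesis by simp
  qed
  have law: "law_at \<nu> t y = S t * \<nu> y" if "0 < y" "0 \<le> t" for y t
    using qs'[OF that] S_pos[OF that(2)] by (simp add: field_simps)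
  have S_add: "S (s + t) = S s * S t" if "0 \<le> s" "0 \<le> t" for s t
    unfolding S_def by (rule mean_survival_add[OF \<nu>(1)]) (use law that in \<open>auto simp: S_def\<close>)
  have S_0: "S 0 = 1"
    using S_add[of 0 0] S_pos[of 0] by simp
  have S_mult: "S (real n * d) = S d ^ n" if "0 \<le> d" for n d
  proof (induction n)
    case (Suc n)
    have "S (real (Suc n) * d) = S (d + real n * d)" by (simp add: algebra_simps)
    then show ?case using S_add[of d "real n * d"] Suc that by simp
  qed (simp add: S_0)
  \<comment> \<open>Otherwise \<open>S\<close> would be \<open>1\<close> at all integers, and the
    chain started in \<open>x1\<close>, which is charged by \<open>\<nu>\<close>, would never be
    absorbed.\<close>
  have "S 1 < 1"
  proof (rule ccontr)
    assume "\<not> S 1 < 1"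
    have nu1: "(\<lambda>x. \<nu> x * (1 - survival t x)) sums (1 - S t)" for t
      using sums_diff[OF sum1 S_sums[of t]] by (simp add: right_diff_distrib)
    have v0: "0 \<le> \<nu> x * (1 - survival t x)" for x t using nn survival_le_1 by simp
    have "0 \<le> 1 - S t" for t by (rule sums_le[OF _ sums_zero nu1[of t]]) (rule v0)
    then have "S 1 = 1" using \<open>\<not> S 1 < 1\<close> by (smt (verit))
    then have "S (real n) = 1" for n using S_mult[of 1 n] by simp
    then have z: "(\<lambda>x. \<nu> x * (1 - survival (real n) x)) sums 0" for n using nu1[of "real n"] by simp
    have "\<nu> x1 * (1 - survival (real n) x1) = 0" for n
      using suminf_eq_zero_iff[OF sums_summable[OF z[of n]]] v0 sums_unique[OF z[of n]] by simp
    then have "p (real n) x1 0 = 0" for n using x1 by (simp add: survival_def)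
    then show False using p_absorbed_tendsto[of x1] LIMSEQ_unique[OF tendsto_const] by fastforce
  qed
  define l where "l = - ln (S 1)"
  have l: "0 < l" using \<open>S 1 < 1\<close> S_pos[of 1] by (simp add: l_def)
  have S_1: "S 1 = exp (- l)" using S_pos[of 1] by (simp add: l_def)
  have S_nat: "S (real n) = exp (- l * real n)" for n
    using S_mult[of 1 n] by (simp add: S_1 exp_of_nat_mult[symmetric] mult.commute)
  have S_mesh: "S (mesh n) = exp (- l * mesh n)" for n
  proof (rule power_eq_imp_eq_base)
    have m1: "real (2 ^ n) * mesh n = 1" by (simp add: mesh_def)
    have "S (mesh n) ^ (2 ^ n) = S 1" using S_mult[of "mesh n" "2 ^ n"] m1 by (simp add: less_imp_le)
    also have "\<dots> = exp (real (2 ^ n) * (- l * mesh n))"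
      using m1 by (simp only: S_1 mult.left_commute[of "real _"]) simp
    also have "\<dots> = exp (- l * mesh n) ^ (2 ^ n)" by (rule exp_of_nat_mult)
    finally show "S (mesh n) ^ (2 ^ n) = exp (- l * mesh n) ^ (2 ^ n)" .
  qed (simp_all add: less_imp_le S_pos)
  have law_decayed: "law_at \<nu> t y = decayed l \<nu> t y" if "0 \<le> t" "S t = exp (- l * t)" for t y
  proof (cases "y = 0")
    case True
    then show ?thesis using mean_survival_eq[OF \<nu>(1) that(1)] that(2) \<nu>(2) by (simp add: decayed_def S_def)
  qed (use law[of y t] that in \<open>simp add: decayed_def\<close>)
  define s where "s y = (if y = 0 then l else 0) - l * \<nu> y - (\<Sum>x\<le>Suc y. \<nu> x * Q x y)" for y
  \<comment> \<open>The series for the law at time \<open>mesh n\<close> is cut at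
    \<open>Suc y\<close> before the limit. The terms beyond are nonnegative, so an inequality
    survives.\<close>
  have s_nonneg: "0 \<le> s y" for y
  proof -
    have "(\<Sum>x\<le>Suc y. \<nu> x * Q x y) \<le> - l * (\<nu> y - (if y = 0 then 1 else 0))"
    proof (rule LIMSEQ_le)
      show "(\<lambda>n. \<Sum>x\<le>Suc y. \<nu> x * ((p (mesh n) x y - (if x = y then 1 else 0)) / mesh n)) \<longlonglongrightarrow> (\<Sum>x\<le>Suc y. \<nu> x * Q x y)"
        by (intro tendsto_intros Q_mesh)
      show "(\<lambda>n. (exp (- l * mesh n) - 1) / mesh n * (\<nu> y - (if y = 0 then 1 else 0))) \<longlonglongrightarrow> - l * (\<nu> y - (if y = 0 then 1 else 0))"
        by (intro tendsto_mult exp_mesh_tendsto tendsto_const)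
      have "(\<Sum>x\<le>Suc y. \<nu> x * ((p (mesh n) x y - (if x = y then 1 else 0)) / mesh n)) \<le>
          (exp (- l * mesh n) - 1) / mesh n * (\<nu> y - (if y = 0 then 1 else 0))" for n
      proof -
        have "(\<Sum>x\<le>Suc y. \<nu> x * p (mesh n) x y) \<le> law_at \<nu> (mesh n) y"
          unfolding law_at_def by (rule sum_le_suminf[OF sums_summable[OF law_at_sums[OF \<nu>(1)]]]) (auto simp: nn)
        also have "\<dots> = decayed l \<nu> (mesh n) y" by (rule law_decayed) (simp_all add: less_imp_le S_mesh)
        finally have *: "(\<Sum>x\<le>Suc y. \<nu> x * p (mesh n) x y) \<le> decayed l \<nu> (mesh n) y" .
        have "(\<Sum>x\<le>Suc y. \<nu> x * ((p (mesh n) x y - (if x = y then 1 else 0)) / mesh n)) =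
            ((\<Sum>x\<le>Suc y. \<nu> x * p (mesh n) x y) - (\<Sum>x\<le>Suc y. if x = y then \<nu> y else 0)) / mesh n"
          unfolding sum_subtractf[symmetric] sum_divide_distrib by (intro sum.cong) (auto simp: algebra_simps)
        also have "(\<Sum>x\<le>Suc y. if x = y then \<nu> y else 0) = \<nu> y" by simp
        also have "((\<Sum>x\<le>Suc y. \<nu> x * p (mesh n) x y) - \<nu> y) / mesh n \<le> (decayed l \<nu> (mesh n) y - \<nu> y) / mesh n"
          using * by (intro divide_right_mono) (auto simp: less_imp_le)
        also have "decayed l \<nu> (mesh n) y - \<nu> y = (exp (- l * mesh n) - 1) * (\<nu> y - (if y = 0 then 1 else 0))"
          by (simp add: decayed_def algebra_simps)
        finally show ?thesis by simp
      qed
      then show "\<exists>N. \<forall>n\<ge>N. (\<Sum>x\<le>Suc y. \<nu> x * ((p (mesh n) x y - (if x = y then 1 else 0)) / mesh n)) \<le>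
          (exp (- l * mesh n) - 1) / mesh n * (\<nu> y - (if y = 0 then 1 else 0))" by blast
    qed
    then show ?thesis by (auto simp: s_def algebra_simps)
  qed
  \<comment> \<open>\<open>law_at_le\<close> at time \<open>1\<close> leaves a margin proportional
    to \<open>s y\<close> between \<open>law_at\<close> and \<open>decayed\<close>; as these agree,
    the margin is zero.\<close>
  have s_0: "s y = 0" for y
  proof -
    have "law_at \<nu> 1 y \<le> decayed l \<nu> 1 y - 1 * (exp (- l * 1) * s y / (1 + 1 * \<bar>Q y y\<bar>))"
      by (rule law_at_le[OF \<nu> less_imp_le[OF l] s_def s_nonneg]) simp
    moreover have "law_at \<nu> 1 y = decayed l \<nu> 1 y" by (rule law_decayed) (simp_all add: S_1)
    ultimately have "exp (- l) * s y / (1 + \<bar>Q y y\<bar>) \<le> 0" by simp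
    moreover have "0 < 1 + \<bar>Q y y\<bar>" by simp
    ultimately have "exp (- l) * s y \<le> 0" by (simp add: divide_le_0_iff)
    then have "s y \<le> 0" by (simp add: mult_le_0_iff)
    then show ?thesis using s_nonneg[of y] by simp
  qed
  have \<nu>_eq: "\<nu> y = l * V (- l) 0 y" for y
    by (rule left_solution_unique) (use s_0 \<nu>(2) in \<open>simp_all add: s_def\<close>)
  have \<nu>1: "0 < \<nu> 1" using \<nu>_eq[of 1] V_superdiag[of "- l" 0] Q_down[of 0] l by simp
  have surv: "survival (real n) 1 \<le> (1 / \<nu> 1) * exp (- l * real n)" for n
  proof -
    have "(\<Sum>x\<in>{1}. \<nu> x * survival (real n) x) \<le> S (real n)"
      unfolding sums_unique[OF S_sums] by (rule sum_le_suminf[OF sums_summable[OF S_sums]]) (auto simp: nn)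
    then show ?thesis using \<nu>1 by (simp add: S_nat field_simps)
  qed
  have "ereal l \<le> decay_parameter P X"
  proof (rule ereal_le_epsilon2)
    fix e :: real assume e: "0 < e"
    \<comment> \<open>A rate below \<open>l\<close> by at most \<open>e\<close> that is still
      positive even if \<open>e \<ge> l\<close>.\<close>
    define m where "m = max (l / 2) (l - e)"
    have m: "0 < m" "m < l" "l \<le> m + e" using l e by (auto simp: m_def)
    have "ereal m \<le> decay_parameter P X"
      unfolding decay_parameter_def
      by (rule SUP_upper) (use m exp_moment_finite[OF m(1,2) surv] in \<open>auto intro!: exI[of _ 1]\<close>)
    then have "ereal m + ereal e \<le> decay_parameter P X + ereal e" by (rule add_right_mono)
    moreover have "ereal l \<le> ereal m + ereal e" using m(3) by simp
    ultimately show "ereal l \<le> decay_parameter P X + ereal e" by (rule order_trans[rotated])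
  qed
  moreover have "\<nu> = nu P X Q l" by (intro ext) (simp add: nu_eq \<nu>_eq)
  ultimately show ?thesis using l by blast
qed

text \<open>In row \<open>1\<close>, dropping the nonnegative off-diagonal terms leaves
  \<open>Q 1 1 * f 1 \<le> - l * f 1\<close>.\<close>

lemma supersolution_rate_le: "supersolution l f \<Longrightarrow> l \<le> - Q 1 1"
proof -
  assume f: "supersolution l f"
  then have sm: "summable (\<lambda>w. Q 1 w * f w)" and le: "(\<Sum>w. Q 1 w * f w) \<le> - l * f 1" and pos: "\<And>x. 0 < f x"
    unfolding supersolution_def by (metis One_nat_def)+
  have "(\<Sum>w\<in>{1}. Q 1 w * f w) \<le> (\<Sum>w. Q 1 w * f w)"
    by (rule sum_le_suminf[OF sm]) (auto intro!: mult_nonneg_nonneg Q_nonneg less_imp_le[OF pos])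
  then have "Q 1 1 * f 1 \<le> - l * f 1" using le by simp
  then have "(l + Q 1 1) * f 1 \<le> 0" by (simp add: algebra_simps)
  then show ?thesis using pos[of 1] by (simp add: mult_le_0_iff)
qed

text \<open>The point is finiteness, so that \<open>real_of_ereal\<close> really returns the decay
  parameter. Every positive rate below an admissible \<open>k\<close> has a supersolution, whose
  rate is bounded.\<close>

lemma decay_parameter_le: "decay_parameter P X \<le> ereal (- Q 1 1)"
  unfolding decay_parameter_def
proof (rule SUP_least)
  fix k assume "k \<in> {l::real. 0 \<le> l \<and> (\<exists>x\<ge>1. (\<integral>\<^sup>+\<omega>. exp_ereal (ereal l * hit X {0} \<omega>) \<partial>P x) < \<infinity>)}"
  then obtain x where x: "1 \<le> x" "(\<integral>\<^sup>+\<omega>. exp_ereal (ereal k * hit X {0} \<omega>) \<partial>P x) < \<infinity>" by auto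
  have "l \<le> - Q 1 1" if "l < k" for l
  proof (cases "0 < l")
    case True
    then show ?thesis using ex_monotone_supersolution[OF _ that x] supersolution_rate_le by blast
  next
    case False
    then show ?thesis using supersolution_rate_le[OF supersolution_1] by simp
  qed
  then show "ereal k \<le> ereal (- Q 1 1)" by (simp add: dense_le)
qed

lemma decaying:
  assumes "0 < decay_parameter P X" "non_entrance P X Q"
  shows "decaying_skip_free_matrix Q (scale_nonneg P X Q 0) (real_of_ereal (decay_parameter P X))"
proof
  fix l assume l: "0 < l" "l < real_of_ereal (decay_parameter P X)"
  have "ereal l < decay_parameter P X" using l decay_parameter_le by (cases "decay_parameter P X") auto
  then obtain k x where "l < k" "1 \<le> x" "(\<integral>\<^sup>+\<omega>. exp_ereal (ereal k * hit X {0} \<omega>) \<partial>P x) < \<infinity>"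
    unfolding decay_parameter_def by (auto simp: less_SUP_iff)
  then show "\<exists>f. supersolution l f \<and> mono f" using ex_monotone_supersolution[OF l(1)] by blast
next
  show "\<not> summable (scale_nonneg P X Q 0 0)"
  proof
    assume "summable (scale_nonneg P X Q 0 0)"
    then have "(\<Sum>y. ennreal (scale_nonneg P X Q 0 0 y)) = ennreal (\<Sum>y. scale_nonneg P X Q 0 0 y)"
      by (intro suminf_ennreal_eq summable_sums W_nonneg)
    then show False using assms(2) by (simp add: non_entrance_def)
  qed
qed (rule Q_upward)

end

text \<open>Zeros could make inequalities between neighbouring states hold trivially. Positivity off
  \<open>0\<close> turns them into an order of the ratios of consecutive values, and at
  \<open>x = 0\<close> both sides vanish.\<close>

lemma lr_le_trans:
  assumes pos: "\<And>x. 0 < x \<Longrightarrow> 0 < \<mu> x" "\<And>x. 0 < x \<Longrightarrow> 0 < \<nu> x" "\<And>x. 0 < x \<Longrightarrow> 0 < \<kappa> x"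
    and zero: "\<mu> 0 = 0" "\<kappa> 0 = 0" and le: "lr_le \<mu> \<nu>" "lr_le \<nu> \<kappa>"
  shows "lr_le \<mu> \<kappa>"
  unfolding lr_le_def
proof
  fix x
  show "\<mu> (x + 1) * \<kappa> x \<le> \<mu> x * \<kappa> (x + 1)"
  proof (cases "x = 0")
    case False
    then have p: "0 < \<mu> x" "0 < \<nu> x" "0 < \<kappa> x" using pos by auto
    have "\<mu> (x + 1) / \<mu> x \<le> \<nu> (x + 1) / \<nu> x"
      using le(1) p by (simp add: lr_le_def field_simps)
    also have "\<dots> \<le> \<kappa> (x + 1) / \<kappa> x"
      using le(2) p by (simp add: lr_le_def field_simps)
    finally show ?thesis using p by (simp add: field_simps)
  qed (simp add: zero)
qed

text \<open>Both inequalities together make the ratios of consecutive values equal, so the two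
  vectors are proportional, and the total masses fix the factor \<open>1\<close>.\<close>

lemma lr_le_antisym:
  assumes pos: "\<And>x. 0 < x \<Longrightarrow> 0 < \<mu> x" "\<And>x. 0 < x \<Longrightarrow> 0 < \<nu> x"
    and zero: "\<mu> 0 = 0" "\<nu> 0 = 0" and le: "lr_le \<mu> \<nu>" "lr_le \<nu> \<mu>" and sums: "\<mu> sums 1" "\<nu> sums 1"
  shows "\<mu> = \<nu>"
proof -
  define c where "c = \<mu> 1 / \<nu> 1"
  have eq: "\<mu> (x + 1) * \<nu> x = \<mu> x * \<nu> (x + 1)" for x
    using le unfolding lr_le_def by (metis antisym mult.commute)
  have "\<mu> (Suc x) = c * \<nu> (Suc x)" for x
  proof (induction x)
    case 0 show ?case using pos(2)[of 1] by (simp add: c_def)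
  next
    case (Suc x)
    have "\<mu> (Suc (Suc x)) * \<nu> (Suc x) = c * \<nu> (Suc x) * \<nu> (Suc (Suc x))"
      using eq[of "Suc x"] Suc by simp
    then show ?case using pos(2)[of "Suc x"] by simp
  qed
  then have c: "\<mu> x = c * \<nu> x" for x using zero by (cases x) auto
  then have "\<mu> sums (c * 1)" using sums_mult[OF sums(2), of c] by (simp add: c[abs_def, symmetric])
  then have "c = 1" using sums_unique2[OF sums(1)] by simp
  then show ?thesis using c by auto
qed

theorem theorem1p8:
  fixes P :: "nat \<Rightarrow> 'a measure" and X :: "real \<Rightarrow> 'a \<Rightarrow> enat" and Q :: "nat \<Rightarrow> nat \<Rightarrow> real"
  assumes "downward_skip_free_chain P X Q"
    and "\<And>x. \<P>(\<omega> in P x. hit X {0} \<omega> < \<infinity>) = 1"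
    and "decay_parameter P X > 0"
    and "non_entrance P X Q"
  shows "(\<forall>l. 0 < l \<and> ereal l \<le> decay_parameter P X \<longrightarrow> prob_distribution (nu P X Q l)) \<and>
    (\<forall>l l'. 0 < l' \<and> l' \<le> l \<and> ereal l \<le> decay_parameter P X \<longrightarrow>
      lr_le (nu P X Q l) (nu P X Q l')) \<and>
    linear_order_on {\<nu>. quasi_stationary P X \<nu>}
      {(\<mu>, \<nu>). quasi_stationary P X \<mu> \<and> quasi_stationary P X \<nu> \<and> lr_le \<mu> \<nu>} \<and>
    quasi_stationary P X (nu P X Q (real_of_ereal (decay_parameter P X))) \<and>
    (\<forall>\<nu>. quasi_stationary P X \<nu> \<longrightarrow>
      lr_le (nu P X Q (real_of_ereal (decay_parameter P X))) \<nu>)"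
proof -
  interpret downward_skip_free_chain P X Q by fact
  interpret absorbed_chain P X Q by unfold_locales (rule assms(2))
  define l0 where "l0 = real_of_ereal (decay_parameter P X)"
  have l0: "ereal l0 = decay_parameter P X" "0 < l0"
    using assms(3) decay_parameter_le by (cases "decay_parameter P X"; simp add: l0_def)+
  interpret decaying_skip_free_matrix Q "scale_nonneg P X Q 0" l0
    unfolding l0_def by (rule decaying[OF assms(3,4)])
  have le: "l \<le> l0" if "ereal l \<le> decay_parameter P X" for l using that l0(1) by (metis ereal_less_eq(3))
  have prob: "prob_distribution (nu P X Q l)" if "0 < l" "l \<le> l0" for l
    using V_sums[OF that] V_nonneg[OF that] that(1) by (simp add: prob_distribution_def nu_eq[abs_def])
  have lr: "lr_le (nu P X Q l) (nu P X Q l')" if l: "0 < l'" "l' \<le> l" "l \<le> l0" for l l'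
    unfolding lr_le_def
  proof
    fix x
    have "l * l' * (V (- l) 0 (Suc x) * V (- l') 0 x) \<le> l * l' * (V (- l) 0 x * V (- l') 0 (Suc x))"
      using l by (intro mult_left_mono V_lr) auto
    then show "nu P X Q l (x + 1) * nu P X Q l' x \<le> nu P X Q l x * nu P X Q l' (x + 1)"
      by (simp add: nu_eq mult_ac)
  qed
  have qs_nu: "\<exists>l>0. l \<le> l0 \<and> \<nu> = nu P X Q l" if "quasi_stationary P X \<nu>" for \<nu>
    using quasi_stationary_imp_nu[OF that] le by blast
  have qs_l0: "quasi_stationary P X (nu P X Q l0)"
  proof (rule quasi_stationary_if_left_solution[OF prob])
    show "(\<Sum>x\<le>Suc y. nu P X Q l0 x * Q x y) = (if y = 0 then l0 else 0) - l0 * nu P X Q l0 y" for y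
    proof -
      have "(\<Sum>x\<le>Suc y. nu P X Q l0 x * Q x y) = l0 * (\<Sum>x\<le>Suc y. V (- l0) 0 x * Q x y)"
        unfolding nu_eq sum_distrib_left by (simp only: mult.assoc)
      also have "\<dots> = l0 * ((if 0 = y then 1 else 0) + - l0 * V (- l0) 0 y)" unfolding V_Q ..
      finally show ?thesis by (simp add: nu_eq algebra_simps)
    qed
    show "nu P X Q l0 0 = 0" by (simp add: nu_eq V_zero)
  qed (use l0 in auto)
  have qs_pos: "0 < \<nu> x" if "quasi_stationary P X \<nu>" "0 < x" for \<nu> x
    using qs_nu[OF that(1)] V_0_pos that(2) by (auto simp: nu_eq)
  have qs_0: "\<nu> 0 = 0" and qs_sums: "\<nu> sums 1" if "quasi_stationary P X \<nu>" for \<nu>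
    using that by (auto simp: quasi_stationary_iff prob_distribution_def)
  have "linear_order_on {\<nu>. quasi_stationary P X \<nu>}
      {(\<mu>, \<nu>). quasi_stationary P X \<mu> \<and> quasi_stationary P X \<nu> \<and> lr_le \<mu> \<nu>}"
    unfolding linear_order_on_def partial_order_on_def preorder_on_def
  proof (intro conjI)
    show "refl_on {\<nu>. quasi_stationary P X \<nu>} {(\<mu>, \<nu>). quasi_stationary P X \<mu> \<and> quasi_stationary P X \<nu> \<and> lr_le \<mu> \<nu>}"
      by (auto simp: refl_on_def lr_le_def)
    show "trans {(\<mu>, \<nu>). quasi_stationary P X \<mu> \<and> quasi_stationary P X \<nu> \<and> lr_le \<mu> \<nu>}"
    proof (rule transI, clarify)
      fix \<mu> \<nu> \<kappa> assume q: "quasi_stationary P X \<mu>" "quasi_stationary P X \<nu>" "quasi_stationary P X \<kappa>"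
        and "lr_le \<mu> \<nu>" "lr_le \<nu> \<kappa>"
      then show "lr_le \<mu> \<kappa>" by (intro lr_le_trans[of \<mu> \<nu> \<kappa>] qs_pos qs_0)
    qed
    show "antisym {(\<mu>, \<nu>). quasi_stationary P X \<mu> \<and> quasi_stationary P X \<nu> \<and> lr_le \<mu> \<nu>}"
    proof (rule antisymI, clarify)
      fix \<mu> \<nu> assume "quasi_stationary P X \<mu>" "quasi_stationary P X \<nu>" "lr_le \<mu> \<nu>" "lr_le \<nu> \<mu>"
      then show "\<mu> = \<nu>" by (intro lr_le_antisym qs_pos qs_0 qs_sums)
    qed
    show "total_on {\<nu>. quasi_stationary P X \<nu>} {(\<mu>, \<nu>). quasi_stationary P X \<mu> \<and> quasi_stationary P X \<nu> \<and> lr_le \<mu> \<nu>}"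
      unfolding total_on_def
    proof (clarify)
      fix \<mu> \<nu> assume q: "quasi_stationary P X \<mu>" "quasi_stationary P X \<nu>" "\<not> lr_le \<nu> \<mu>"
      obtain l m where "0 < l" "l \<le> l0" "\<mu> = nu P X Q l" "0 < m" "m \<le> l0" "\<nu> = nu P X Q m"
        using qs_nu q(1,2) by metis
      \<comment> \<open>Larger rates are smaller in the order: \<open>l \<le> m\<close> would give
        \<open>lr_le \<nu> \<mu>\<close>, which is excluded, so \<open>m < l\<close>.\<close>
      then show "lr_le \<mu> \<nu>" using lr[of l m] lr[of m l] q(3) by (cases "l \<le> m") auto
    qed
  qed auto
  moreover have "lr_le (nu P X Q l0) \<nu>" if "quasi_stationary P X \<nu>" for \<nu>
    using qs_nu[OF that] lr[of _ l0] by auto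
  ultimately show ?thesis
    using prob lr le qs_l0 unfolding l0_def[symmetric] by blast
qed

end
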